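(* There is a universal constant $C>0$ such that the following holds. Let $\mathbf{A}\in\mathbb{R}^{d\times d}$ be symmetric positive definite with eigenvalues $\lambda_1\ge\cdots\ge\lambda_d$ and $\kappa=\lambda_1/\lambda_d$. Let $\mathbf{b}^{(1)},\dots,\mathbf{b}^{(m)}\in\mathbb{R}^d$ be independent standard Gaussian random vectors, $r\ge0$, and $\delta\in(0,1)$. Then, for some $$s\le C\left(\frac rm\log\left(\frac1\Delta\right)+\log\left(\frac d\delta\right)\right),\qquad\Delta:=\min_{i=1,\dots,(m-1)\lceil r/(m-1)\rceil-1}\frac{\lambda_i-\lambda_{i+1}}{\lambda_1},$$ with probability at least $1-\delta$, the block-Lanczos square root iterates $\mathrm{bsq}_t^{(i)}$ for $\mathbf{B}=[\mathbf{b}^{(1)}~\cdots~\mathbf{b}^{(m)}]$ satisfy $$\left\{\forall i:\ \frac{\|\mathbf{A}^{1/2}\mathbf{b}^{(i)}-\mathrm{bsq}_t^{(i)}\|}{\|\mathbf{A}^{1/2}\|\,\|\mathbf{b}^{(i)}\|}\le\log(16\kappa)\exp\left(-\frac{t-s}{3\sqrt{\kappa_{r+1}(0)}}\right)\right\}.$$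
   Context: $\mathbf{A}_\mu=\mathbf{A}+\mu\mathbf{I}$; $\kappa_{r+1}(\mu)=(\lambda_{r+1}+\mu)/(\lambda_d+\mu)$, so $\kappa_{r+1}(0)=\lambda_{r+1}/\lambda_d$; $\|\cdot\|$ is the Euclidean norm for vectors and the spectral norm for matrices; $\|\mathbf{x}\|_{\mathbf{M}}=\sqrt{\mathbf{x}^{\mathsf T}\mathbf{M}\mathbf{x}}$. The quantities $r,m,s,t$ are integers, $m\ge2$, $t\ge 0$, and all eigenvalue indices that appear are understood to lie in $\{1,\dots,d\}$. The term $\frac rm\log(1/\Delta)$ is read as $0$ if the minimum defining $\Delta$ is over an empty set, and as $+\infty$ if $\Delta=0$. $\log$ is the natural logarithm. Krylov subspaces: $\mathcal{K}_t(\mathbf{M},\mathbf{v})=\operatorname{span}\{\mathbf{v},\mathbf{M}\mathbf{v},\dots,\mathbf{M}^{t-1}\mathbf{v}\}$, and for a matrix $\mathbf{V}$ with columns $\mathbf{v}^{(1)},\dots,\mathbf{v}^{(k)}$, $\mathcal{K}_t(\mathbf{M},\mathbf{V})=\mathcal{K}_t(\mathbf{M},\mathbf{v}^{(1)})+\cdots+\mathcal{K}_t(\mathbf{M},\mathbf{v}^{(k)})$. Block-CG: for $\mathbf{B}=[\mathbf{b}^{(1)}~\cdots~\mathbf{b}^{(m)}]$, $\mathrm{bcg}_t^{(i)}(\mu)=\operatorname{argmin}\{\|\mathbf{A}_\mu^{-1}\mathbf{b}^{(i)}-\mathbf{x}\|_{\mathbf{A}_\mu}:\mathbf{x}\in\mathcal{K}_t(\mathbf{A}_\mu,\mathbf{B})\}$.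 Block-Lanczos square root iterate: $\mathrm{bsq}_t^{(i)}:=\frac2\pi\int_0^\infty\mathbf{A}\,\mathrm{bcg}_t^{(i)}(z^2)\,\mathrm{d}z$. *)

theory Defs
  imports
    "HOL-Probability.Characteristic_Functions"
    "Jordan_Normal_Form.Matrix"
    "Jordan_Normal_Form.VS_Connect"
    "Jordan_Normal_Form.Char_Poly"
    "Jordan_Normal_Form.Gauss_Jordan_Elimination"
begin

text \<open>
  Matrices and vectors carry their dimensions as values (rather than types), because the constant
  in the theorem must be chosen before the dimension.  Vector entries and matrix columns are
  0-based; eigenvalues are 1-based.
\<close>

no_notation vec_nth (infixl \<open>$\<close> 90)
no_notation inner (infix \<open>\<bullet>\<close> 70)
hide_type (open) Finite_Cartesian_Product.vec
hide_const (open) Finite_Cartesian_Product.vec Determinants.det Finite_Cartesian_Product.mat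


subsection \<open>Linear algebra\<close>

definition norm2 :: "real vec \<Rightarrow> real" where
  "norm2 v = sqrt (v \<bullet> v)"

definition mat_norm :: "real mat \<Rightarrow> real \<comment> \<open>spectral norm\<close>" where
  "mat_norm A = (SUP x\<in>carrier_vec (dim_col A). norm2 (A *\<^sub>v x) / norm2 x)"

definition weighted_norm :: "real mat \<Rightarrow> real vec \<Rightarrow> real" where
  "weighted_norm M x = sqrt (x \<bullet> (M *\<^sub>v x))"

definition symmetric_pos_semidef :: "nat \<Rightarrow> real mat \<Rightarrow> bool" where
  "symmetric_pos_semidef d A \<longleftrightarrow> A \<in> carrier_mat d d \<and> A\<^sup>T = A \<and>
     (\<forall>x\<in>carrier_vec d. x \<bullet> (A *\<^sub>v x) \<ge> 0)"

definition symmetric_pos_def :: "nat \<Rightarrow> real mat \<Rightarrow> bool" where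
  "symmetric_pos_def d A \<longleftrightarrow> A \<in> carrier_mat d d \<and> A\<^sup>T = A \<and>
     (\<forall>x\<in>carrier_vec d. x \<noteq> 0\<^sub>v d \<longrightarrow> x \<bullet> (A *\<^sub>v x) > 0)"

definition mat_sqrt :: "real mat \<Rightarrow> real mat" where
  "mat_sqrt A = (THE S. symmetric_pos_semidef (dim_row A) S \<and> S * S = A)"

text \<open>The eigenvalues are counted with algebraic multiplicity; only \<open>ev 1, \<dots>, ev d\<close> are relevant.\<close>

definition ordered_eigenvalues :: "nat \<Rightarrow> real mat \<Rightarrow> (nat \<Rightarrow> real) \<Rightarrow> bool" where
  "ordered_eigenvalues d A ev \<longleftrightarrow>
     char_poly A = (\<Prod>i\<in>{1..d}. [:- ev i, 1:]) \<and> (\<forall>i\<in>{1..<d}. ev (i + 1) \<le> ev i)"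

definition shifted :: "real mat \<Rightarrow> real \<Rightarrow> real mat" where
  "shifted A \<mu> = A + \<mu> \<cdot>\<^sub>m 1\<^sub>m (dim_row A)"

definition shifted_cond :: "nat \<Rightarrow> (nat \<Rightarrow> real) \<Rightarrow> nat \<Rightarrow> real \<Rightarrow> real" where
  "shifted_cond d ev k \<mu> = (ev k + \<mu>) / (ev d + \<mu>)"


subsection \<open>Krylov subspaces and block methods\<close>

abbreviation vec_span :: "nat \<Rightarrow> real vec set \<Rightarrow> real vec set" where
  "vec_span d \<equiv> LinearCombinations.module.span class_ring (module_vec TYPE(real) d)"

definition krylov :: "nat \<Rightarrow> real mat \<Rightarrow> real vec \<Rightarrow> real vec set" where
  "krylov t M v = vec_span (dim_row M) {(M ^\<^sub>m k) *\<^sub>v v | k. k < t}"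

definition block_krylov :: "nat \<Rightarrow> real mat \<Rightarrow> real mat \<Rightarrow> real vec set" where
  "block_krylov t M V =
     {finsum_vec TYPE(real) (dim_row M) x {..<dim_col V} | x.
        \<forall>j<dim_col V. x j \<in> krylov t M (col V j)}"

text \<open>For positive definite shifted matrices the inverse exists and the minimizer is unique.\<close>

definition bcg :: "real mat \<Rightarrow> real mat \<Rightarrow> nat \<Rightarrow> nat \<Rightarrow> real \<Rightarrow> real vec" where
  "bcg A B t i \<mu> =
     arg_min (\<lambda>x. weighted_norm (shifted A \<mu>) (the (mat_inverse (shifted A \<mu>)) *\<^sub>v col B i - x))
             (\<lambda>x. x \<in> block_krylov t (shifted A \<mu>) B)"

text \<open>The vector-valued integral is taken entrywise.\<close>

definition bsq :: "real mat \<Rightarrow> real mat \<Rightarrow> nat \<Rightarrow> nat \<Rightarrow> real vec" where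
  "bsq A B t i =
     vec (dim_row A) (\<lambda>j. 2 / pi * (LBINT z:{0..}. (A *\<^sub>v bcg A B t i (z\<^sup>2)) $ j))"


subsection \<open>The eigenvalue gap\<close>

definition gap_top :: "nat \<Rightarrow> nat \<Rightarrow> nat" where
  "gap_top r m = (m - 1) * nat \<lceil>real r / real (m - 1)\<rceil>"

definition eigen_gap :: "(nat \<Rightarrow> real) \<Rightarrow> nat \<Rightarrow> nat \<Rightarrow> real" where
  "eigen_gap ev r m = Min ((\<lambda>i. (ev i - ev (i + 1)) / ev 1) ` {1..<gap_top r m})"

text \<open>
  \<open>(r / m) log (1 / \<Delta>)\<close>, read as 0 if the minimum is over the empty set, and as \<open>\<infinity>\<close> if \<open>\<Delta> = 0\<close>.
\<close>

definition gap_term :: "(nat \<Rightarrow> real) \<Rightarrow> nat \<Rightarrow> nat \<Rightarrow> ereal" where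
  "gap_term ev r m =
     (if {1..<gap_top r m} = {} then 0
      else if eigen_gap ev r m = 0 then \<infinity>
      else ereal (real r / real m * ln (1 / eigen_gap ev r m)))"


subsection \<open>Gaussian block\<close>

text \<open>
  The joint law of the \<open>d \<cdot> m\<close> independent standard normal entries of \<open>m\<close> independent standard
  Gaussian vectors in dimension \<open>d\<close>; the outcome \<open>\<omega> (j, i)\<close> is entry \<open>j\<close> of vector \<open>i\<close>.  Working with
  the law itself keeps the constant in the theorem independent of any sample space.
\<close>

definition gaussian_law :: "nat \<Rightarrow> nat \<Rightarrow> (nat \<times> nat \<Rightarrow> real) measure" where
  "gaussian_law d m = (\<Pi>\<^sub>M k\<in>{..<d} \<times> {..<m}. std_normal_distribution)"

definition block_of :: "nat \<Rightarrow> nat \<Rightarrow> (nat \<times> nat \<Rightarrow> real) \<Rightarrow> real mat" where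
  "block_of d m \<omega> = mat d m \<omega>"

text \<open>Independent standard normal entries on any probability space have this joint law.\<close>

lemma gaussian_law_unique:
  fixes X :: "nat \<times> nat \<Rightarrow> 'w \<Rightarrow> real"
  assumes "prob_space M" "d > 0" "m > 0"
    and indep: "prob_space.indep_vars M (\<lambda>_. borel) X ({..<d} \<times> {..<m})"
    and normal: "\<And>k. k \<in> {..<d} \<times> {..<m} \<Longrightarrow> distributed M lborel (X k) std_normal_density"
  shows "distr M (\<Pi>\<^sub>M k\<in>{..<d} \<times> {..<m}. borel) (\<lambda>w. \<lambda>k\<in>{..<d} \<times> {..<m}. X k w) = gaussian_law d m"
proof -
  interpret prob_space M by fact
  let ?J = "{..<d} \<times> {..<m}"
  have "(0, 0) \<in> ?J" using assms(2,3) by auto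
  hence ne: "?J \<noteq> {}" by blast
  have rv: "\<And>k. k \<in> ?J \<Longrightarrow> random_variable borel (X k)"
    using normal by (auto simp: distributed_def)
  have "distr M (\<Pi>\<^sub>M k\<in>?J. borel) (\<lambda>w. \<lambda>k\<in>?J. X k w) = (\<Pi>\<^sub>M k\<in>?J. distr M borel (X k))"
    using indep_vars_iff_distr_eq_PiM'[OF ne rv] indep by simp
  also have "\<dots> = gaussian_law d m"
    unfolding gaussian_law_def
  proof (rule PiM_cong)
    fix k assume k: "k \<in> ?J"
    have "distr M borel (X k) = distr M lborel (X k)" by (rule distr_cong) auto
    also have "\<dots> = std_normal_distribution" using normal[OF k] by (simp add: distributed_def)
    finally show "distr M borel (X k) = std_normal_distribution" .
  qed simp
  finally show ?thesis .
qed

end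

theory Submission
  imports Defs "Jordan_Normal_Form.Schur_Decomposition"
begin

text \<open>
  Expand everything in an orthonormal eigenbasis \<open>v 1, \<dots>, v d\<close> of \<open>A\<close>.  The elements of the block Krylov
  space are the vectors \<open>\<Sum>\<^sub>l P\<^sub>l(A) b\<^sub>l\<close> with polynomials \<open>P\<^sub>l\<close> of degree below \<open>t\<close>, for every shift alike, and the
  block-CG error at shift \<open>\<mu>\<close> is the least-squares residual of \<open>(A + \<mu>)\<^sup>-\<^sup>1 b\<close> in the energy norm.  Hence every choice
  of the \<open>P\<^sub>l\<close> gives an upper bound for it.

  Deflation (\<open>cg_residual_deflation_bound\<close>, \<open>cg_energy_deflated\<close>).  Call an eigenvalue large if it exceeds
  \<open>4 \<lambda>\<^sub>r\<^sub>+\<^sub>1\<close>.  Suppose the Krylov space contains, for each large \<open>\<lambda>\<^sub>j\<close>, a vector whose coordinates at the large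
  eigenvalues are those of \<open>v j\<close> and whose other coordinates are at most \<open>1/(40 d)\<close>.  Let \<open>\<rho>\<close> be a Chebyshev polynomial
  on \<open>[\<lambda>\<^sub>d, 4 \<lambda>\<^sub>r\<^sub>+\<^sub>1]\<close> with \<open>\<rho>(-\<mu>) = 1\<close>.  Correcting the polynomial approximation with error \<open>\<rho>(A)(A + \<mu>)\<^sup>-\<^sup>1 b\<close> by \<open>\<rho>(A)\<close> applied to
  these vectors makes the large coordinates of the error vanish and leaves a factor \<open>41/20 exp(-(t - s)/(3 \<surd>\<kappa>\<^sub>r\<^sub>+\<^sub>1))\<close>,
  uniformly in \<open>\<mu> \<ge> 0\<close>.  Because \<open>A\<^sup>1\<^sup>/\<^sup>2 b\<close> is \<open>2/\<pi>\<close> times the integral of \<open>A (A + z\<^sup>2)\<^sup>-\<^sup>1 b\<close>, Minkowski's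
  inequality and an elliptic integral turn this into the stated error with the factor \<open>log(16 \<kappa>)\<close>
  (\<open>bsq_error_bound\<close>, \<open>relative_error_bound\<close>).

  The approximate eigenvectors (\<open>approximate_top_eigenvectors\<close>).  Put \<open>x\<^sub>i = \<lambda>\<^sub>i/\<lambda>\<^sub>1\<close>, \<open>q = \<lceil>r/(m-1)\<rceil>\<close>, and let
  row \<open>i\<close> be the vector with entries \<open>\<langle>v i, b\<^sub>l\<rangle> x\<^sub>i\<^sup>a\<close> for \<open>l < m-1\<close>, \<open>a < q\<close>.  If row \<open>j\<close> has distance at least
  \<open>\<surd>\<eta>\<close> from the span of the other top rows, then the normalised residual gives a Krylov vector that agrees with \<open>v j\<close> at
  these indices and is of moderate size elsewhere; multiplication by \<open>(A/\<lambda>\<^sub>j)\<^sup>s\<^sup>'\<close> then makes it small at the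
  eigenvalues up to \<open>\<lambda>\<^sub>r\<^sub>+\<^sub>1\<close>.  Not all rows need to be well separated: fewer than \<open>q\<close> indices may be given up, since they can
  be handled by additional zeros of \<open>\<rho>\<close>.

  Why giving up fewer than \<open>q\<close> indices suffices (\<open>exists_well_conditioned_rows\<close>).  Otherwise one can remove, one after
  the other, \<open>q\<close> indices whose rows are all close to the span of those that remain.  Row \<open>j\<close> depends affinely on the
  Gaussian variable \<open>\<langle>v j, b\<^sub>l\<rangle>\<close>, with slope the node vector \<open>e\<^sub>l \<otimes> (x\<^sub>j\<^sup>a)\<^sub>a\<close>, and the span of the remaining rows does not
  depend on it.  So, unless the node vector is itself close to that span, the row is close to it only with small
  probability; this is the line bound \<open>std_normal_prod_line_bound\<close>.  Outside a small event, then, all node vectors of the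
  \<open>q\<close> removed indices are close to the span of at most \<open>r - 1\<close> rows in a space of dimension \<open>(m-1) q \<ge> r\<close>.  A vector
  orthogonal to these rows consists of \<open>m-1\<close> polynomials of degree below \<open>q\<close> that are small at \<open>q\<close> separated points, hence
  has small coefficients, which is absurd.

  A union bound over at most \<open>r\<^sup>q\<^sup>+\<^sup>1 (m-1)\<close> such events and the choice of all parameters cost
  \<open>s = O(r/m log(1/\<Delta>) + log(d/\<delta>))\<close> iterations (\<open>iteration_count_bound\<close>); here \<open>log r\<close> is absorbed because
  \<open>((m-1) q - 1) \<Delta> \<le> 1\<close>.  If \<open>\<Delta> = 0\<close>, then \<open>s = d\<close> is permitted and \<open>d\<close> steps are exact; if \<open>r = 0\<close>,
  nothing needs to be deflated.
\<close>


section \<open>Least-squares residuals\<close>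

definition ip :: "'x set \<Rightarrow> ('x \<Rightarrow> real) \<Rightarrow> ('x \<Rightarrow> real) \<Rightarrow> ('x \<Rightarrow> real) \<Rightarrow> real" where
  "ip X c f g = (\<Sum>x\<in>X. c x * f x * g x)"

text \<open>
  Gram--Schmidt without a rank assumption: a direction that is already in the span of the others has residual zero,
  its quotient \<open>x / 0\<close> is \<open>0\<close>, and the step leaves \<open>f\<close> unchanged.  The explicit recursion, as opposed to a choice of a
  minimiser, makes the residual a measurable function of all its data.
\<close>

fun residual :: "'x set \<Rightarrow> ('x \<Rightarrow> real) \<Rightarrow> ('x \<Rightarrow> real) list \<Rightarrow> ('x \<Rightarrow> real) \<Rightarrow> 'x \<Rightarrow> real" where
  "residual X c [] f = f"
| "residual X c (w # ws) f =
     (\<lambda>x. residual X c ws f x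
        - ip X c (residual X c ws f) (residual X c ws w) / ip X c (residual X c ws w) (residual X c ws w)
          * residual X c ws w x)"

lemma ip_commute: "ip X c f g = ip X c g f"
  by (simp add: ip_def mult_ac)

lemma ip_add_left: "ip X c (\<lambda>x. f x + g x) h = ip X c f h + ip X c g h"
  by (simp add: ip_def algebra_simps sum.distrib)

lemma ip_diff_left: "ip X c (\<lambda>x. f x - g x) h = ip X c f h - ip X c g h"
  by (simp add: ip_def algebra_simps sum_subtractf)

lemma ip_scale_left: "ip X c (\<lambda>x. a * f x) h = a * ip X c f h"
  by (simp add: ip_def algebra_simps sum_distrib_left)

lemma ip_sum_left: "ip X c (\<lambda>x. \<Sum>i\<in>I. f i x) h = (\<Sum>i\<in>I. ip X c (f i) h)"
proof (cases "finite I")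
  case True
  then show ?thesis by induction (simp_all add: ip_add_left, simp add: ip_def)
qed (simp add: ip_def)

lemma ip_diff_right: "ip X c h (\<lambda>x. f x - g x) = ip X c h f - ip X c h g"
  by (simp add: ip_diff_left ip_commute[of _ _ h])

lemma ip_scale_right: "ip X c h (\<lambda>x. a * f x) = a * ip X c h f"
  by (simp add: ip_scale_left ip_commute[of _ _ h])

lemma ip_sum_right: "ip X c h (\<lambda>x. \<Sum>i\<in>I. f i x) = (\<Sum>i\<in>I. ip X c h (f i))"
  by (simp add: ip_sum_left ip_commute[of _ _ h])

lemma ip_self_nonneg:
  assumes "\<And>x. x \<in> X \<Longrightarrow> c x > 0"
  shows "ip X c f f \<ge> 0"
  unfolding ip_def by (intro sum_nonneg) (use assms in \<open>force simp: mult.assoc intro: less_imp_le\<close>)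

lemma ip_self_eq_0:
  assumes "finite X" "\<And>x. x \<in> X \<Longrightarrow> c x > 0" "ip X c f f = 0" "x \<in> X"
  shows "f x = 0"
proof -
  have "\<forall>x\<in>X. c x * f x * f x = 0"
    using assms(3) unfolding ip_def
    by (subst (asm) sum_nonneg_eq_0_iff) (use assms in \<open>force simp: mult.assoc intro: less_imp_le\<close>)+
  then show ?thesis using assms by force
qed

text \<open>
  This is what makes the division by zero in \<open>residual\<close> harmless.
\<close>

lemma ip_eq_0_of_self:
  assumes "finite X" "\<And>x. x \<in> X \<Longrightarrow> c x > 0" "ip X c g g = 0"
  shows "ip X c f g = 0"
  unfolding ip_def by (intro sum.neutral) (use ip_self_eq_0[OF assms] in auto)

lemma residual_in_span:
  "\<exists>y. \<forall>x. residual X c ws f x = f x - (\<Sum>k<length ws. y k * (ws ! k) x)"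
proof (induction ws arbitrary: f)
  case (Cons w ws)
  obtain y where y: "\<And>x. residual X c ws f x = f x - (\<Sum>k<length ws. y k * (ws ! k) x)"
    using Cons by blast
  obtain z where z: "\<And>x. residual X c ws w x = w x - (\<Sum>k<length ws. z k * (ws ! k) x)"
    using Cons by blast
  define a where "a = ip X c (residual X c ws f) (residual X c ws w) / ip X c (residual X c ws w) (residual X c ws w)"
  have "residual X c (w # ws) f x = f x - (\<Sum>k<length (w # ws). (case k of 0 \<Rightarrow> a | Suc k \<Rightarrow> y k - a * z k) * ((w # ws) ! k) x)" for x
    by (simp add: y z a_def[symmetric] sum.lessThan_Suc_shift del: sum.lessThan_Suc)
       (simp add: algebra_simps sum_subtractf sum_distrib_left)
  then show ?case by blast
qed simp

lemma residual_orthogonal: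
  assumes "finite X" "\<And>x. x \<in> X \<Longrightarrow> c x > 0" "w \<in> set ws"
  shows "ip X c (residual X c ws f) w = 0"
  using assms(3)
proof (induction ws arbitrary: f w)
  case (Cons v ws)
  let ?f = "residual X c ws f" and ?v = "residual X c ws v"
  have old: "ip X c (residual X c (v # ws) f) u = 0" if "u \<in> set ws" for u
    using Cons.IH[OF that] by (simp add: ip_diff_left ip_scale_left del: times_divide_eq_left)
  have v': "ip X c (residual X c (v # ws) f) ?v = 0"
    unfolding residual.simps ip_diff_left ip_scale_left
    using ip_eq_0_of_self[where g = ?v and f = ?f and X = X and c = c] assms(1,2)
    by (cases "ip X c ?v ?v = 0") simp_all
  obtain z where z: "\<And>x. ?v x = v x - (\<Sum>k<length ws. z k * (ws ! k) x)"
    using residual_in_span by blast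
  have "ip X c (residual X c (v # ws) f) v
      = ip X c (residual X c (v # ws) f) ?v + (\<Sum>k<length ws. z k * ip X c (residual X c (v # ws) f) (ws ! k))"
    unfolding z ip_diff_right ip_sum_right ip_scale_right by simp
  also have "\<dots> = 0" using v' old by simp
  finally show ?case using Cons.prems old by auto
qed simp

lemma residual_orthogonal_combination:
  assumes "finite X" "\<And>x. x \<in> X \<Longrightarrow> c x > 0" "set us \<subseteq> set ws"
  shows "ip X c (residual X c ws f) (\<lambda>x. \<Sum>k<length us. y k * (us ! k) x) = 0"
  unfolding ip_sum_right ip_scale_right
  by (intro sum.neutral) (use residual_orthogonal[OF assms(1,2)] assms(3) in \<open>auto simp: subset_eq\<close>)

lemma residual_affine:
  "residual X c ws (\<lambda>x. f x + t * g x) x = residual X c ws f x + t * residual X c ws g x"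
proof (induction ws arbitrary: x)
  case (Cons w ws)
  then have "residual X c ws (\<lambda>x. f x + t * g x) = (\<lambda>x. residual X c ws f x + t * residual X c ws g x)"
    by (rule ext)
  then show ?case by (simp add: ip_add_left ip_scale_left algebra_simps add_divide_distrib)
qed simp

text \<open>
  Pythagoras: the difference of two elements of the affine space \<open>f + span ws\<close> lies in the span, and the residual is
  orthogonal to it.
\<close>

lemma residual_minimal:
  assumes X: "finite X" "\<And>x. x \<in> X \<Longrightarrow> c x > 0"
    and g: "\<And>x. x \<in> X \<Longrightarrow> g x = f x - (\<Sum>k<length us. y k * (us ! k) x)" and us: "set us \<subseteq> set ws"
  shows "ip X c g g = ip X c (residual X c ws f) (residual X c ws f)
           + ip X c (\<lambda>x. g x - residual X c ws f x) (\<lambda>x. g x - residual X c ws f x)"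
proof -
  let ?f = "residual X c ws f"
  obtain z where z: "\<And>x. ?f x = f x - (\<Sum>k<length ws. z k * (ws ! k) x)"
    using residual_in_span by blast
  have "ip X c ?f (\<lambda>x. g x - ?f x)
      = ip X c ?f (\<lambda>x. (\<Sum>k<length ws. z k * (ws ! k) x) - (\<Sum>k<length us. y k * (us ! k) x))"
    unfolding ip_def by (intro sum.cong) (use g z in auto)
  also have "\<dots> = 0"
    unfolding ip_diff_right using residual_orthogonal_combination[OF X] us by simp
  finally have 0: "ip X c ?f (\<lambda>x. g x - ?f x) = 0" .
  have "ip X c g g = ip X c ?f ?f + ip X c (\<lambda>x. g x - ?f x) (\<lambda>x. g x - ?f x) + 2 * ip X c ?f (\<lambda>x. g x - ?f x)"
    by (simp add: ip_def sum.distrib[symmetric] sum_distrib_left algebra_simps)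
  with 0 show ?thesis by simp
qed

lemma residual_minimal_le:
  assumes X: "finite X" "\<And>x. x \<in> X \<Longrightarrow> c x > 0"
    and g: "\<And>x. x \<in> X \<Longrightarrow> g x = f x - (\<Sum>k<length us. y k * (us ! k) x)" and us: "set us \<subseteq> set ws"
  shows "ip X c (residual X c ws f) (residual X c ws f) \<le> ip X c g g"
  using residual_minimal[OF assms] ip_self_nonneg[of X c "\<lambda>x. g x - residual X c ws f x"] X(2) by simp

text \<open>
  The left-hand side is the trace of the projection onto the orthogonal complement of \<open>ws\<close>; every step of the
  recursion lowers the trace by at most one.  It replaces a dimension argument: if there are fewer vectors than
  coordinates, some unit vector has a nonzero residual.
\<close>

lemma sum_residual_basis:
  assumes "finite X"
  shows "(\<Sum>x\<in>X. ip X (\<lambda>_. 1) (residual X (\<lambda>_. 1) ws (indicator {x})) (residual X (\<lambda>_. 1) ws (indicator {x})))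
           \<ge> real (card X) - real (length ws)"
proof (induction ws)
  case Nil
  have "ip X (\<lambda>_. 1) (indicator {x}) (indicator {x}) = 1" if "x \<in> X" for x
    using that assms by (simp add: ip_def indicator_def of_bool_def if_distrib[of "\<lambda>u. _ * u"] cong: if_cong)
  then show ?case by simp
next
  case (Cons w ws)
  let ?ip = "ip X (\<lambda>_. 1)" and ?r = "residual X (\<lambda>_. 1) ws"
  let ?n = "?ip (?r w) (?r w)"
  have proj: "?ip (?r (indicator {x})) (?r w) = ?r w x" if x: "x \<in> X" for x
  proof -
    obtain z where z: "\<And>y. ?r (indicator {x}) y = indicator {x} y - (\<Sum>k<length ws. z k * (ws ! k) y)"
      using residual_in_span by blast
    have "?ip (?r w) (?r (indicator {x})) = ?ip (?r w) (indicator {x})"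
      unfolding z ip_diff_right
      using residual_orthogonal_combination[OF assms, of "\<lambda>_. 1" ws ws w z] by simp
    also have "\<dots> = ?r w x"
      using x assms by (simp add: ip_def indicator_def of_bool_def if_distrib[of "\<lambda>u. _ * u"] cong: if_cong)
    finally show ?thesis by (simp add: ip_commute)
  qed
  have step: "?ip (residual X (\<lambda>_. 1) (w # ws) f) (residual X (\<lambda>_. 1) (w # ws) f)
     = ?ip (?r f) (?r f) - (?ip (?r f) (?r w))\<^sup>2 / ?n" for f
  proof -
    define a where "a = ?ip (?r f) (?r w) / ?n"
    have "?ip (\<lambda>x. ?r f x - a * ?r w x) (\<lambda>x. ?r f x - a * ?r w x)
      = ?ip (?r f) (?r f) - 2 * a * ?ip (?r f) (?r w) + a\<^sup>2 * ?n"
      by (simp add: ip_diff_left ip_diff_right ip_scale_left ip_scale_right ip_commute[of _ _ "?r w" "?r f"]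
           algebra_simps power2_eq_square)
    then have "?ip (residual X (\<lambda>_. 1) (w # ws) f) (residual X (\<lambda>_. 1) (w # ws) f)
      = ?ip (?r f) (?r f) - 2 * a * ?ip (?r f) (?r w) + a\<^sup>2 * ?n"
      by (simp only: residual.simps a_def)
    then show ?thesis unfolding a_def by (cases "?n = 0") (auto simp: power2_eq_square field_simps)
  qed
  have "(\<Sum>x\<in>X. (?ip (?r (indicator {x})) (?r w))\<^sup>2 / ?n) = (\<Sum>x\<in>X. (?r w x)\<^sup>2) / ?n"
    by (simp add: proj sum_divide_distrib)
  also have "\<dots> = ?n / ?n" by (simp add: ip_def power2_eq_square)
  also have "\<dots> \<le> 1" by (simp add: divide_le_eq_1)
  finally have "(\<Sum>x\<in>X. (?ip (?r (indicator {x})) (?r w))\<^sup>2 / ?n) \<le> 1" .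
  with Cons.IH show ?case by (simp add: step sum_subtractf del: residual.simps)
qed

lemma ip_measurable [measurable (raw)]:
  assumes "finite X"
    and "\<And>x. x \<in> X \<Longrightarrow> (\<lambda>p. c p x) \<in> borel_measurable M"
    and "\<And>x. x \<in> X \<Longrightarrow> (\<lambda>p. f p x) \<in> borel_measurable M"
    and "\<And>x. x \<in> X \<Longrightarrow> (\<lambda>p. g p x) \<in> borel_measurable M"
  shows "(\<lambda>p. ip X (c p) (f p) (g p)) \<in> borel_measurable M"
  unfolding ip_def using assms by (intro borel_measurable_sum borel_measurable_times) auto

lemma residual_measurable:
  assumes "finite X"
    and c: "\<And>x. x \<in> X \<Longrightarrow> (\<lambda>p. c p x) \<in> borel_measurable M"
    and w: "\<And>k x. k \<in> set ks \<Longrightarrow> x \<in> X \<Longrightarrow> (\<lambda>p. w k p x) \<in> borel_measurable M"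
    and f: "\<And>x. x \<in> X \<Longrightarrow> (\<lambda>p. f p x) \<in> borel_measurable M"
    and x: "x \<in> X"
  shows "(\<lambda>p. residual X (c p) (map (\<lambda>k. w k p) ks) (f p) x) \<in> borel_measurable M"
  using w f x
proof (induction ks arbitrary: f x)
  case (Cons k ks)
  have IH: "(\<lambda>p. residual X (c p) (map (\<lambda>k. w k p) ks) (f p) x) \<in> borel_measurable M"
    if "\<And>x. x \<in> X \<Longrightarrow> (\<lambda>p. f p x) \<in> borel_measurable M" "x \<in> X" for f x
    using Cons that by auto
  show ?case
    using Cons.prems
    by (simp, intro borel_measurable_diff borel_measurable_times borel_measurable_divide ip_measurable IH assms(1) c) auto
qed auto

section \<open>Gaussian measure of sets that are thin in one direction\<close>

abbreviation std_normal_prod :: "'k set \<Rightarrow> ('k \<Rightarrow> real) measure" where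
  "std_normal_prod K \<equiv> (\<Pi>\<^sub>M k\<in>K. std_normal_distribution)"

definition shift_on :: "'k set \<Rightarrow> ('k \<Rightarrow> real) \<Rightarrow> real \<Rightarrow> ('k \<Rightarrow> real) \<Rightarrow> 'k \<Rightarrow> real" where
  "shift_on K v t x = (\<lambda>k\<in>K. x k + t * v k)"

definition std_normal_prod_density :: "'k set \<Rightarrow> ('k \<Rightarrow> real) \<Rightarrow> real" where
  "std_normal_prod_density K x = (\<Prod>k\<in>K. std_normal_density (x k))"

lemma std_normal_prod_eq_density:
  fixes K :: "'k set"
  assumes K: "finite K"
  shows "std_normal_prod K = density (\<Pi>\<^sub>M k\<in>K. lborel) (\<lambda>x. ennreal (std_normal_prod_density K x))"
proof -
  interpret L: product_sigma_finite "\<lambda>_::'k. lborel :: real measure"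
    by standard
  interpret N: prob_space std_normal_distribution
    by (rule prob_space_normal_density) simp
  interpret S: product_sigma_finite "\<lambda>_::'k. std_normal_distribution"
    by standard
  have "density (\<Pi>\<^sub>M k\<in>K. lborel) (\<lambda>x. ennreal (std_normal_prod_density K x)) = std_normal_prod K"
  proof (rule S.PiM_eqI[OF K])
    show "sets (density (\<Pi>\<^sub>M k\<in>K. lborel) (\<lambda>x. ennreal (std_normal_prod_density K x))) = sets (std_normal_prod K)"
      unfolding sets_density by (intro sets_PiM_cong) auto
    fix A :: "'k \<Rightarrow> real set" assume "\<And>i. i \<in> K \<Longrightarrow> A i \<in> sets std_normal_distribution"
    then have A: "\<And>i. i \<in> K \<Longrightarrow> A i \<in> sets borel" by simp
    have "emeasure (density (\<Pi>\<^sub>M k\<in>K. lborel) (\<lambda>x. ennreal (std_normal_prod_density K x))) (Pi\<^sub>E K A)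
        = (\<integral>\<^sup>+x. (\<Prod>k\<in>K. ennreal (std_normal_density (x k)) * indicator (A k) (x k)) \<partial>(\<Pi>\<^sub>M k\<in>K. lborel))"
    proof (subst emeasure_density)
      show "(\<lambda>x. ennreal (std_normal_prod_density K x)) \<in> borel_measurable (\<Pi>\<^sub>M k\<in>K. lborel)"
        unfolding std_normal_prod_density_def by measurable
      show "Pi\<^sub>E K A \<in> sets (\<Pi>\<^sub>M k\<in>K. lborel)"
        using K A by (intro sets_PiM_I_finite) auto
      show "(\<integral>\<^sup>+x. ennreal (std_normal_prod_density K x) * indicator (Pi\<^sub>E K A) x \<partial>(\<Pi>\<^sub>M k\<in>K. lborel))
          = (\<integral>\<^sup>+x. (\<Prod>k\<in>K. ennreal (std_normal_density (x k)) * indicator (A k) (x k)) \<partial>(\<Pi>\<^sub>M k\<in>K. lborel))"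
      proof (intro nn_integral_cong)
        fix x :: "'k \<Rightarrow> real" assume x: "x \<in> space (\<Pi>\<^sub>M k\<in>K. lborel)"
        show "ennreal (std_normal_prod_density K x) * indicator (Pi\<^sub>E K A) x
            = (\<Prod>k\<in>K. ennreal (std_normal_density (x k)) * indicator (A k) (x k))"
        proof (cases "x \<in> Pi\<^sub>E K A")
          case True
          then have "(\<Prod>k\<in>K. ennreal (std_normal_density (x k)) * indicator (A k) (x k))
              = (\<Prod>k\<in>K. ennreal (std_normal_density (x k)))"
            by (intro prod.cong) (auto dest: PiE_mem)
          with True show ?thesis by (simp add: std_normal_prod_density_def prod_ennreal)
        next
          case False
          then obtain k where k: "k \<in> K" "x k \<notin> A k" using x by (auto simp: space_PiM PiE_iff)
          then have "(\<Prod>k\<in>K. ennreal (std_normal_density (x k)) * indicator (A k) (x k)) = 0"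
            using K by (intro prod_zero) (auto intro!: bexI[of _ k])
          with False show ?thesis by simp
        qed
      qed
    qed
    also have "\<dots> = (\<Prod>k\<in>K. \<integral>\<^sup>+x. ennreal (std_normal_density x) * indicator (A k) x \<partial>lborel)"
      using K A by (subst L.product_nn_integral_prod) auto
    also have "\<dots> = (\<Prod>k\<in>K. emeasure std_normal_distribution (A k))"
      using A by (intro prod.cong) (auto simp: emeasure_density)
    finally show "emeasure (density (\<Pi>\<^sub>M k\<in>K. lborel) (\<lambda>x. ennreal (std_normal_prod_density K x))) (Pi\<^sub>E K A)
        = (\<Prod>k\<in>K. emeasure std_normal_distribution (A k))" .
  qed
  then show ?thesis ..
qed

lemma shift_on_measurable [measurable]:
  "(\<lambda>(t, x). shift_on K v t x) \<in> borel \<Otimes>\<^sub>M (\<Pi>\<^sub>M k\<in>K. borel) \<rightarrow>\<^sub>M (\<Pi>\<^sub>M k\<in>K. borel)"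
  unfolding shift_on_def split_def by measurable

lemma shift_on_measurable' [measurable]:
  "shift_on K v t \<in> (\<Pi>\<^sub>M k\<in>K. borel) \<rightarrow>\<^sub>M (\<Pi>\<^sub>M k\<in>K. borel)"
  unfolding shift_on_def by measurable

lemma distr_shift_on:
  fixes K :: "'k set"
  assumes K: "finite K"
  shows "distr (\<Pi>\<^sub>M k\<in>K. lborel) (\<Pi>\<^sub>M k\<in>K. borel) (shift_on K v t) = (\<Pi>\<^sub>M k\<in>K. lborel)"
proof -
  interpret L: product_sigma_finite "\<lambda>_::'k. lborel :: real measure"
    by standard
  have sets_eq: "sets (\<Pi>\<^sub>M k\<in>K. (lborel :: real measure)) = sets (\<Pi>\<^sub>M k\<in>K. borel)"
    by (intro sets_PiM_cong) auto
  have meas: "shift_on K v t \<in> (\<Pi>\<^sub>M k\<in>K. lborel) \<rightarrow>\<^sub>M (\<Pi>\<^sub>M k\<in>K. borel)"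
    by (subst measurable_cong_sets[OF sets_eq refl]) measurable
  show ?thesis
  proof (rule L.PiM_eqI[OF K])
    show "sets (distr (\<Pi>\<^sub>M k\<in>K. lborel) (\<Pi>\<^sub>M k\<in>K. borel) (shift_on K v t)) = sets (\<Pi>\<^sub>M k\<in>K. (lborel :: real measure))"
      by (simp add: sets_eq)
    fix A :: "'k \<Rightarrow> real set" assume "\<And>i. i \<in> K \<Longrightarrow> A i \<in> sets lborel"
    then have A: "\<And>i. i \<in> K \<Longrightarrow> A i \<in> sets borel" by simp
    have vimage: "shift_on K v t -` Pi\<^sub>E K A \<inter> space (\<Pi>\<^sub>M k\<in>K. lborel) = (\<Pi>\<^sub>E k\<in>K. (\<lambda>x. t * v k + x) -` A k)"
      by (auto simp: shift_on_def space_PiM PiE_iff add_ac)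
    have pre: "(\<lambda>x. t * v k + x) -` A k \<in> sets borel" if "k \<in> K" for k
      using measurable_sets[of "\<lambda>x. t * v k + x" borel borel "A k"] A[OF that] by simp
    have "emeasure (distr (\<Pi>\<^sub>M k\<in>K. lborel) (\<Pi>\<^sub>M k\<in>K. borel) (shift_on K v t)) (Pi\<^sub>E K A)
        = (\<Prod>k\<in>K. emeasure lborel ((\<lambda>x. t * v k + x) -` A k))"
      using A pre K by (subst emeasure_distr[OF meas]) (auto simp: vimage L.emeasure_PiM intro!: sets_PiM_I_finite)
    also have "\<dots> = (\<Prod>k\<in>K. emeasure (distr lborel borel ((+) (t * v k))) (A k))"
      using A by (intro prod.cong refl) (subst emeasure_distr, auto)
    also have "\<dots> = (\<Prod>k\<in>K. emeasure lborel (A k))"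
      by (simp add: lborel_distr_plus)
    finally show "emeasure (distr (\<Pi>\<^sub>M k\<in>K. lborel) (\<Pi>\<^sub>M k\<in>K. borel) (shift_on K v t)) (Pi\<^sub>E K A)
        = (\<Prod>k\<in>K. emeasure lborel (A k))" .
  qed
qed

lemma nn_integral_shift_on:
  assumes "finite K" "F \<in> borel_measurable (\<Pi>\<^sub>M k\<in>K. borel)"
  shows "(\<integral>\<^sup>+x. F (shift_on K v t x) \<partial>(\<Pi>\<^sub>M k\<in>K. lborel)) = (\<integral>\<^sup>+x. F x \<partial>(\<Pi>\<^sub>M k\<in>K. lborel))"
proof -
  have sets_eq: "sets (\<Pi>\<^sub>M k\<in>K. (lborel :: real measure)) = sets (\<Pi>\<^sub>M k\<in>K. borel)"
    by (intro sets_PiM_cong) auto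
  have meas: "shift_on K v t \<in> (\<Pi>\<^sub>M k\<in>K. lborel) \<rightarrow>\<^sub>M (\<Pi>\<^sub>M k\<in>K. borel)"
    by (subst measurable_cong_sets[OF sets_eq refl]) measurable
  show ?thesis
    using assms(2) by (subst (2) distr_shift_on[OF assms(1), of v t, symmetric], subst nn_integral_distr[OF meas]) auto
qed

lemma std_normal_prod_density_eq:
  assumes "finite K"
  shows "std_normal_prod_density K x = (1 / sqrt (2 * pi)) ^ card K * exp (- (\<Sum>k\<in>K. (x k)\<^sup>2) / 2)"
  using assms unfolding std_normal_prod_density_def std_normal_density_def
  by (simp add: prod.distrib exp_sum[symmetric] sum_negf sum_divide_distrib prod_dividef power_divide)

text \<open>
  Along a line in direction \<open>v\<close> the density is \<open>exp(-(s + 2 t p + t\<^sup>2)/2)\<close> with \<open>p\<close> the component of \<open>x\<close> along \<open>v\<close>;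
  for \<open>0 \<le> t \<le> 1\<close> the factor \<open>exp(-t p - t\<^sup>2/2)\<close> lies below \<open>exp(-p) + exp p\<close>.  The densities at \<open>t = 1\<close> and \<open>t = -1\<close> carry
  the additional factor \<open>exp(-1/2) \<ge> 1/2\<close>, whence the constant 2.
\<close>

lemma std_normal_prod_density_shift_le:
  assumes "finite K" "(\<Sum>k\<in>K. (v k)\<^sup>2) = 1" "0 \<le> t" "t \<le> 1"
  shows "std_normal_prod_density K (shift_on K v t x)
    \<le> 2 * (std_normal_prod_density K (shift_on K v 1 x) + std_normal_prod_density K (shift_on K v (- 1) x))"
proof -
  define p where "p = (\<Sum>k\<in>K. x k * v k)"
  define s where "s = (\<Sum>k\<in>K. (x k)\<^sup>2)"
  have sq: "(\<Sum>k\<in>K. (shift_on K v u x k)\<^sup>2) = s + 2 * u * p + u\<^sup>2" for u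
  proof -
    have "(\<Sum>k\<in>K. (shift_on K v u x k)\<^sup>2) = (\<Sum>k\<in>K. (x k)\<^sup>2 + 2 * u * (x k * v k) + u\<^sup>2 * (v k)\<^sup>2)"
      by (intro sum.cong) (auto simp: shift_on_def power2_eq_square algebra_simps)
    also have "\<dots> = s + 2 * u * p + u\<^sup>2 * (\<Sum>k\<in>K. (v k)\<^sup>2)"
      by (simp add: sum.distrib sum_distrib_left s_def p_def)
    finally show ?thesis using assms(2) by simp
  qed
  have half: "1 / 2 \<le> exp (- 1 / 2 :: real)" using exp_ge_add_one_self[of "- 1 / 2 :: real"] by simp
  have up: "exp (- t * p - t\<^sup>2 / 2) \<le> exp (- p) + exp p"
  proof -
    have "- t * p \<le> \<bar>t * p\<bar>" by simp
    also have "\<dots> \<le> 1 * \<bar>p\<bar>" unfolding abs_mult using assms(3,4) by (intro mult_right_mono) auto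
    finally have "- t * p - t\<^sup>2 / 2 \<le> \<bar>p\<bar>" using zero_le_power2[of t] by linarith
    then have "exp (- t * p - t\<^sup>2 / 2) \<le> exp \<bar>p\<bar>" by simp
    also have "\<dots> \<le> exp (- p) + exp p" by (cases "p \<ge> 0") simp_all
    finally show ?thesis .
  qed
  have "exp (- (s + 2 * t * p + t\<^sup>2) / 2) = exp (- s / 2) * exp (- t * p - t\<^sup>2 / 2)"
    unfolding exp_add[symmetric] by (simp add: field_simps)
  also have "\<dots> \<le> exp (- s / 2) * (exp (- p) + exp p)"
    by (intro mult_left_mono up) simp
  also have "\<dots> \<le> exp (- s / 2) * (exp (- p) + exp p) * (2 * exp (- 1 / 2))"
  proof -
    have "0 \<le> exp (- s / 2) * (exp (- p) + exp p)" by (simp add: add_nonneg_nonneg)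
    from mult_left_mono[OF _ this, of 1 "2 * exp (- 1 / 2)"] half show ?thesis by simp
  qed
  also have "\<dots> = 2 * (exp (- (s + 2 * 1 * p + 1\<^sup>2) / 2) + exp (- (s + 2 * (- 1) * p + (- 1)\<^sup>2) / 2))"
  proof -
    have "- (s + 2 * 1 * p + 1\<^sup>2) / 2 = - s / 2 + - p + - 1 / 2"
      "- (s + 2 * (- 1) * p + (- 1)\<^sup>2) / 2 = - s / 2 + p + - 1 / 2"
      by (simp_all add: field_simps)
    then show ?thesis by (simp only: exp_add algebra_simps)
  qed
  finally have main: "exp (- (s + 2 * t * p + t\<^sup>2) / 2)
    \<le> 2 * (exp (- (s + 2 * 1 * p + 1\<^sup>2) / 2) + exp (- (s + 2 * (- 1) * p + (- 1)\<^sup>2) / 2))" .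
  have c: "(1 / sqrt (2 * pi)) ^ card K \<ge> 0" by simp
  show ?thesis
    unfolding std_normal_prod_density_eq[OF assms(1)] sq
    using mult_left_mono[OF main c] by (simp only: ring_distribs mult.left_commute)
qed

text \<open>
  Translate the set by \<open>t v\<close>, average over \<open>t\<close> in the unit interval, and bound the translated densities by the two
  densities at \<open>t = 1\<close> and \<open>t = -1\<close>.  These do not depend on \<open>t\<close>, so after exchanging the integrals only the length of the
  intersection of the set with each line in direction \<open>v\<close> enters.
\<close>

theorem std_normal_prod_line_bound:
  assumes K: "finite K" and v: "(\<Sum>k\<in>K. (v k)\<^sup>2) = 1"
    and E[measurable]: "E \<in> sets (\<Pi>\<^sub>M k\<in>K. (borel :: real measure))"
    and line: "\<And>x s t. shift_on K v s x \<in> E \<Longrightarrow> shift_on K v t x \<in> E \<Longrightarrow> \<bar>s - t\<bar> \<le> l"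
    and l: "l \<ge> 0"
  shows "emeasure (std_normal_prod K) E \<le> ennreal (8 * l)"
proof -
  let ?L = "(\<Pi>\<^sub>M k\<in>K. lborel) :: ('a \<Rightarrow> real) measure" and ?B = "(\<Pi>\<^sub>M k\<in>K. borel) :: ('a \<Rightarrow> real) measure"
  let ?d = "\<lambda>x. ennreal (std_normal_prod_density K x)"
  have sets_eq: "sets ?L = sets ?B"
    by (intro sets_PiM_cong) auto
  interpret L: product_sigma_finite "\<lambda>_::'a. lborel :: real measure"
    by standard
  interpret FL: finite_product_sigma_finite "\<lambda>_::'a. lborel :: real measure" K
    by standard (rule K)
  interpret P: pair_sigma_finite "lborel :: real measure" ?L
    by standard
  have d[measurable]: "std_normal_prod_density K \<in> borel_measurable ?B"
    unfolding std_normal_prod_density_def by measurable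
  have dL[measurable]: "?d \<in> borel_measurable ?L"
    by (subst measurable_cong_sets[OF sets_eq refl]) measurable
  have EL: "E \<in> sets ?L" using E sets_eq by simp
  have total: "(\<integral>\<^sup>+x. ?d x \<partial>?L) = 1"
  proof -
    interpret N: prob_space std_normal_distribution by (rule prob_space_normal_density) simp
    interpret PP: product_prob_space "\<lambda>_::'a. std_normal_distribution" K by standard
    have "emeasure (std_normal_prod K) (space (std_normal_prod K)) = 1" by (rule PP.emeasure_space_1)
    then show ?thesis
      unfolding std_normal_prod_eq_density[OF K] space_density emeasure_density[OF dL sets.top]
      by (simp cong: nn_integral_cong)
  qed
  let ?F = "\<lambda>x. ?d x * indicator E x"
  have F[measurable]: "?F \<in> borel_measurable ?B" by measurable
  have sh[measurable]: "(\<lambda>(t, x). shift_on K v t x) \<in> lborel \<Otimes>\<^sub>M ?L \<rightarrow>\<^sub>M ?B"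
    by (subst measurable_cong_sets[OF sets_pair_measure_cong[OF sets_lborel sets_eq] refl])
       (rule shift_on_measurable)
  define G where "G t x = ?F (shift_on K v t x) * indicator {0..1::real} t" for t x
  have joint: "(\<lambda>(t, x). G t x) \<in> borel_measurable (lborel \<Otimes>\<^sub>M ?L)"
    using measurable_compose[OF sh F] unfolding G_def split_def by measurable
  have "emeasure (std_normal_prod K) E = (\<integral>\<^sup>+x. ?F x \<partial>?L)"
    unfolding std_normal_prod_eq_density[OF K] by (rule emeasure_density[OF dL EL])
  (* The integral is constant in t; averaging over t in the unit interval makes room for Fubini. *)
  also have "\<dots> = (\<integral>\<^sup>+t. (\<integral>\<^sup>+x. ?F x \<partial>?L) * indicator {0..1::real} t \<partial>lborel)"
    by (subst nn_integral_cmult_indicator) simp_all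
  also have "\<dots> = (\<integral>\<^sup>+t. (\<integral>\<^sup>+x. G t x \<partial>?L) \<partial>lborel)"
  proof (intro nn_integral_cong)
    fix t :: real
    show "(\<integral>\<^sup>+x. ?F x \<partial>?L) * indicator {0..1} t = (\<integral>\<^sup>+x. G t x \<partial>?L)"
      unfolding G_def using nn_integral_shift_on[OF K F, of v t] by (simp add: indicator_def)
  qed
  also have "\<dots> = (\<integral>\<^sup>+x. (\<integral>\<^sup>+t. G t x \<partial>lborel) \<partial>?L)"
    by (rule P.Fubini'[OF joint, symmetric])
  also have "\<dots> \<le> (\<integral>\<^sup>+x. ennreal (2 * (std_normal_prod_density K (shift_on K v 1 x)
                     + std_normal_prod_density K (shift_on K v (- 1) x))) * ennreal (2 * l) \<partial>?L)"
  proof (intro nn_integral_mono)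
    fix x assume x: "x \<in> space ?L"
    let ?m = "2 * (std_normal_prod_density K (shift_on K v 1 x) + std_normal_prod_density K (shift_on K v (- 1) x))"
    have xB: "x \<in> space ?B" using x sets_eq_imp_space_eq[OF sets_eq] by simp
    have meas: "{t. shift_on K v t x \<in> E} \<in> sets borel"
    proof -
      have "(\<lambda>t. shift_on K v t x) \<in> borel \<rightarrow>\<^sub>M ?B"
        using measurable_compose[OF measurable_Pair2'[OF xB] shift_on_measurable[of K v]] by simp
      from measurable_sets[OF this E] show ?thesis by (simp add: vimage_def)
    qed
    have "(\<integral>\<^sup>+t. G t x \<partial>lborel)
        \<le> (\<integral>\<^sup>+t. ennreal ?m * indicator {t. shift_on K v t x \<in> E} t \<partial>lborel)"
    proof (intro nn_integral_mono)
      fix t :: real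
      show "G t x \<le> ennreal ?m * indicator {t. shift_on K v t x \<in> E} t"
        using std_normal_prod_density_shift_le[OF K v, of t x]
        by (auto simp: G_def indicator_def intro!: ennreal_leI)
    qed
    also have "\<dots> = ennreal ?m * emeasure lborel {t. shift_on K v t x \<in> E}"
      using meas by (subst nn_integral_cmult_indicator) auto
    also have "\<dots> \<le> ennreal ?m * ennreal (2 * l)"
    proof (intro mult_left_mono)
      show "emeasure lborel {t. shift_on K v t x \<in> E} \<le> ennreal (2 * l)"
      proof (cases "{t. shift_on K v t x \<in> E} = {}")
        case False
        then obtain s where "shift_on K v s x \<in> E" by auto
        then have "{t. shift_on K v t x \<in> E} \<subseteq> {s - l..s + l}"
          using line[of s x] by (fastforce simp: abs_le_iff)
        then have "emeasure lborel {t. shift_on K v t x \<in> E} \<le> emeasure lborel {s - l..s + l}"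
          by (intro emeasure_mono) auto
        also have "\<dots> = ennreal (2 * l)" using l by (simp add: emeasure_lborel_Icc_eq)
        finally show ?thesis .
      qed simp
    qed simp
    finally show "(\<integral>\<^sup>+t. G t x \<partial>lborel) \<le> ennreal ?m * ennreal (2 * l)" .
  qed
  also have "\<dots> = (\<integral>\<^sup>+x. (?d (shift_on K v 1 x) + ?d (shift_on K v (- 1) x)) * ennreal (4 * l) \<partial>?L)"
    using l by (intro nn_integral_cong)
      (simp add: ennreal_plus[symmetric] ennreal_mult[symmetric] std_normal_prod_density_def prod_nonneg mult_ac del: ennreal_plus)
  also have "\<dots> = ((\<integral>\<^sup>+x. ?d (shift_on K v 1 x) \<partial>?L) + (\<integral>\<^sup>+x. ?d (shift_on K v (- 1) x) \<partial>?L)) * ennreal (4 * l)"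
  proof -
    have "(\<lambda>x. ?d (shift_on K v u x)) \<in> borel_measurable ?L" for u
      by (subst measurable_cong_sets[OF sets_eq refl]) measurable
    then show ?thesis by (simp add: nn_integral_multc nn_integral_add)
  qed
  also have "\<dots> = 2 * ennreal (4 * l)"
    using nn_integral_shift_on[OF K, of ?d v 1] nn_integral_shift_on[OF K, of ?d v "- 1"] total by simp
  also have "\<dots> = ennreal (8 * l)"
    using ennreal_mult[of 2 "4 * l"] l by simp
  finally show ?thesis .
qed

section \<open>Coordinates in an orthonormal eigenbasis\<close>

abbreviation ip1 :: "'x set \<Rightarrow> ('x \<Rightarrow> real) \<Rightarrow> ('x \<Rightarrow> real) \<Rightarrow> real" where
  "ip1 X \<equiv> ip X (\<lambda>_. 1)"

text \<open>
  The characteristic polynomial splits, so there is a Schur decomposition, and the span of the first \<open>k\<close> columns of the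
  transition matrix \<open>P\<close> is invariant for each \<open>k\<close>.  Orthogonalising the columns gives eigenvectors because a symmetric map also
  leaves the orthogonal complements of these spans invariant.  The order of the eigenvalues is that of the given list.
\<close>

lemma orthonormal_eigenvectors_exist:
  assumes A: "A \<in> carrier_mat d d" "A\<^sup>T = (A :: real mat)"
    and cp: "char_poly A = (\<Prod>e\<leftarrow>es. [:- e, 1:])"
  obtains v where "\<And>k. k < d \<Longrightarrow> v k \<in> carrier_vec d"
    "\<And>i k. i < d \<Longrightarrow> k < d \<Longrightarrow> v i \<bullet> v k = (if i = k then 1 else 0)"
    "\<And>k. k < d \<Longrightarrow> A *\<^sub>v v k = (es ! k) \<cdot>\<^sub>v v k"
proof -
  obtain B P Q where BPQ: "schur_decomposition A es = (B, P, Q)" by (cases "schur_decomposition A es")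
  have wit: "similar_mat_wit A B P Q" and ut: "upper_triangular B" and diag: "diag_mat B = es"
    using schur_decomposition[OF A(1) cp BPQ] by auto
  have B: "B \<in> carrier_mat d d" and P: "P \<in> carrier_mat d d" and Q: "Q \<in> carrier_mat d d"
    and QP: "Q * P = 1\<^sub>m d" and ABPQ: "A = P * B * Q"
    using wit A(1) unfolding similar_mat_wit_def Let_def by auto
  have AP: "A * P = P * B"
  proof -
    have "A * P = P * B * (Q * P)"
      unfolding ABPQ using P Q B by (intro assoc_mult_mat[of _ d d _ d _ d]) auto
    then show ?thesis using P B by (simp add: QP)
  qed
  define X where "X = {..<d}"
  define T where "T f x = (\<Sum>y<d. A $$ (x, y) * f y)" for f :: "nat \<Rightarrow> real" and x
  define p where "p k x = P $$ (x, k)" for k x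
  define Sp where "Sp k f \<longleftrightarrow> (\<exists>z. \<forall>x<d. f x = (\<Sum>i<k. z i * p i x))" for k and f :: "nat \<Rightarrow> real"
  have X: "finite X" by (simp add: X_def)
  have pos: "\<And>x. x \<in> X \<Longrightarrow> (0::real) < 1" by simp
  have Asym: "A $$ (x, y) = A $$ (y, x)" if "x < d" "y < d" for x y
    using A that by (metis carrier_matD index_transpose_mat(1))
  have Tsym: "ip1 X (T f) g = ip1 X f (T g)" for f g
  proof -
    have "ip1 X (T f) g = (\<Sum>x<d. \<Sum>y<d. A $$ (x, y) * f y * g x)"
      by (simp add: ip_def T_def X_def sum_distrib_right)
    also have "\<dots> = (\<Sum>y<d. \<Sum>x<d. A $$ (y, x) * f y * g x)"
      by (subst sum.swap) (simp add: Asym)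
    also have "\<dots> = ip1 X f (T g)"
      by (simp add: ip_def T_def X_def sum_distrib_left mult_ac)
    finally show ?thesis .
  qed
  have Tp: "T (p k) x = (\<Sum>i\<le>k. B $$ (i, k) * p i x)" if "k < d" "x < d" for k x
  proof -
    have "T (p k) x = (A * P) $$ (x, k)"
      using A(1) P that by (simp add: T_def p_def scalar_prod_def atLeast0LessThan)
    also have "\<dots> = (\<Sum>i<d. P $$ (x, i) * B $$ (i, k))"
      using B P that by (simp add: AP scalar_prod_def atLeast0LessThan)
    also have "\<dots> = (\<Sum>i\<le>k. P $$ (x, i) * B $$ (i, k))"
      by (rule sum.mono_neutral_right) (use that B upper_triangularD[OF ut] in auto)
    finally show ?thesis by (simp add: p_def mult.commute)
  qed
  have Sp_mono: "Sp k f" if "Sp j f" "j \<le> k" for j k f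
  proof -
    obtain z where "\<forall>x<d. f x = (\<Sum>i<j. z i * p i x)" using \<open>Sp j f\<close> by (auto simp: Sp_def)
    then have "\<forall>x<d. f x = (\<Sum>i<k. (if i < j then z i else 0) * p i x)"
      using sum.mono_neutral_right[of "{..<k}" "{..<j}" "\<lambda>i. (if i < j then z i else 0) * p i x" for x] that(2)
      by (auto simp: subset_eq)
    then show ?thesis by (auto simp: Sp_def)
  qed
  have Sp_comb: "Sp k (\<lambda>x. a * f x + b * g x)" if fg: "Sp k f" "Sp k g" for k f g a b
  proof -
    obtain y z where "\<forall>x<d. f x = (\<Sum>i<k. y i * p i x)" "\<forall>x<d. g x = (\<Sum>i<k. z i * p i x)"
      using fg by (auto simp: Sp_def)
    then have "\<forall>x<d. a * f x + b * g x = (\<Sum>i<k. (a * y i + b * z i) * p i x)"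
      by (simp add: sum_distrib_left sum.distrib algebra_simps)
    then show ?thesis by (auto simp: Sp_def)
  qed
  have Sp_p: "Sp k (p i)" if "i < k" for i k
  proof -
    have "p i x = (\<Sum>j<k. (if j = i then 1 else 0) * p j x)" for x
      using that by (simp add: if_distrib[of "\<lambda>u. u * _"] cong: if_cong)
    then show ?thesis unfolding Sp_def by (intro exI[of _ "\<lambda>j. if j = i then 1 else 0"]) simp
  qed
  have Sp_sum: "Sp k (\<lambda>x. \<Sum>i<n. y i * f i x)" if "\<And>i. i < n \<Longrightarrow> Sp k (f i)" for k n y and f :: "nat \<Rightarrow> nat \<Rightarrow> real"
    using that
  proof (induction n)
    case 0
    show ?case unfolding Sp_def by (rule exI[of _ "\<lambda>_. 0"]) simp
  next
    case (Suc n)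
    then show ?case using Sp_comb[of k "\<lambda>x. \<Sum>i<n. y i * f i x" "f n" 1 "y n"] by simp
  qed
  have Sp_cong: "Sp k g" if "Sp k f" "\<And>x. x < d \<Longrightarrow> g x = f x" for k f g
    using that unfolding Sp_def by simp
  have orth_Sp: "ip1 X h f = 0" if "Sp k f" "\<And>i. i < k \<Longrightarrow> ip1 X h (p i) = 0" for k f h
  proof -
    obtain z where z: "\<forall>x<d. f x = (\<Sum>i<k. z i * p i x)" using \<open>Sp k f\<close> by (auto simp: Sp_def)
    have "ip1 X h f = ip1 X h (\<lambda>x. \<Sum>i<k. z i * p i x)"
      using z by (auto simp: ip_def X_def)
    also have "\<dots> = 0" unfolding ip_sum_right ip_scale_right using that(2) by simp
    finally show ?thesis .
  qed
  define u where "u k = residual X (\<lambda>_. 1) (map p [0..<k]) (p k)" for k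
  have u_orth: "ip1 X (u k) (p i) = 0" if "i < k" for i k
    unfolding u_def by (rule residual_orthogonal[OF X pos]) (use that in auto)
  have u_span: "\<exists>y. \<forall>x. u k x = p k x - (\<Sum>i<k. y i * p i x)" for k
    using residual_in_span[of X "\<lambda>_. 1" "map p [0..<k]" "p k"] by (simp add: u_def)
  have u_Sp: "Sp (Suc k) (u k)" for k
  proof -
    obtain y where y: "\<forall>x. u k x = p k x - (\<Sum>i<k. y i * p i x)" using u_span by blast
    have "Sp (Suc k) (\<lambda>x. 1 * p k x + (- 1) * (\<Sum>i<k. y i * p i x))"
      by (intro Sp_comb Sp_p Sp_sum) auto
    then show ?thesis by (rule Sp_cong) (simp add: y)
  qed
  have TpSp: "Sp (Suc i) (T (p i))" if "i < d" for i
  proof -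
    have "Sp (Suc i) (\<lambda>x. \<Sum>j<Suc i. B $$ (j, i) * p j x)" by (intro Sp_sum Sp_p) auto
    then show ?thesis by (rule Sp_cong) (use Tp that in \<open>simp add: lessThan_Suc_atMost\<close>)
  qed
  have eig: "T (u k) x = es ! k * u k x" if k: "k < d" and x: "x < d" for k x
  proof -
    obtain y where y: "\<forall>x. u k x = p k x - (\<Sum>i<k. y i * p i x)" using u_span by blast
    have esk: "es ! k = B $$ (k, k)" using diag k B by (auto simp: diag_mat_def)
    have Tu: "T (u k) x = T (p k) x - (\<Sum>i<k. y i * T (p i) x)" for x
    proof -
      have "(\<Sum>i<k. y i * T (p i) x) = (\<Sum>y'<d. \<Sum>i<k. A $$ (x, y') * (y i * p i y'))"
        unfolding T_def by (subst sum.swap) (simp add: sum_distrib_left mult_ac)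
      then show ?thesis by (simp add: T_def y right_diff_distrib sum_subtractf sum_distrib_left)
    qed
    (* w lies in the span of the first k columns and is orthogonal to them, hence vanishes. *)
    define w where "w x = T (u k) x - es ! k * u k x" for x
    have "Sp k (\<lambda>x. 1 * (\<Sum>i<k. B $$ (i, k) * p i x) + 1 * ((- 1) * (\<Sum>i<k. y i * T (p i) x) + es ! k * (\<Sum>i<k. y i * p i x)))"
      by (intro Sp_comb Sp_sum Sp_p) (use k in \<open>auto intro: Sp_mono[OF TpSp]\<close>)
    then have "Sp k w"
    proof (rule Sp_cong)
      fix x assume "x < d"
      then show "w x = 1 * (\<Sum>i<k. B $$ (i, k) * p i x) + 1 * ((- 1) * (\<Sum>i<k. y i * T (p i) x) + es ! k * (\<Sum>i<k. y i * p i x))"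
        using k by (simp add: w_def Tu Tp esk y lessThan_Suc_atMost[symmetric] algebra_simps)
    qed
    moreover have "ip1 X w (p i) = 0" if "i < k" for i
    proof -
      have "ip1 X (u k) (T (p i)) = 0"
        by (rule orth_Sp[OF Sp_mono[OF TpSp, of i k]]) (use that k u_orth in auto)
      then have "ip1 X (T (u k)) (p i) = 0" by (simp add: Tsym)
      then show ?thesis using u_orth[OF that]
        unfolding w_def by (simp add: ip_diff_left ip_scale_left)
    qed
    ultimately have "ip1 X w w = 0" using orth_Sp by blast
    from ip_self_eq_0[OF X pos this] x show ?thesis by (simp add: w_def X_def)
  qed
  have unz: "ip1 X (u k) (u k) > 0" if k: "k < d" for k
  proof (rule ccontr)
    assume "\<not> ?thesis"
    then have "ip1 X (u k) (u k) = 0" using ip_self_nonneg[of X "\<lambda>_. 1" "u k"] by simp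
    from ip_self_eq_0[OF X pos this] have 0: "u k x = 0" if "x < d" for x using that by (auto simp: X_def)
    obtain y where y: "\<forall>x. u k x = p k x - (\<Sum>i<k. y i * p i x)" using u_span by blast
    have QPi: "(\<Sum>x<d. Q $$ (k, x) * p i x) = (if k = i then 1 else 0)" if "i < d" for i
      using arg_cong[OF QP, of "\<lambda>M. M $$ (k, i)"] Q P k that
      by (simp add: scalar_prod_def p_def atLeast0LessThan)
    have "0 = (\<Sum>x<d. Q $$ (k, x) * u k x)" by (simp add: 0)
    also have "\<dots> = (\<Sum>x<d. Q $$ (k, x) * p k x) - (\<Sum>i<k. y i * (\<Sum>x<d. Q $$ (k, x) * p i x))"
      unfolding sum_distrib_left by (subst sum.swap) (simp add: y right_diff_distrib sum_subtractf sum_distrib_left mult_ac)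
    also have "\<dots> = 1" using k by (simp add: QPi)
    finally show False by simp
  qed
  have uu: "ip1 X (u i) (u k) = 0" if "i < k" for i k
    unfolding ip_commute[of X _ "u i"]
    by (rule orth_Sp[OF Sp_mono[OF u_Sp[of i], of k]]) (use that u_orth in auto)
  define v where "v k = vec d (\<lambda>x. u k x / sqrt (ip1 X (u k) (u k)))" for k
  show ?thesis
  proof (rule that[of v])
    show "v k \<in> carrier_vec d" if "k < d" for k by (simp add: v_def)
    show "v i \<bullet> v k = (if i = k then 1 else 0)" if "i < d" "k < d" for i k
    proof -
      have "v i \<bullet> v k = ip1 X (u i) (u k) / (sqrt (ip1 X (u i) (u i)) * sqrt (ip1 X (u k) (u k)))"
        by (simp add: v_def scalar_prod_def ip_def X_def atLeast0LessThan sum_divide_distrib)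
      also have "\<dots> = (if i = k then 1 else 0)"
        using uu[of i k] uu[of k i] unz[OF that(1)] ip_commute[of X _ "u i" "u k"]
        by (cases i k rule: linorder_cases) auto
      finally show ?thesis .
    qed
    show "A *\<^sub>v v k = es ! k \<cdot>\<^sub>v v k" if k: "k < d" for k
    proof (rule eq_vecI)
      show "(A *\<^sub>v v k) $ x = (es ! k \<cdot>\<^sub>v v k) $ x" if "x < dim_vec (es ! k \<cdot>\<^sub>v v k)" for x
        using that A(1) eig[OF k, of x]
        by (simp add: v_def scalar_prod_def atLeast0LessThan T_def sum_divide_distrib[symmetric] times_divide_eq_right)
    qed (use A in \<open>simp_all add: v_def\<close>)
  qed
qed

text \<open>
  The eigenvalues are indexed from 1, in decreasing order, whereas entries of vectors are indexed from 0.
\<close>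

locale eigenbasis =
  fixes d :: nat and A :: "real mat" and ev :: "nat \<Rightarrow> real" and v :: "nat \<Rightarrow> real vec"
  assumes A_carrier [simp]: "A \<in> carrier_mat d d"
    and A_sym: "A\<^sup>T = A"
    and v_carrier [simp]: "i \<in> {1..d} \<Longrightarrow> v i \<in> carrier_vec d"
    and v_orthonormal: "i \<in> {1..d} \<Longrightarrow> j \<in> {1..d} \<Longrightarrow> v i \<bullet> v j = (if i = j then 1 else 0)"
    and v_eigen: "i \<in> {1..d} \<Longrightarrow> A *\<^sub>v v i = ev i \<cdot>\<^sub>v v i"
    and ev_pos: "i \<in> {1..d} \<Longrightarrow> 0 < ev i"
    and ev_antimono: "1 \<le> i \<Longrightarrow> i \<le> j \<Longrightarrow> j \<le> d \<Longrightarrow> ev j \<le> ev i"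

lemma eigenbasis_exists:
  assumes "symmetric_pos_def d A" "ordered_eigenvalues d A ev"
  obtains v where "eigenbasis d A ev v"
proof -
  have A: "A \<in> carrier_mat d d" "A\<^sup>T = A"
    and pd: "\<And>x. x \<in> carrier_vec d \<Longrightarrow> x \<noteq> 0\<^sub>v d \<Longrightarrow> x \<bullet> (A *\<^sub>v x) > 0"
    using assms(1) by (auto simp: symmetric_pos_def_def)
  let ?es = "map ev [1..<Suc d]"
  have "char_poly A = (\<Prod>e\<leftarrow>?es. [:- e, 1:])"
  proof -
    have "(\<Prod>e\<leftarrow>?es. [:- e, 1:]) = prod_list (map (\<lambda>i. [:- ev i, 1:]) [1..<Suc d])"
      by (simp only: map_map comp_def)
    also have "\<dots> = (\<Prod>i\<in>set [1..<Suc d]. [:- ev i, 1:])"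
      by (rule prod.distinct_set_conv_list[symmetric]) (rule distinct_upt)
    also have "set [1..<Suc d] = {1..d}" by (simp only: set_upt atLeastLessThanSuc_atLeastAtMost)
    finally show ?thesis using assms(2) unfolding ordered_eigenvalues_def by (simp only:)
  qed
  from orthonormal_eigenvectors_exist[OF A this] obtain w
    where w: "\<And>k. k < d \<Longrightarrow> w k \<in> carrier_vec d"
    "\<And>i k. i < d \<Longrightarrow> k < d \<Longrightarrow> w i \<bullet> w k = (if i = k then 1 else 0)"
    "\<And>k. k < d \<Longrightarrow> A *\<^sub>v w k = (?es ! k) \<cdot>\<^sub>v w k" by blast
  have "eigenbasis d A ev (\<lambda>i. w (i - 1))"
  proof
    show eig: "A *\<^sub>v w (i - 1) = ev i \<cdot>\<^sub>v w (i - 1)" if "i \<in> {1..d}" for i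
    proof -
      have "?es ! (i - 1) = ev i" using that by (subst nth_map) (auto simp del: upt_Suc)
      moreover have "i - 1 < d" using that by auto
      ultimately show ?thesis using w(3)[of "i - 1"] by (simp only:)
    qed
    show "0 < ev i" if i: "i \<in> {1..d}" for i
    proof -
      have 1: "w (i - 1) \<bullet> w (i - 1) = 1" and c: "w (i - 1) \<in> carrier_vec d" using w i by auto
      then have "w (i - 1) \<noteq> 0\<^sub>v d" by auto
      from pd[OF c this] show ?thesis using 1 c eig[OF i] by simp
    qed
    show "w (i - 1) \<bullet> w (j - 1) = (if i = j then 1 else 0)" if "i \<in> {1..d}" "j \<in> {1..d}" for i j
      using that w(2)[of "i - 1" "j - 1"] by auto
    show "ev j \<le> ev i" if "1 \<le> i" "i \<le> j" "j \<le> d" for i j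
      using that(2,1,3)
    proof (induction rule: dec_induct)
      case (step n)
      have "\<forall>i\<in>{1..<d}. ev (i + 1) \<le> ev i" using assms(2) unfolding ordered_eigenvalues_def by simp
      then have "ev (n + 1) \<le> ev n" using step by simp
      also have "\<dots> \<le> ev i" using step by simp
      finally show ?case by simp
    qed simp
  qed (use A w in auto)
  then show ?thesis using that by blast
qed

context eigenbasis
begin

lemma A_dim [simp]: "dim_row A = d" "dim_col A = d"
  using carrier_matD[OF A_carrier] by simp_all

lemma v_dim [simp]: "Suc 0 \<le> i \<Longrightarrow> i \<le> d \<Longrightarrow> dim_vec (v i) = d"
  using v_carrier[of i] by simp

lemma mult_A_carrier [simp]: "x \<in> carrier_vec d \<Longrightarrow> A *\<^sub>v x \<in> carrier_vec d"
  by (rule mult_mat_vec_carrier[OF A_carrier])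

definition co :: "real vec \<Rightarrow> nat \<Rightarrow> real" where
  "co x i = v i \<bullet> x"

definition of_co :: "(nat \<Rightarrow> real) \<Rightarrow> real vec" where
  "of_co f = vec d (\<lambda>p. \<Sum>i\<in>{1..d}. f i * v i $ p)"

lemma of_co_carrier [simp]: "of_co f \<in> carrier_vec d"
  by (simp add: of_co_def)

lemma co_of_co [simp]:
  assumes i: "i \<in> {1..d}" shows "co (of_co f) i = f i"
proof -
  have "co (of_co f) i = (\<Sum>p<d. \<Sum>j\<in>{1..d}. v i $ p * (f j * v j $ p))"
    using v_carrier[OF i] by (simp add: co_def of_co_def scalar_prod_def sum_distrib_left atLeast0LessThan)
  also have "\<dots> = (\<Sum>j\<in>{1..d}. f j * (v i \<bullet> v j))"
    using v_carrier by (subst sum.swap)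
      (auto simp: scalar_prod_def sum_distrib_left atLeast0LessThan mult_ac intro!: sum.cong)
  also have "\<dots> = (\<Sum>j\<in>{1..d}. if j = i then f j else 0)"
    by (intro sum.cong) (use i v_orthonormal in auto)
  also have "\<dots> = f i" using i by simp
  finally show ?thesis .
qed

text \<open>
  A square matrix with orthonormal rows has orthonormal columns.
\<close>

lemma v_completeness:
  assumes "p < d" "p' < d"
  shows "(\<Sum>i\<in>{1..d}. v i $ p * v i $ p') = (if p = p' then 1 else 0)"
proof -
  define W where "W = mat d d (\<lambda>(p, k). v (Suc k) $ p)"
  have W: "W \<in> carrier_mat d d" by (simp add: W_def)
  have "W\<^sup>T * W = 1\<^sub>m d"
  proof (rule eq_matI)
    fix i j assume "i < dim_row (1\<^sub>m d :: real mat)" "j < dim_col (1\<^sub>m d :: real mat)"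
    then have ij: "i < d" "j < d" by auto
    then have "(W\<^sup>T * W) $$ (i, j) = v (Suc i) \<bullet> v (Suc j)"
      using v_carrier[of "Suc j"] by (simp add: W_def scalar_prod_def)
    then show "(W\<^sup>T * W) $$ (i, j) = 1\<^sub>m d $$ (i, j)" using ij v_orthonormal by simp
  qed (use W in auto)
  then have "W * W\<^sup>T = 1\<^sub>m d" using W by (intro mat_mult_left_right_inverse[of "W\<^sup>T"]) auto
  from arg_cong[OF this, of "\<lambda>M. M $$ (p, p')"] have "(\<Sum>k<d. v (Suc k) $ p * v (Suc k) $ p') = (if p = p' then 1 else 0)"
    using assms by (simp add: W_def scalar_prod_def atLeast0LessThan)
  moreover have "(\<Sum>i\<in>{1..d}. v i $ p * v i $ p') = (\<Sum>k<d. v (Suc k) $ p * v (Suc k) $ p')"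
    by (rule sum.reindex_bij_witness[of _ Suc "\<lambda>i. i - 1"]) auto
  ultimately show ?thesis by simp
qed

lemma of_co_co:
  assumes x: "x \<in> carrier_vec d" shows "of_co (co x) = x"
proof (rule eq_vecI)
  fix p assume "p < dim_vec x"
  then have p: "p < d" using x by simp
  have "of_co (co x) $ p = (\<Sum>i\<in>{1..d}. \<Sum>p'<d. v i $ p' * x $ p' * v i $ p)"
    using x p by (simp add: of_co_def co_def scalar_prod_def sum_distrib_right atLeast0LessThan)
  also have "\<dots> = (\<Sum>p'<d. x $ p' * (\<Sum>i\<in>{1..d}. v i $ p * v i $ p'))"
    by (subst sum.swap) (simp add: sum_distrib_left mult_ac)
  also have "\<dots> = (\<Sum>p'<d. if p' = p then x $ p' else 0)"
  proof (intro sum.cong refl)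
    fix p' assume "p' \<in> {..<d}"
    then show "x $ p' * (\<Sum>i\<in>{1..d}. v i $ p * v i $ p') = (if p' = p then x $ p' else 0)"
      using v_completeness[OF p, of p'] by auto
  qed
  also have "\<dots> = x $ p" using p by simp
  finally show "of_co (co x) $ p = x $ p" .
qed (use x in \<open>simp add: of_co_def\<close>)

lemma co_eqI:
  assumes "x \<in> carrier_vec d" "y \<in> carrier_vec d" "\<And>i. i \<in> {1..d} \<Longrightarrow> co x i = co y i"
  shows "x = y"
proof -
  have "of_co (co x) = of_co (co y)" using assms(3) by (auto simp: of_co_def)
  then show ?thesis using assms by (simp add: of_co_co)
qed

lemma index_eq_co:
  assumes "x \<in> carrier_vec d" "p < d"
  shows "x $ p = (\<Sum>i\<in>{1..d}. co x i * v i $ p)"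
  using arg_cong[OF of_co_co[OF assms(1)], of "\<lambda>y. y $ p"] assms(2) by (simp add: of_co_def)

lemma scalar_prod_co:
  assumes x: "x \<in> carrier_vec d" and y: "y \<in> carrier_vec d"
  shows "x \<bullet> y = (\<Sum>i\<in>{1..d}. co x i * co y i)"
proof -
  have coy: "co y i = (\<Sum>p<d. v i $ p * y $ p)" for i
    using y by (simp add: co_def scalar_prod_def atLeast0LessThan)
  have "x \<bullet> y = (\<Sum>p<d. \<Sum>i\<in>{1..d}. co x i * v i $ p * y $ p)"
    using y by (simp add: scalar_prod_def index_eq_co[OF x] sum_distrib_right atLeast0LessThan)
  also have "\<dots> = (\<Sum>i\<in>{1..d}. co x i * co y i)"
    by (subst sum.swap) (simp add: coy sum_distrib_left mult.assoc)
  finally show ?thesis .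
qed

lemma norm2_co:
  assumes "x \<in> carrier_vec d" shows "norm2 x = sqrt (\<Sum>i\<in>{1..d}. (co x i)\<^sup>2)"
  using assms by (simp add: norm2_def scalar_prod_co power2_eq_square)

lemma co_add:
  assumes "i \<in> {1..d}" "x \<in> carrier_vec d" "y \<in> carrier_vec d"
  shows "co (x + y) i = co x i + co y i"
  unfolding co_def using assms by (intro scalar_prod_add_distrib[of _ d]) auto

lemma co_diff:
  assumes "i \<in> {1..d}" "x \<in> carrier_vec d" "y \<in> carrier_vec d"
  shows "co (x - y) i = co x i - co y i"
  unfolding co_def using assms by (intro scalar_prod_minus_distrib[of _ d]) auto

lemma co_smult:
  assumes "i \<in> {1..d}" "x \<in> carrier_vec d" shows "co (c \<cdot>\<^sub>v x) i = c * co x i"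
  unfolding co_def using assms by (intro scalar_prod_smult_distrib[of _ d]) auto

lemma co_symmetric_mult:
  assumes "M \<in> carrier_mat d d" "M\<^sup>T = M" "M *\<^sub>v v i = c \<cdot>\<^sub>v v i" "i \<in> {1..d}" "x \<in> carrier_vec d"
  shows "co (M *\<^sub>v x) i = c * co x i"
proof -
  have "v i \<bullet> (M *\<^sub>v x) = (M\<^sup>T *\<^sub>v v i) \<bullet> x"
    using transpose_vec_mult_scalar[OF assms(1,5) v_carrier[OF assms(4)]] by simp
  also have "\<dots> = c * (v i \<bullet> x)" using assms by simp
  finally show ?thesis by (simp add: co_def)
qed

lemma co_A:
  assumes "i \<in> {1..d}" "x \<in> carrier_vec d" shows "co (A *\<^sub>v x) i = ev i * co x i"
  using co_symmetric_mult[OF A_carrier A_sym v_eigen] assms by simp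

lemma shifted_carrier [simp]: "shifted A \<mu> \<in> carrier_mat d d"
  by (simp add: shifted_def)

lemma shifted_dim [simp]: "dim_row (shifted A \<mu>) = d" "dim_col (shifted A \<mu>) = d"
  using carrier_matD[OF shifted_carrier] by simp_all

lemma co_shifted:
  assumes i: "i \<in> {1..d}" and x: "x \<in> carrier_vec d"
  shows "co (shifted A \<mu> *\<^sub>v x) i = (ev i + \<mu>) * co x i"
proof -
  have "shifted A \<mu> *\<^sub>v x = A *\<^sub>v x + \<mu> \<cdot>\<^sub>v x"
  proof -
    have "shifted A \<mu> *\<^sub>v x = A *\<^sub>v x + (\<mu> \<cdot>\<^sub>m 1\<^sub>m d) *\<^sub>v x"
      unfolding shifted_def A_dim by (rule add_mult_distrib_mat_vec[OF A_carrier _ x]) simp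
    also have "(\<mu> \<cdot>\<^sub>m 1\<^sub>m d) *\<^sub>v x = \<mu> \<cdot>\<^sub>v x"
      using x by (intro eq_vecI) (auto simp: smult_scalar_prod_distrib[of _ d])
    finally show ?thesis .
  qed
  then show ?thesis using x by (simp add: co_add[OF i] co_smult[OF i] co_A[OF i] algebra_simps)
qed

lemma co_shifted_pow:
  assumes i: "i \<in> {1..d}" and x: "x \<in> carrier_vec d"
  shows "co ((shifted A \<mu> ^\<^sub>m k) *\<^sub>v x) i = (ev i + \<mu>) ^ k * co x i"
  using x
proof (induction k arbitrary: x)
  case (Suc k)
  have c: "shifted A \<mu> ^\<^sub>m k \<in> carrier_mat d d" by (rule pow_carrier_mat) simp
  have "shifted A \<mu> ^\<^sub>m Suc k *\<^sub>v x = shifted A \<mu> ^\<^sub>m k *\<^sub>v (shifted A \<mu> *\<^sub>v x)"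
    using Suc.prems c by (simp add: assoc_mult_mat_vec[of _ d d _ d])
  moreover have "shifted A \<mu> *\<^sub>v x \<in> carrier_vec d"
    using Suc.prems by (intro mult_mat_vec_carrier[where n = d]) auto
  ultimately show ?case using Suc by (simp add: co_shifted[OF i])
qed simp

end

section \<open>Block Krylov spaces as polynomial combinations\<close>

text \<open>
  Unlike a bound on \<open>degree\<close>, this also makes sense for \<open>t = 0\<close>, where it leaves only the zero polynomial.
\<close>

definition degree_below :: "nat \<Rightarrow> real poly \<Rightarrow> bool" where
  "degree_below t p \<longleftrightarrow> (\<forall>k\<ge>t. coeff p k = 0)"

lemma degree_below_iff: "degree_below t p \<longleftrightarrow> p = 0 \<or> degree p < t"
proof
  assume "degree_below t p"
  then show "p = 0 \<or> degree p < t"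
    unfolding degree_below_def by (metis leading_coeff_0_iff not_less)
next
  assume "p = 0 \<or> degree p < t"
  then show "degree_below t p" unfolding degree_below_def by (auto intro: coeff_eq_0)
qed

lemma poly_degree_below:
  assumes "degree_below t p" shows "poly p x = (\<Sum>k<t. coeff p k * x ^ k)"
proof (cases "p = 0")
  case False
  then have "degree p < t" using assms degree_below_iff by auto
  then have "(\<Sum>k<t. coeff p k * x ^ k) = (\<Sum>k\<le>degree p. coeff p k * x ^ k)"
    by (intro sum.mono_neutral_right) (auto intro: coeff_eq_0)
  then show ?thesis by (simp add: poly_altdef)
qed simp

lemma degree_below_pcompose: "degree_below t p \<Longrightarrow> degree_below t (pcompose p [:a, 1:])"
  unfolding degree_below_iff by (auto simp: degree_pcompose)

lemma degree_below_sum_monom: "degree_below t (\<Sum>k<t. monom (c k) k)"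
  unfolding degree_below_def by (auto simp: coeff_sum coeff_monom)

lemma degree_below_add: "degree_below t p \<Longrightarrow> degree_below t q \<Longrightarrow> degree_below t (p + q)"
  by (simp add: degree_below_def)

lemma degree_below_diff: "degree_below t p \<Longrightarrow> degree_below t q \<Longrightarrow> degree_below t (p - q)"
  by (simp add: degree_below_def)

lemma degree_below_smult: "degree_below t p \<Longrightarrow> degree_below t (Polynomial.smult c p)"
  by (simp add: degree_below_def)

lemma degree_below_sum: "(\<And>j. j \<in> J \<Longrightarrow> degree_below t (p j)) \<Longrightarrow> degree_below t (sum p J)"
  by (simp add: degree_below_def coeff_sum)

lemma degree_below_mult:
  assumes "degree p \<le> n" "degree_below t q" shows "degree_below (n + t) (p * q)"
  using assms degree_mult_le[of p q] unfolding degree_below_iff by fastforce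

lemma degree_below_mono: "degree_below t p \<Longrightarrow> t \<le> u \<Longrightarrow> degree_below u p"
  by (simp add: degree_below_def)

context eigenbasis
begin

text \<open>
  The shift disappears from the description since polynomials in \<open>A + \<mu> I\<close> of degree below \<open>t\<close> are polynomials in \<open>A\<close> of
  degree below \<open>t\<close>.
\<close>

lemma krylov_shifted_iff:
  assumes b: "b \<in> carrier_vec d"
  shows "x \<in> krylov t (shifted A \<mu>) b \<longleftrightarrow>
    x \<in> carrier_vec d \<and> (\<exists>p. degree_below t p \<and> (\<forall>i\<in>{1..d}. co x i = poly p (ev i) * co b i))"
proof -
  interpret V: vec_space "TYPE(real)" d .
  let ?g = "\<lambda>k. (shifted A \<mu> ^\<^sub>m k) *\<^sub>v b"
  let ?S = "{?g k | k. k < t}"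
  define N where "N = {x \<in> carrier_vec d. \<exists>c. \<forall>i\<in>{1..d}. co x i = (\<Sum>k<t. c k * (ev i + \<mu>) ^ k) * co b i}"
  have g: "?g k \<in> carrier_vec d" for k
    using b by (intro mult_mat_vec_carrier[where n = d] pow_carrier_mat) auto
  then have S: "?S \<subseteq> carrier_vec d" by auto
  have kry: "krylov t (shifted A \<mu>) b = V.span ?S" by (simp add: krylov_def)
  have sub: "V.span ?S \<subseteq> N"
  proof (rule V.span_is_subset)
    show "?S \<subseteq> N"
    proof
      fix x assume "x \<in> ?S"
      then obtain k where k: "k < t" "x = ?g k" by auto
      have "\<forall>i\<in>{1..d}. co x i = (\<Sum>l<t. (if l = k then 1 else 0) * (ev i + \<mu>) ^ l) * co b i"
        using k b by (simp add: co_shifted_pow[of _ b] if_distrib[of "\<lambda>u. u * _"] cong: if_cong)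
      then show "x \<in> N" unfolding N_def using k g
        by (intro CollectI conjI exI[of _ "\<lambda>l. if l = k then 1 else 0"]) auto
    qed
    have "submodule class_ring N (module_vec TYPE(real) d)"
    proof (rule submodule.intro)
      show "module class_ring (module_vec TYPE(real) d)" by (rule vec_module)
      show "N \<subseteq> carrier (module_vec TYPE(real) d)" by (auto simp: N_def module_vec_simps)
      show "\<zero>\<^bsub>module_vec TYPE(real) d\<^esub> \<in> N"
      proof -
        have "\<forall>i\<in>{1..d}. co (0\<^sub>v d) i = (\<Sum>k<t. 0 * (ev i + \<mu>) ^ k) * co b i"
          using v_carrier by (auto simp: co_def)
        then show ?thesis unfolding N_def module_vec_simps by (intro CollectI conjI exI[of _ "\<lambda>_. 0"]) auto
      qed
      show "x \<oplus>\<^bsub>module_vec TYPE(real) d\<^esub> y \<in> N" if xy: "x \<in> N" "y \<in> N" for x y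
      proof -
        obtain c c' where "\<forall>i\<in>{1..d}. co x i = (\<Sum>k<t. c k * (ev i + \<mu>) ^ k) * co b i"
          "\<forall>i\<in>{1..d}. co y i = (\<Sum>k<t. c' k * (ev i + \<mu>) ^ k) * co b i" using xy by (auto simp: N_def)
        then have "\<forall>i\<in>{1..d}. co (x + y) i = (\<Sum>k<t. (c k + c' k) * (ev i + \<mu>) ^ k) * co b i"
          using xy by (auto simp: N_def co_add[of _ x y] sum.distrib algebra_simps)
        then show ?thesis using xy unfolding N_def module_vec_simps by (intro CollectI conjI exI[of _ "\<lambda>k. c k + c' k"]) auto
      qed
      show "a \<odot>\<^bsub>module_vec TYPE(real) d\<^esub> x \<in> N" if x: "a \<in> carrier class_ring" "x \<in> N" for a x
      proof -
        obtain c where "\<forall>i\<in>{1..d}. co x i = (\<Sum>k<t. c k * (ev i + \<mu>) ^ k) * co b i" using x by (auto simp: N_def)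
        then have "\<forall>i\<in>{1..d}. co (a \<cdot>\<^sub>v x) i = (\<Sum>k<t. (a * c k) * (ev i + \<mu>) ^ k) * co b i"
          using x by (auto simp: N_def co_smult[of _ x] sum_distrib_left algebra_simps)
        then show ?thesis using x unfolding N_def module_vec_simps by (intro CollectI conjI exI[of _ "\<lambda>k. a * c k"]) auto
      qed
    qed
    then show "submodule class_ring N (module_vec TYPE(real) d)" .
  qed
  have sup: "N \<subseteq> V.span ?S"
  proof
    fix x assume "x \<in> N"
    then obtain c where x: "x \<in> carrier_vec d" and c: "\<forall>i\<in>{1..d}. co x i = (\<Sum>k<t. c k * (ev i + \<mu>) ^ k) * co b i"
      by (auto simp: N_def)
    have "of_co (\<lambda>i. (\<Sum>k<n. c k * (ev i + \<mu>) ^ k) * co b i) \<in> V.span ?S" if "n \<le> t" for n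
      using that
    proof (induction n)
      case 0
      have "of_co (\<lambda>i. (\<Sum>k<0. c k * (ev i + \<mu>) ^ k) * co b i) = 0\<^sub>v d"
        by (intro eq_vecI) (auto simp: of_co_def)
      then show ?case using V.span_zero by simp
    next
      case (Suc n)
      have gs: "c n \<cdot>\<^sub>v ?g n \<in> V.span ?S"
        using Suc.prems by (intro V.smult_in_span S V.span_mem) auto
      have "of_co (\<lambda>i. (\<Sum>k<Suc n. c k * (ev i + \<mu>) ^ k) * co b i)
        = of_co (\<lambda>i. (\<Sum>k<n. c k * (ev i + \<mu>) ^ k) * co b i) + c n \<cdot>\<^sub>v ?g n"
        using g by (intro co_eqI) (auto simp: co_add[of _ "of_co _"] co_smult[of _ "?g n"] co_shifted_pow[OF _ b] algebra_simps
           simp del: One_nat_def atLeastAtMost_iff)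
      then show ?case using Suc gs V.span_add1[OF S, of "of_co (\<lambda>i. (\<Sum>k<n. c k * (ev i + \<mu>) ^ k) * co b i)" "c n \<cdot>\<^sub>v ?g n"] S
        by (simp add: module_vec_simps)
    qed
    from this[of t] have "of_co (\<lambda>i. (\<Sum>k<t. c k * (ev i + \<mu>) ^ k) * co b i) \<in> V.span ?S" by simp
    moreover have "of_co (\<lambda>i. (\<Sum>k<t. c k * (ev i + \<mu>) ^ k) * co b i) = x"
      using x c by (intro co_eqI) (auto simp del: One_nat_def atLeastAtMost_iff)
    ultimately show "x \<in> V.span ?S" by simp
  qed
  have NP: "x \<in> N \<longleftrightarrow> x \<in> carrier_vec d \<and> (\<exists>p. degree_below t p \<and> (\<forall>i\<in>{1..d}. co x i = poly p (ev i) * co b i))"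
  proof
    assume "x \<in> N"
    then obtain c where x: "x \<in> carrier_vec d" and c: "\<forall>i\<in>{1..d}. co x i = (\<Sum>k<t. c k * (ev i + \<mu>) ^ k) * co b i"
      by (auto simp: N_def)
    let ?p = "pcompose (\<Sum>k<t. monom (c k) k) [:\<mu>, 1:]"
    have "poly ?p y = (\<Sum>k<t. c k * (y + \<mu>) ^ k)" for y
      by (simp add: poly_pcompose poly_sum poly_monom add.commute)
    then show "x \<in> carrier_vec d \<and> (\<exists>p. degree_below t p \<and> (\<forall>i\<in>{1..d}. co x i = poly p (ev i) * co b i))"
      using x c degree_below_pcompose[OF degree_below_sum_monom, of t c \<mu>] by (intro conjI exI[of _ ?p]) auto
  next
    assume R: "x \<in> carrier_vec d \<and> (\<exists>p. degree_below t p \<and> (\<forall>i\<in>{1..d}. co x i = poly p (ev i) * co b i))"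
    then obtain p where p: "degree_below t p" "\<forall>i\<in>{1..d}. co x i = poly p (ev i) * co b i" by blast
    let ?q = "pcompose p [:- \<mu>, 1:]"
    have "poly p y = (\<Sum>k<t. coeff ?q k * (y + \<mu>) ^ k)" for y
      using poly_degree_below[OF degree_below_pcompose[OF p(1), of "- \<mu>"], of "y + \<mu>"]
      by (simp add: poly_pcompose)
    then have "\<forall>i\<in>{1..d}. co x i = (\<Sum>k<t. coeff ?q k * (ev i + \<mu>) ^ k) * co b i" using p(2) by simp
    then show "x \<in> N" using R unfolding N_def by blast
  qed
  show ?thesis unfolding kry NP[symmetric] using sub sup by blast
qed

lemma block_krylov_iff:
  assumes B: "B \<in> carrier_mat d m"
  shows "x \<in> block_krylov t (shifted A \<mu>) B \<longleftrightarrow>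
    x \<in> carrier_vec d \<and> (\<exists>P. (\<forall>j<m. degree_below t (P j)) \<and>
      (\<forall>i\<in>{1..d}. co x i = (\<Sum>j<m. poly (P j) (ev i) * co (col B j) i)))"
proof -
  have Bd: "dim_col B = m" using B by simp
  have col: "col B j \<in> carrier_vec d" for j using B by auto
  have fin: "finsum_vec TYPE(real) d y {..<m} \<in> carrier_vec d"
      and cofin: "\<And>i. i \<in> {1..d} \<Longrightarrow> co (finsum_vec TYPE(real) d y {..<m}) i = (\<Sum>j<m. co (y j) i)"
    if y: "\<And>j. j < m \<Longrightarrow> y j \<in> carrier_vec d" for y
  proof -
    show fc: "finsum_vec TYPE(real) d y {..<m} \<in> carrier_vec d"
      using y by (intro finsum_vec_closed) auto
    show "co (finsum_vec TYPE(real) d y {..<m}) i = (\<Sum>j<m. co (y j) i)" if i: "i \<in> {1..d}" for i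
    proof -
      have "co (finsum_vec TYPE(real) d y {..<m}) i = (\<Sum>p<d. v i $ p * (\<Sum>j<m. y j $ p))"
        using fc y by (simp add: co_def scalar_prod_def atLeast0LessThan index_finsum_vec Pi_def)
      also have "\<dots> = (\<Sum>j<m. \<Sum>p<d. v i $ p * y j $ p)"
        unfolding sum_distrib_left by (rule sum.swap)
      also have "\<dots> = (\<Sum>j<m. co (y j) i)"
        by (intro sum.cong refl) (auto simp: co_def scalar_prod_def atLeast0LessThan carrier_vecD[OF y])
      finally show ?thesis .
    qed
  qed
  show ?thesis
  proof
    assume "x \<in> block_krylov t (shifted A \<mu>) B"
    then obtain y where x: "x = finsum_vec TYPE(real) d y {..<m}"
      and y: "\<And>j. j < m \<Longrightarrow> y j \<in> krylov t (shifted A \<mu>) (col B j)"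
      by (auto simp: block_krylov_def Bd)
    have yc: "y j \<in> carrier_vec d" if "j < m" for j using y[OF that] krylov_shifted_iff[OF col] by auto
    have "\<forall>j. \<exists>p. j < m \<longrightarrow> degree_below t p \<and> (\<forall>i\<in>{1..d}. co (y j) i = poly p (ev i) * co (col B j) i)"
      using y krylov_shifted_iff[OF col] by blast
    then obtain P where P: "\<And>j. j < m \<Longrightarrow> degree_below t (P j) \<and> (\<forall>i\<in>{1..d}. co (y j) i = poly (P j) (ev i) * co (col B j) i)"
      by metis
    show "x \<in> carrier_vec d \<and> (\<exists>P. (\<forall>j<m. degree_below t (P j)) \<and>
      (\<forall>i\<in>{1..d}. co x i = (\<Sum>j<m. poly (P j) (ev i) * co (col B j) i)))"
      unfolding x using fin[OF yc] cofin[OF yc] P by (intro conjI exI[of _ P]) auto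
  next
    assume R: "x \<in> carrier_vec d \<and> (\<exists>P. (\<forall>j<m. degree_below t (P j)) \<and>
      (\<forall>i\<in>{1..d}. co x i = (\<Sum>j<m. poly (P j) (ev i) * co (col B j) i)))"
    then obtain P where P: "\<forall>j<m. degree_below t (P j)"
      "\<forall>i\<in>{1..d}. co x i = (\<Sum>j<m. poly (P j) (ev i) * co (col B j) i)" by blast
    define y where "y j = of_co (\<lambda>i. poly (P j) (ev i) * co (col B j) i)" for j
    have yc: "y j \<in> carrier_vec d" for j by (simp add: y_def)
    have "y j \<in> krylov t (shifted A \<mu>) (col B j)" if "j < m" for j
      unfolding krylov_shifted_iff[OF col] using P that by (intro conjI exI[of _ "P j"]) (auto simp: y_def simp del: One_nat_def atLeastAtMost_iff)
    moreover have "x = finsum_vec TYPE(real) d y {..<m}"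
    proof (rule co_eqI)
      show "finsum_vec TYPE(real) d y {..<m} \<in> carrier_vec d" using yc by (rule fin)
      show "co x i = co (finsum_vec TYPE(real) d y {..<m}) i" if "i \<in> {1..d}" for i
        using P(2) that cofin[of y, OF yc that] by (simp add: y_def del: One_nat_def atLeastAtMost_iff)
    qed (use R in blast)
    ultimately show "x \<in> block_krylov t (shifted A \<mu>) B"
      unfolding block_krylov_def Bd shifted_dim by blast
  qed
qed

end

section \<open>Block conjugate gradients and the matrix square root in coordinates\<close>

context eigenbasis
begin

lemma co_mat_inverse_shifted:
  assumes \<mu>: "\<mu> \<ge> 0" and b: "b \<in> carrier_vec d" and i: "i \<in> {1..d}"
  shows "the (mat_inverse (shifted A \<mu>)) *\<^sub>v b \<in> carrier_vec d"
    and "co (the (mat_inverse (shifted A \<mu>)) *\<^sub>v b) i = co b i / (ev i + \<mu>)"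
proof -
  let ?M = "shifted A \<mu>"
  have pos: "ev j + \<mu> > 0" if "j \<in> {1..d}" for j using ev_pos[OF that] \<mu> by simp
  have "det ?M \<noteq> 0"
  proof
    assume "det ?M = 0"
    then have "\<exists>x. x \<in> carrier_vec d \<and> x \<noteq> 0\<^sub>v d \<and> ?M *\<^sub>v x = 0\<^sub>v d"
      by (rule iffD1[OF det_0_iff_vec_prod_zero_field[OF shifted_carrier]])
    then obtain x where x: "x \<in> carrier_vec d" "x \<noteq> 0\<^sub>v d" "?M *\<^sub>v x = 0\<^sub>v d"
      by (elim exE conjE)
    have "co x j = co (0\<^sub>v d) j" if j: "j \<in> {1..d}" for j
    proof -
      have "co (0\<^sub>v d) j = 0" using v_carrier[OF j] by (simp add: co_def)
      moreover have "(ev j + \<mu>) * co x j = co (0\<^sub>v d) j" using co_shifted[OF j x(1), of \<mu>] x(3) by simp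
      ultimately show ?thesis using pos[OF j] by simp
    qed
    from co_eqI[OF x(1) zero_carrier_vec this] x(2) show False by simp
  qed
  then have unit: "?M \<in> Units (ring_mat TYPE(real) d ())"
    by (rule det_non_zero_imp_unit[OF shifted_carrier])
  have "mat_inverse ?M \<noteq> None"
  proof
    assume "mat_inverse ?M = None"
    then have "?M \<notin> Units (ring_mat TYPE(real) d ())" by (rule mat_inverse(1)[OF shifted_carrier])
    with unit show False by contradiction
  qed
  then obtain N where N: "mat_inverse ?M = Some N" by (cases "mat_inverse ?M") simp_all
  from mat_inverse(2)[OF shifted_carrier N] have MN: "?M * N = 1\<^sub>m d" and Nc: "N \<in> carrier_mat d d" by auto
  have Nb: "N *\<^sub>v b \<in> carrier_vec d" using Nc b by (rule mult_mat_vec_carrier)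
  then show "the (mat_inverse ?M) *\<^sub>v b \<in> carrier_vec d" by (simp add: N)
  have "?M *\<^sub>v (N *\<^sub>v b) = b"
    using assoc_mult_mat_vec[OF shifted_carrier Nc b, symmetric] b by (simp add: MN)
  then have "(ev i + \<mu>) * co (N *\<^sub>v b) i = co b i" using co_shifted[OF i Nb, of \<mu>] by simp
  then show "co (the (mat_inverse ?M) *\<^sub>v b) i = co b i / (ev i + \<mu>)"
    using pos[OF i] by (simp add: N field_simps)
qed

text \<open>
  The squared norm that belongs to \<open>A + \<mu> I\<close>, in terms of the coordinates.
\<close>

definition energy :: "real \<Rightarrow> (nat \<Rightarrow> real) \<Rightarrow> real" where
  "energy \<mu> e = (\<Sum>i\<in>{1..d}. (ev i + \<mu>) * (e i)\<^sup>2)"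

lemma energy_eq_ip: "energy \<mu> e = ip {1..d} (\<lambda>i. ev i + \<mu>) e e"
  by (simp add: energy_def ip_def power2_eq_square mult.assoc)

text \<open>
  The block-CG error in coordinates: the solution \<open>b\<^sub>i/(\<lambda>\<^sub>i + \<mu>)\<close> is projected away from all \<open>A\<^sup>k b\<^sub>j\<close> with respect to the
  energy inner product.  The list of these vectors may be linearly dependent.
\<close>

definition cg_residual :: "real mat \<Rightarrow> nat \<Rightarrow> nat \<Rightarrow> real \<Rightarrow> nat \<Rightarrow> real" where
  "cg_residual B t i0 \<mu> =
     residual {1..d} (\<lambda>i. ev i + \<mu>)
       (map (\<lambda>(j, k) i. ev i ^ k * co (col B j) i) (List.product [0..<dim_col B] [0..<t]))
       (\<lambda>i. co (col B i0) i / (ev i + \<mu>))"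

lemma sum_nth_eq_sum_set:
  fixes f :: "'b \<Rightarrow> real"
  assumes "distinct xs" shows "(\<Sum>n<length xs. f (xs ! n)) = sum f (set xs)"
  using assms by (simp add: sum_list_distinct_conv_sum_set[symmetric] sum_list_sum_nth atLeast0LessThan)

text \<open>
  Translates between one polynomial for each column and one coefficient for each pair of a column and a power.
\<close>

lemma block_polynomial_eq_list_sum:
  assumes Q: "\<And>j. j < m \<Longrightarrow> degree_below t (Q j)"
  defines "ks \<equiv> List.product [0..<m] [0..<t]"
  shows "(\<Sum>n<length (map (\<lambda>(j, k) i. ev i ^ k * \<beta> j i) ks).
            coeff (Q (fst (ks ! n))) (snd (ks ! n)) * (map (\<lambda>(j, k) i. ev i ^ k * \<beta> j i) ks ! n) i)
         = (\<Sum>j<m. poly (Q j) (ev i) * \<beta> j i)"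
proof -
  let ?h = "\<lambda>a. coeff (Q (fst a)) (snd a)"
  have "(\<Sum>n<length (map (\<lambda>(j, k) i. ev i ^ k * \<beta> j i) ks).
            coeff (Q (fst (ks ! n))) (snd (ks ! n)) * (map (\<lambda>(j, k) i. ev i ^ k * \<beta> j i) ks ! n) i)
      = (\<Sum>n<length ks. (\<lambda>a. ?h a * (ev i ^ snd a * \<beta> (fst a) i)) (ks ! n))"
    by (intro sum.cong) (auto simp: split_def)
  also have "\<dots> = (\<Sum>a\<in>set ks. ?h a * (ev i ^ snd a * \<beta> (fst a) i))"
    by (rule sum_nth_eq_sum_set) (simp add: ks_def distinct_product)
  also have "\<dots> = (\<Sum>(j, k)\<in>{..<m} \<times> {..<t}. coeff (Q j) k * (ev i ^ k * \<beta> j i))"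
    unfolding ks_def by (intro sum.cong) auto
  also have "\<dots> = (\<Sum>j<m. \<Sum>k<t. coeff (Q j) k * (ev i ^ k * \<beta> j i))"
    by (rule sum.cartesian_product[symmetric])
  also have "\<dots> = (\<Sum>j<m. poly (Q j) (ev i) * \<beta> j i)"
  proof (intro sum.cong refl)
    fix j assume "j \<in> {..<m}"
    then have "poly (Q j) (ev i) = (\<Sum>k<t. coeff (Q j) k * ev i ^ k)"
      using Q poly_degree_below by auto
    then show "(\<Sum>k<t. coeff (Q j) k * (ev i ^ k * \<beta> j i)) = poly (Q j) (ev i) * \<beta> j i"
      by (simp add: sum_distrib_right mult.assoc)
  qed
  finally show ?thesis .
qed

text \<open>
  By Pythagoras the residual yields the unique minimiser, so the arbitrary choice in \<open>arg_min\<close> must return it.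
\<close>

lemma bcg_carrier_and_residual:
  assumes B: "B \<in> carrier_mat d m" and i0: "i0 < m" and \<mu>: "\<mu> \<ge> 0"
  shows "bcg A B t i0 \<mu> \<in> carrier_vec d"
    and "\<And>i. i \<in> {1..d} \<Longrightarrow> co (col B i0) i / (ev i + \<mu>) - co (bcg A B t i0 \<mu>) i = cg_residual B t i0 \<mu> i"
proof -
  let ?X = "{1..d}" and ?c = "\<lambda>i. ev i + \<mu>"
  let ?f = "\<lambda>i. co (col B i0) i / (ev i + \<mu>)"
  let ?ks = "List.product [0..<m] [0..<t]"
  let ?w = "\<lambda>(j, k) i. ev i ^ k * co (col B j) i"
  let ?P = "\<lambda>x. x \<in> block_krylov t (shifted A \<mu>) B"
  let ?sol = "the (mat_inverse (shifted A \<mu>)) *\<^sub>v col B i0"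
  let ?obj = "\<lambda>x. weighted_norm (shifted A \<mu>) (?sol - x)"
  define r where "r = residual ?X ?c (map ?w ?ks) ?f"
  have r: "cg_residual B t i0 \<mu> = r" using B by (simp add: cg_residual_def r_def)
  have X: "finite ?X" by simp
  have pos: "?c i > 0" if "i \<in> ?X" for i using ev_pos[OF that] \<mu> by simp
  have col: "col B j \<in> carrier_vec d" for j using B by auto
  have obj: "?obj x = sqrt (energy \<mu> (\<lambda>i. ?f i - co x i))" if x: "x \<in> carrier_vec d" for x
  proof (cases "d = 0")
    case True
    have "energy \<mu> e = 0" for e unfolding energy_def using True by simp
    moreover have "?obj x = 0" unfolding weighted_norm_def scalar_prod_def using True by simp
    ultimately show ?thesis by simp
  next
    case False
    have sol: "?sol \<in> carrier_vec d" using co_mat_inverse_shifted(1)[OF \<mu> col, of 1] False by simp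
    have e: "?sol - x \<in> carrier_vec d" using sol x by simp
    have Me: "shifted A \<mu> *\<^sub>v (?sol - x) \<in> carrier_vec d" using e by (intro mult_mat_vec_carrier[where n = d]) auto
    have "(?sol - x) \<bullet> (shifted A \<mu> *\<^sub>v (?sol - x)) = energy \<mu> (\<lambda>i. ?f i - co x i)"
      unfolding scalar_prod_co[OF e Me] energy_def
    proof (intro sum.cong refl)
      fix i assume i: "i \<in> {1..d}"
      have "co (?sol - x) i = ?f i - co x i"
        using co_diff[OF i sol x] co_mat_inverse_shifted(2)[OF \<mu> col i] by simp
      then show "co (?sol - x) i * co (shifted A \<mu> *\<^sub>v (?sol - x)) i = (ev i + \<mu>) * (?f i - co x i)\<^sup>2"
        using co_shifted[OF i e] by (simp add: power2_eq_square)
    qed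
    then show ?thesis by (simp add: weighted_norm_def)
  qed
  have nth_w: "(map ?w ?ks ! n) i = ev i ^ snd (?ks ! n) * co (col B (fst (?ks ! n))) i" if "n < length ?ks" for n i
    using that by (simp add: split_def)
  (* The candidate minimiser is the vector whose error is the residual r. *)
  define x0 where "x0 = of_co (\<lambda>i. ?f i - r i)"
  have x0c: "x0 \<in> carrier_vec d" by (simp add: x0_def)
  have x0: "co x0 i = ?f i - r i" if "i \<in> ?X" for i using that by (simp add: x0_def)
  have P0: "?P x0"
  proof -
    obtain y where y: "\<And>x. r x = ?f x - (\<Sum>n<length (map ?w ?ks). y n * (map ?w ?ks ! n) x)"
      using residual_in_span[of ?X ?c "map ?w ?ks" ?f] unfolding r_def by (elim exE) simp
    define Q where "Q j = (\<Sum>n<length ?ks. if fst (?ks ! n) = j then monom (y n) (snd (?ks ! n)) else 0)" for j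
    have "degree_below t (Q j)" for j
      unfolding Q_def
    proof (rule degree_below_sum)
      fix n assume "n \<in> {..<length ?ks}"
      then have "?ks ! n \<in> set ?ks" by (intro nth_mem) simp
      then have "snd (?ks ! n) < t" by auto
      then show "degree_below t (if fst (?ks ! n) = j then monom (y n) (snd (?ks ! n)) else 0)"
        by (auto simp: degree_below_def)
    qed
    moreover have "co x0 i = (\<Sum>j<m. poly (Q j) (ev i) * co (col B j) i)" if i: "i \<in> ?X" for i
    proof -
      have "(\<Sum>j<m. poly (Q j) (ev i) * co (col B j) i)
          = (\<Sum>j<m. \<Sum>n<length ?ks. if fst (?ks ! n) = j then y n * ev i ^ snd (?ks ! n) * co (col B j) i else 0)"
        by (auto simp: Q_def poly_sum sum_distrib_right poly_monom intro!: sum.cong)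
      also have "\<dots> = (\<Sum>n<length ?ks. \<Sum>j<m. if fst (?ks ! n) = j then y n * ev i ^ snd (?ks ! n) * co (col B j) i else 0)"
        by (rule sum.swap)
      also have "\<dots> = (\<Sum>n<length ?ks. y n * (map ?w ?ks ! n) i)"
      proof (intro sum.cong refl)
        fix n assume n: "n \<in> {..<length ?ks}"
        then have "?ks ! n \<in> set ?ks" by (intro nth_mem) simp
        then have "fst (?ks ! n) < m" by auto
        then show "(\<Sum>j<m. if fst (?ks ! n) = j then y n * ev i ^ snd (?ks ! n) * co (col B j) i else 0) = y n * (map ?w ?ks ! n) i"
          using n by (subst nth_w) (auto simp: sum.delta')
      qed
      also have "\<dots> = ?f i - r i" using y[of i] by simp
      finally show ?thesis using x0[OF i] by simp
    qed
    ultimately show ?thesis unfolding block_krylov_iff[OF B]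
      by (intro conjI exI[of _ Q] x0c) simp_all
  qed
  have E0: "energy \<mu> (\<lambda>i. ?f i - co x0 i) = energy \<mu> r"
    unfolding energy_def by (intro sum.cong refl) (simp add: x0 del: One_nat_def atLeastAtMost_iff)
  have min: "energy \<mu> (\<lambda>i. ?f i - co x i) = energy \<mu> r + energy \<mu> (\<lambda>i. ?f i - co x i - r i)" if Px: "?P x" for x
  proof -
    obtain Q where "\<forall>j<m. degree_below t (Q j)" "\<forall>i\<in>{1..d}. co x i = (\<Sum>j<m. poly (Q j) (ev i) * co (col B j) i)"
      using iffD1[OF block_krylov_iff[OF B] Px] by (elim conjE exE)
    then have Q: "\<And>j. j < m \<Longrightarrow> degree_below t (Q j)"
      "\<And>i. i \<in> ?X \<Longrightarrow> co x i = (\<Sum>j<m. poly (Q j) (ev i) * co (col B j) i)" by simp_all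
    let ?h = "\<lambda>a. coeff (Q (fst a)) (snd a)"
    have "?f i - co x i = ?f i - (\<Sum>n<length (map ?w ?ks). ?h (?ks ! n) * (map ?w ?ks ! n) i)" if i: "i \<in> ?X" for i
      by (simp only: Q(2)[OF i] block_polynomial_eq_list_sum[where Q = Q and m = m and t = t and \<beta> = "\<lambda>j. co (col B j)", OF Q(1)])
    then show ?thesis
      unfolding energy_eq_ip r_def
      by (intro residual_minimal[where us = "map ?w ?ks" and y = "\<lambda>n. ?h (?ks ! n)", OF X pos _ subset_refl]) simp_all
  qed
  have nonneg: "energy \<mu> e \<ge> 0" for e
    unfolding energy_eq_ip by (rule ip_self_nonneg) (use pos in blast)
  have Pc: "x \<in> carrier_vec d" if "?P x" for x
    by (rule conjunct1[OF iffD1[OF block_krylov_iff[OF B] that]])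
  have arg: "is_arg_min ?obj ?P x0"
    unfolding is_arg_min_def
  proof (intro conjI notI)
    assume "\<exists>y. ?P y \<and> ?obj y < ?obj x0"
    then obtain y where y: "?P y" "?obj y < ?obj x0" by (elim exE conjE)
    have yc: "y \<in> carrier_vec d" by (rule Pc[OF y(1)])
    then have "energy \<mu> (\<lambda>i. ?f i - co y i) < energy \<mu> r" using y(2) obj[OF yc] obj[OF x0c] E0 by simp
    then show False using min[OF y(1)] nonneg[of "\<lambda>i. ?f i - co y i - r i"] by simp
  qed (rule P0)
  have uniq: "x = x0" if x: "is_arg_min ?obj ?P x" for x
  proof -
    have P: "?P x" and le: "\<not> ?obj x0 < ?obj x"
      using x P0 unfolding is_arg_min_def by simp_all
    have xc: "x \<in> carrier_vec d" by (rule Pc[OF P])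
    have "energy \<mu> (\<lambda>i. ?f i - co x i) \<le> energy \<mu> r" using le obj[OF xc] obj[OF x0c] E0 by simp
    then have "energy \<mu> (\<lambda>i. ?f i - co x i - r i) = 0"
      using min[OF P] nonneg[of "\<lambda>i. ?f i - co x i - r i"] by simp
    then have z: "ip ?X ?c (\<lambda>i. ?f i - co x i - r i) (\<lambda>i. ?f i - co x i - r i) = 0" by (simp add: energy_eq_ip)
    have "?f i - co x i - r i = 0" if "i \<in> ?X" for i using ip_self_eq_0[OF X pos z] that by blast
    then have "co x i = co x0 i" if "i \<in> ?X" for i using x0[OF that] that by force
    then show ?thesis by (rule co_eqI[OF xc x0c])
  qed
  have "bcg A B t i0 \<mu> = x0"
    unfolding bcg_def arg_min_def using arg uniq by (rule some_equality)
  then show "bcg A B t i0 \<mu> \<in> carrier_vec d"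
    and "\<And>i. i \<in> {1..d} \<Longrightarrow> ?f i - co (bcg A B t i0 \<mu>) i = cg_residual B t i0 \<mu> i"
    using x0c x0 r by simp_all
qed

lemma cg_residual_minimal:
  assumes B: "B \<in> carrier_mat d m" and i0: "i0 < m" and \<mu>: "\<mu> \<ge> 0"
    and Q: "\<And>j. j < m \<Longrightarrow> degree_below t (Q j)"
  shows "energy \<mu> (cg_residual B t i0 \<mu>)
     \<le> energy \<mu> (\<lambda>i. co (col B i0) i / (ev i + \<mu>) - (\<Sum>j<m. poly (Q j) (ev i) * co (col B j) i))"
proof -
  let ?X = "{1..d}" and ?c = "\<lambda>i. ev i + \<mu>"
  let ?ks = "List.product [0..<m] [0..<t]"
  let ?w = "\<lambda>(j, k) i. ev i ^ k * co (col B j) i"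
  let ?h = "\<lambda>a. coeff (Q (fst a)) (snd a)"
  have pos: "?c i > 0" if "i \<in> ?X" for i using ev_pos[OF that] \<mu> by simp
  note eq = block_polynomial_eq_list_sum[where Q = Q and m = m and t = t and \<beta> = "\<lambda>j. co (col B j)", OF Q]
  have "ip ?X ?c (residual ?X ?c (map ?w ?ks) (\<lambda>i. co (col B i0) i / (ev i + \<mu>)))
           (residual ?X ?c (map ?w ?ks) (\<lambda>i. co (col B i0) i / (ev i + \<mu>)))
     \<le> ip ?X ?c (\<lambda>i. co (col B i0) i / (ev i + \<mu>) - (\<Sum>j<m. poly (Q j) (ev i) * co (col B j) i))
            (\<lambda>i. co (col B i0) i / (ev i + \<mu>) - (\<Sum>j<m. poly (Q j) (ev i) * co (col B j) i))"
    by (rule residual_minimal_le[where us = "map ?w ?ks" and y = "\<lambda>n. ?h (?ks ! n)"])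
       (use pos in \<open>simp_all only: eq finite_atLeastAtMost subset_refl\<close>)
  then show ?thesis using B by (simp only: energy_eq_ip cg_residual_def carrier_matD(2)[OF B])
qed

lemma mat_eq_on_vecI:
  fixes M N :: "real mat"
  assumes "M \<in> carrier_mat d d" "N \<in> carrier_mat d d"
    and eq: "\<And>x. x \<in> carrier_vec d \<Longrightarrow> M *\<^sub>v x = N *\<^sub>v x"
  shows "M = N"
proof (rule eq_matI)
  fix p q assume "p < dim_row N" "q < dim_col N"
  then have pq: "p < d" "q < d" using assms(2) by auto
  have "(M *\<^sub>v unit_vec d q) $ p = (N *\<^sub>v unit_vec d q) $ p" by (simp add: eq)
  then show "M $$ (p, q) = N $$ (p, q)" using pq assms(1,2) by simp
qed (use assms in auto)

lemma scalar_prod_self_nonpos_imp_zero: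
  fixes y :: "real vec"
  assumes y: "y \<in> carrier_vec n" and le: "y \<bullet> y \<le> 0" and p: "p < n"
  shows "y $ p = 0"
proof -
  have "y \<bullet> y = (\<Sum>p<n. (y $ p)\<^sup>2)"
    using y by (simp add: scalar_prod_def power2_eq_square atLeast0LessThan)
  moreover have "(y $ p)\<^sup>2 \<le> (\<Sum>p<n. (y $ p)\<^sup>2)"
    using p by (intro member_le_sum) simp_all
  ultimately have "(y $ p)\<^sup>2 \<le> 0" using le by linarith
  then show ?thesis by simp
qed

text \<open>
  If \<open>y = S u - c u\<close>, then \<open>S y = -c y\<close> by \<open>S (S u) = c\<^sup>2 u\<close>, and a positive semidefinite map has no negative
  eigenvalue, so \<open>y = 0\<close>.  This gives the uniqueness of the positive semidefinite square root.
\<close>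

lemma psd_sqrt_eigenvector:
  fixes S :: "real mat"
  assumes Sc: "S \<in> carrier_mat n n" and psd: "\<And>y. y \<in> carrier_vec n \<Longrightarrow> y \<bullet> (S *\<^sub>v y) \<ge> 0"
    and u: "u \<in> carrier_vec n" and c: "c > 0" and SSu: "S *\<^sub>v (S *\<^sub>v u) = (c * c) \<cdot>\<^sub>v u"
  shows "S *\<^sub>v u = c \<cdot>\<^sub>v u"
proof -
  define w where "w = S *\<^sub>v u"
  have w: "w \<in> carrier_vec n" unfolding w_def using Sc u by (rule mult_mat_vec_carrier)
  have cu: "c \<cdot>\<^sub>v u \<in> carrier_vec n" using u by simp
  define y where "y = w - c \<cdot>\<^sub>v u"
  have y: "y \<in> carrier_vec n" unfolding y_def using w u by simp
  have "S *\<^sub>v y = S *\<^sub>v w - S *\<^sub>v (c \<cdot>\<^sub>v u)"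
    unfolding y_def by (rule mult_minus_distrib_mat_vec[OF Sc w cu])
  also have "S *\<^sub>v (c \<cdot>\<^sub>v u) = c \<cdot>\<^sub>v w"
    unfolding w_def by (rule mult_mat_vec[OF Sc u])
  also have "S *\<^sub>v w = (c * c) \<cdot>\<^sub>v u" unfolding w_def by (rule SSu)
  also have "(c * c) \<cdot>\<^sub>v u - c \<cdot>\<^sub>v w = (- c) \<cdot>\<^sub>v y"
  proof (rule eq_vecI)
    fix p assume "p < dim_vec ((- c) \<cdot>\<^sub>v y)"
    then have p: "p < n" using y by simp
    have "((c * c) \<cdot>\<^sub>v u - c \<cdot>\<^sub>v w) $ p = c * c * u $ p - c * w $ p" using p u w by simp
    also have "\<dots> = (- c) * (w $ p - c * u $ p)" by (simp add: algebra_simps)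
    also have "\<dots> = ((- c) \<cdot>\<^sub>v y) $ p" using p u w by (simp add: y_def)
    finally show "((c * c) \<cdot>\<^sub>v u - c \<cdot>\<^sub>v w) $ p = ((- c) \<cdot>\<^sub>v y) $ p" .
  qed (use u w y in simp)
  finally have Sy: "S *\<^sub>v y = (- c) \<cdot>\<^sub>v y" .
  have "0 \<le> y \<bullet> ((- c) \<cdot>\<^sub>v y)" using psd[OF y] unfolding Sy .
  also have "\<dots> = (- c) * (y \<bullet> y)" by (rule scalar_prod_smult_distrib[OF y y])
  finally have "\<not> 0 < c * (y \<bullet> y)" by simp
  then have le: "y \<bullet> y \<le> 0" using mult_pos_pos[OF c, of "y \<bullet> y"] by linarith
  show ?thesis
  proof (rule eq_vecI)
    fix p assume "p < dim_vec (c \<cdot>\<^sub>v u)"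
    then have p: "p < n" using u by simp
    from scalar_prod_self_nonpos_imp_zero[OF y le p] have "w $ p = (c \<cdot>\<^sub>v u) $ p"
      unfolding y_def using p u w by simp
    then show "(S *\<^sub>v u) $ p = (c \<cdot>\<^sub>v u) $ p" unfolding w_def .
  qed (use carrier_vecD[OF u] carrier_vecD[OF w] in \<open>simp only: w_def index_smult_vec\<close>)
qed

lemma co_psd_sqrt:
  assumes S: "symmetric_pos_semidef d S" "S * S = A" and i: "i \<in> {1..d}" and x: "x \<in> carrier_vec d"
  shows "co (S *\<^sub>v x) i = sqrt (ev i) * co x i"
proof (rule co_symmetric_mult[OF _ _ _ i x])
  show Sc: "S \<in> carrier_mat d d" and "S\<^sup>T = S" using S(1) unfolding symmetric_pos_semidef_def by simp_all
  have psd: "\<And>y. y \<in> carrier_vec d \<Longrightarrow> y \<bullet> (S *\<^sub>v y) \<ge> 0"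
    using S(1) unfolding symmetric_pos_semidef_def by simp
  have s: "sqrt (ev i) > 0" "sqrt (ev i) * sqrt (ev i) = ev i" using ev_pos[OF i] by simp_all
  have "S *\<^sub>v (S *\<^sub>v v i) = ev i \<cdot>\<^sub>v v i"
    using assoc_mult_mat_vec[OF Sc Sc v_carrier[OF i]] unfolding S(2) v_eigen[OF i] by (rule sym)
  then show "S *\<^sub>v v i = sqrt (ev i) \<cdot>\<^sub>v v i"
    by (intro psd_sqrt_eigenvector[OF Sc psd v_carrier[OF i] s(1)]) (simp_all only: s(2))
qed

lemma mat_sqrt_psd: "symmetric_pos_semidef d (mat_sqrt A) \<and> mat_sqrt A * mat_sqrt A = A"
proof -
  define S where "S = mat d d (\<lambda>(p, q). \<Sum>i\<in>{1..d}. sqrt (ev i) * (v i $ p * v i $ q))"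
  have Sc: "S \<in> carrier_mat d d" by (simp add: S_def)
  have Sx: "S *\<^sub>v x = of_co (\<lambda>i. sqrt (ev i) * co x i)" if x: "x \<in> carrier_vec d" for x
  proof (rule eq_vecI)
    fix p assume "p < dim_vec (of_co (\<lambda>i. sqrt (ev i) * co x i))"
    then have p: "p < d" by (simp add: of_co_def)
    have "(S *\<^sub>v x) $ p = (\<Sum>q<d. \<Sum>i\<in>{1..d}. sqrt (ev i) * (v i $ p * v i $ q) * x $ q)"
      using p x by (simp add: S_def scalar_prod_def atLeast0LessThan sum_distrib_right)
    also have "\<dots> = (\<Sum>i\<in>{1..d}. \<Sum>q<d. sqrt (ev i) * (v i $ p * v i $ q) * x $ q)"
      by (rule sum.swap)
    also have "\<dots> = (\<Sum>i\<in>{1..d}. sqrt (ev i) * co x i * v i $ p)"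
      using x by (intro sum.cong refl) (simp add: co_def scalar_prod_def atLeast0LessThan sum_distrib_left sum_distrib_right mult_ac)
    finally show "(S *\<^sub>v x) $ p = of_co (\<lambda>i. sqrt (ev i) * co x i) $ p" using p by (simp add: of_co_def)
  qed (simp add: S_def of_co_def)
  have psd: "symmetric_pos_semidef d S"
    unfolding symmetric_pos_semidef_def
  proof (intro conjI ballI)
    show "S\<^sup>T = S" by (rule eq_matI) (auto simp: S_def mult_ac)
    fix x :: "real vec" assume x: "x \<in> carrier_vec d"
    have "x \<bullet> (S *\<^sub>v x) = (\<Sum>i\<in>{1..d}. co x i * (sqrt (ev i) * co x i))"
      unfolding Sx[OF x] scalar_prod_co[OF x of_co_carrier] by (intro sum.cong refl) (simp del: One_nat_def atLeastAtMost_iff)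
    also have "\<dots> \<ge> 0"
    proof (rule sum_nonneg)
      fix i assume "i \<in> {1..d}"
      then have "0 \<le> sqrt (ev i) * (co x i * co x i)" using ev_pos[of i] by simp
      then show "0 \<le> co x i * (sqrt (ev i) * co x i)" by (simp add: mult_ac)
    qed
    finally show "x \<bullet> (S *\<^sub>v x) \<ge> 0" .
  qed (rule Sc)
  have SS: "S * S = A"
  proof (rule mat_eq_on_vecI)
    fix x :: "real vec" assume x: "x \<in> carrier_vec d"
    have "S * S *\<^sub>v x = S *\<^sub>v (S *\<^sub>v x)" by (rule assoc_mult_mat_vec[OF Sc Sc x])
    also have "\<dots> = of_co (\<lambda>i. sqrt (ev i) * co (of_co (\<lambda>i. sqrt (ev i) * co x i)) i)"
      by (simp add: Sx x)
    also have "\<dots> = A *\<^sub>v x"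
    proof (rule co_eqI)
      fix i assume i: "i \<in> {1..d}"
      have "sqrt (ev i) * (sqrt (ev i) * co x i) = ev i * co x i"
        using ev_pos[OF i] by (simp add: mult.assoc[symmetric])
      then show "co (of_co (\<lambda>i. sqrt (ev i) * co (of_co (\<lambda>i. sqrt (ev i) * co x i)) i)) i = co (A *\<^sub>v x) i"
        using i x by (simp add: co_A[OF i x] del: One_nat_def atLeastAtMost_iff)
    qed (use x in auto)
    finally show "S * S *\<^sub>v x = A *\<^sub>v x" .
  qed (use Sc in auto)
  have uniq: "S' = S" if S': "symmetric_pos_semidef d S' \<and> S' * S' = A" for S'
  proof (rule mat_eq_on_vecI)
    show "S' \<in> carrier_mat d d" using S' by (simp add: symmetric_pos_semidef_def)
    fix x :: "real vec" assume x: "x \<in> carrier_vec d"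
    show "S' *\<^sub>v x = S *\<^sub>v x"
    proof (rule co_eqI)
      have S'c: "S' \<in> carrier_mat d d" using S' by (simp add: symmetric_pos_semidef_def)
      show "S' *\<^sub>v x \<in> carrier_vec d" "S *\<^sub>v x \<in> carrier_vec d"
        using x by (rule mult_mat_vec_carrier[OF S'c], rule mult_mat_vec_carrier[OF Sc])
      show "co (S' *\<^sub>v x) i = co (S *\<^sub>v x) i" if i: "i \<in> {1..d}" for i
        unfolding co_psd_sqrt[OF psd SS i x] by (rule co_psd_sqrt[OF conjunct1[OF S'] conjunct2[OF S'] i x])
    qed
  qed (rule Sc)
  show ?thesis
    unfolding mat_sqrt_def A_dim
  proof (rule theI)
    show "symmetric_pos_semidef d S \<and> S * S = A" using psd SS by (rule conjI)
  qed (rule uniq)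
qed

lemma mat_sqrt_carrier [simp]: "mat_sqrt A \<in> carrier_mat d d"
  using mat_sqrt_psd by (simp add: symmetric_pos_semidef_def)

lemma co_mat_sqrt:
  assumes "i \<in> {1..d}" "x \<in> carrier_vec d" shows "co (mat_sqrt A *\<^sub>v x) i = sqrt (ev i) * co x i"
  by (rule co_psd_sqrt[OF conjunct1[OF mat_sqrt_psd] conjunct2[OF mat_sqrt_psd] assms])

text \<open>
  The upper bound for the quotients in the proof shows that the supremum is taken over a bounded set; without it the
  supremum would have no meaning.
\<close>

lemma mat_norm_sqrt_ge:
  assumes d: "d \<ge> 1" shows "sqrt (ev 1) \<le> mat_norm (mat_sqrt A)"
proof -
  have bound: "norm2 (mat_sqrt A *\<^sub>v x) / norm2 x \<le> sqrt (ev 1)" if x: "x \<in> carrier_vec d" for x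
  proof -
    have Sx: "mat_sqrt A *\<^sub>v x \<in> carrier_vec d" using x by (intro mult_mat_vec_carrier[where n = d]) auto
    have "(\<Sum>i\<in>{1..d}. (co (mat_sqrt A *\<^sub>v x) i)\<^sup>2) \<le> (\<Sum>i\<in>{1..d}. ev 1 * (co x i)\<^sup>2)"
    proof (rule sum_mono)
      fix i assume i: "i \<in> {1..d}"
      have "(co (mat_sqrt A *\<^sub>v x) i)\<^sup>2 = ev i * (co x i)\<^sup>2"
        using ev_pos[OF i] by (simp add: co_mat_sqrt[OF i x] power_mult_distrib)
      also have "\<dots> \<le> ev 1 * (co x i)\<^sup>2" using i ev_antimono[of 1 i] by (intro mult_right_mono) auto
      finally show "(co (mat_sqrt A *\<^sub>v x) i)\<^sup>2 \<le> ev 1 * (co x i)\<^sup>2" .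
    qed
    then have "norm2 (mat_sqrt A *\<^sub>v x) \<le> sqrt (ev 1) * norm2 x"
      unfolding norm2_co[OF Sx] norm2_co[OF x] real_sqrt_mult[symmetric] sum_distrib_left by simp
    moreover have "norm2 x \<ge> 0" unfolding norm2_co[OF x] by (simp add: sum_nonneg)
    moreover have "ev 1 > 0" using ev_pos[of 1] d by simp
    ultimately show ?thesis
      by (cases "norm2 x = 0") (auto simp: divide_le_eq)
  qed
  have v1: "v 1 \<in> carrier_vec d" using d by simp
  have "norm2 (mat_sqrt A *\<^sub>v v 1) / norm2 (v 1) = sqrt (ev 1)"
  proof -
    have Sv: "mat_sqrt A *\<^sub>v v 1 \<in> carrier_vec d" using v1 by (intro mult_mat_vec_carrier[where n = d]) auto
    have co1: "co (v 1) i = (if i = 1 then 1 else 0)" if "i \<in> {1..d}" for i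
      using v_orthonormal[OF that, of 1] d by (simp add: co_def)
    have "(\<Sum>i\<in>{1..d}. (co (mat_sqrt A *\<^sub>v v 1) i)\<^sup>2) = (\<Sum>i\<in>{1..d}. if i = 1 then ev 1 else 0)"
      using ev_pos[of 1] d by (intro sum.cong refl) (auto simp: co_mat_sqrt v1 co1 simp del: One_nat_def)
    then have a: "norm2 (mat_sqrt A *\<^sub>v v 1) = sqrt (ev 1)" unfolding norm2_co[OF Sv] using d by simp
    have "v 1 \<bullet> v 1 = 1" using v_orthonormal[of 1 1] d by simp
    then show ?thesis using a by (simp add: norm2_def)
  qed
  moreover have "norm2 (mat_sqrt A *\<^sub>v v 1) / norm2 (v 1) \<le> mat_norm (mat_sqrt A)"
    unfolding mat_norm_def carrier_matD(2)[OF mat_sqrt_carrier]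
    by (rule cSUP_upper[OF v1]) (use bound in \<open>auto intro!: bdd_aboveI2[where M = "sqrt (ev 1)"]\<close>)
  ultimately show ?thesis by simp
qed

end

section \<open>Deflation of the large eigenvalues\<close>

text \<open>
  The norm of \<open>I + c 1 1\<^sup>T\<close> is \<open>1 + c n\<close>; expanded and estimated by Cauchy--Schwarz.
\<close>

lemma sum_mean_perturbation_bound:
  fixes a :: "'i \<Rightarrow> real"
  assumes I: "finite I" and c: "c \<ge> 0"
  shows "(\<Sum>i\<in>I. (a i + c * (\<Sum>j\<in>I. a j))\<^sup>2) \<le> (1 + c * card I)\<^sup>2 * (\<Sum>i\<in>I. (a i)\<^sup>2)"
proof -
  define T where "T = (\<Sum>j\<in>I. a j)"
  define S where "S = (\<Sum>i\<in>I. (a i)\<^sup>2)"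
  have TS: "T\<^sup>2 \<le> S * card I"
    using Cauchy_Schwarz_ineq_sum[of a "\<lambda>_. 1" I] by (simp add: T_def S_def)
  have "(\<Sum>i\<in>I. (a i + c * T)\<^sup>2) = (\<Sum>i\<in>I. (a i)\<^sup>2 + 2 * c * T * a i + c\<^sup>2 * T\<^sup>2)"
    by (intro sum.cong refl) (simp add: power2_eq_square algebra_simps)
  also have "\<dots> = S + 2 * c * T * T + card I * (c\<^sup>2 * T\<^sup>2)"
    by (simp add: sum.distrib S_def T_def sum_distrib_left)
  also have "\<dots> = S + 2 * c * T\<^sup>2 + card I * c\<^sup>2 * T\<^sup>2" by (simp add: power2_eq_square)
  also have "\<dots> \<le> S + 2 * c * (S * card I) + card I * c\<^sup>2 * (S * card I)"
    using c by (intro add_mono mult_left_mono TS) auto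
  also have "\<dots> = (1 + c * card I)\<^sup>2 * S" by (simp add: power2_eq_square algebra_simps)
  finally show ?thesis by (simp add: T_def S_def)
qed

context eigenbasis
begin

text \<open>
  Here \<open>J\<close> is the set of indices to be deflated and \<open>u\<^sub>j = \<Sum>\<^sub>l U\<^sub>j\<^sub>l(A) b\<^sub>l\<close> approximates \<open>v j\<close> for \<open>j\<close> in \<open>J - J'\<close>.  Write
  \<open>\<rho>(y) = 1 - (y + \<mu>) p(y)\<close>.  The Krylov vector \<open>p(A) b + \<Sum>\<^sub>j (b\<^sub>j/(\<lambda>\<^sub>j + \<mu>)) \<rho>(A) u\<^sub>j\<close> has the error
  \<open>\<rho>(\<lambda>\<^sub>i) (b\<^sub>i/(\<lambda>\<^sub>i + \<mu>) - \<Sum>\<^sub>j (b\<^sub>j/(\<lambda>\<^sub>j + \<mu>)) u\<^sub>j\<^sub>i)\<close> at index \<open>i\<close>.  It vanishes on \<open>J - J'\<close> by the second factor and on \<open>J'\<close> by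
  the first one.  Outside \<open>J\<close> the energy weight \<open>\<lambda>\<^sub>i + \<mu>\<close> is at most that of each \<open>j\<close> in \<open>J\<close>, so the sum over \<open>j\<close> costs only the
  factor \<open>1 + \<epsilon> d\<close>.
\<close>

lemma cg_residual_deflation_bound:
  assumes B: "B \<in> carrier_mat d m" and i0: "i0 < m" and \<mu>: "\<mu> \<ge> 0"
    and J: "J \<subseteq> {1..d}" and J': "J' \<subseteq> J"
    and \<rho>: "poly \<rho> (- \<mu>) = 1" "degree \<rho> \<le> n" and t: "n + s \<le> t"
    and \<rho>0: "\<And>j. j \<in> J' \<Longrightarrow> poly \<rho> (ev j) = 0"
    and \<rho>\<tau>: "\<And>i. i \<in> {1..d} - J \<Longrightarrow> \<bar>poly \<rho> (ev i)\<bar> \<le> \<tau>"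
    and U: "\<And>j l. j \<in> J - J' \<Longrightarrow> l < m \<Longrightarrow> degree_below s (U j l)"
    and Uc: "\<And>j i. j \<in> J - J' \<Longrightarrow> i \<in> J - J' \<Longrightarrow>
        (\<Sum>l<m. poly (U j l) (ev i) * co (col B l) i) = (if i = j then 1 else 0)"
    and U\<epsilon>: "\<And>j i. j \<in> J - J' \<Longrightarrow> i \<in> {1..d} - J \<Longrightarrow>
        \<bar>\<Sum>l<m. poly (U j l) (ev i) * co (col B l) i\<bar> \<le> \<epsilon>"
    and order: "\<And>i j. j \<in> J \<Longrightarrow> i \<in> {1..d} - J \<Longrightarrow> ev i \<le> ev j"
    and \<tau>: "\<tau> \<ge> 0" and \<epsilon>: "\<epsilon> \<ge> 0"
  shows "energy \<mu> (cg_residual B t i0 \<mu>) \<le> (\<tau> * (1 + \<epsilon> * d))\<^sup>2 * (\<Sum>i\<in>{1..d}. (co (col B i0) i)\<^sup>2 / (ev i + \<mu>))"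
proof -
  define \<beta> where "\<beta> l i = co (col B l) i" for l i
  define uc where "uc j i = (\<Sum>l<m. poly (U j l) (ev i) * \<beta> l i)" for j i
  have pos: "ev i + \<mu> > 0" if "i \<in> {1..d}" for i using ev_pos[OF that] \<mu> by simp
  have finJ: "finite (J - J')" using J finite_subset by blast
  have "poly (1 - \<rho>) (- \<mu>) = 0" using \<rho> by simp
  then obtain p where p: "1 - \<rho> = [:\<mu>, 1:] * p" by (metis poly_eq_0_iff_dvd dvdE minus_minus)
  have p_deg: "degree_below n p"
  proof (cases "p = 0")
    case False
    have "degree (1 - \<rho>) \<le> n" using degree_diff_le[of 1 n \<rho>] \<rho>(2) by simp
    moreover have "degree (1 - \<rho>) = 1 + degree p" unfolding p using False by (subst degree_mult_eq) auto
    ultimately show ?thesis by (simp add: degree_below_iff)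
  qed (simp add: degree_below_def)
  have \<rho>p: "poly \<rho> x = 1 - (x + \<mu>) * poly p x" for x
    using arg_cong[OF p, of "\<lambda>q. poly q x"] by (simp add: algebra_simps)
  define Q where "Q l = (if l = i0 then p else 0) + (\<Sum>j\<in>J - J'. Polynomial.smult (\<beta> i0 j / (ev j + \<mu>)) (\<rho> * U j l))" for l
  have Q: "degree_below t (Q l)" if "l < m" for l
    unfolding Q_def
  proof (intro degree_below_add degree_below_sum degree_below_smult)
    show "degree_below t (if l = i0 then p else 0)"
      using degree_below_mono[OF p_deg, of t] t by (simp add: degree_below_def)
    show "degree_below t (\<rho> * U j l)" if "j \<in> J - J'" for j
      by (rule degree_below_mono[OF degree_below_mult[OF \<rho>(2) U[OF that \<open>l < m\<close>]] t])
  qed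
  define a where "a i = \<bar>\<beta> i0 i\<bar> / sqrt (ev i + \<mu>)" for i
  define e where "e i = \<beta> i0 i / (ev i + \<mu>) - (\<Sum>l<m. poly (Q l) (ev i) * \<beta> l i)" for i
  have e_eq: "e i = poly \<rho> (ev i) * (\<beta> i0 i / (ev i + \<mu>) - (\<Sum>j\<in>J - J'. \<beta> i0 j / (ev j + \<mu>) * uc j i))"
    if i: "i \<in> {1..d}" for i
  proof -
    have "(\<Sum>l<m. poly (Q l) (ev i) * \<beta> l i)
       = (\<Sum>l<m. (if l = i0 then poly p (ev i) * \<beta> l i else 0)
            + (\<Sum>j\<in>J - J'. \<beta> i0 j / (ev j + \<mu>) * poly \<rho> (ev i) * (poly (U j l) (ev i) * \<beta> l i)))"
      by (intro sum.cong refl) (simp add: Q_def poly_sum distrib_right sum_distrib_right mult.assoc)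
    also have "\<dots> = poly p (ev i) * \<beta> i0 i + (\<Sum>l<m. \<Sum>j\<in>J - J'. \<beta> i0 j / (ev j + \<mu>) * poly \<rho> (ev i) * (poly (U j l) (ev i) * \<beta> l i))"
      unfolding sum.distrib using i0 by simp
    also have "(\<Sum>l<m. \<Sum>j\<in>J - J'. \<beta> i0 j / (ev j + \<mu>) * poly \<rho> (ev i) * (poly (U j l) (ev i) * \<beta> l i))
       = (\<Sum>j\<in>J - J'. \<beta> i0 j / (ev j + \<mu>) * poly \<rho> (ev i) * uc j i)"
      unfolding uc_def sum_distrib_left by (rule sum.swap)
    also have "\<dots> = poly \<rho> (ev i) * (\<Sum>j\<in>J - J'. \<beta> i0 j / (ev j + \<mu>) * uc j i)"
      by (simp add: sum_distrib_left mult_ac)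
    finally have "e i = \<beta> i0 i / (ev i + \<mu>) - poly p (ev i) * \<beta> i0 i - poly \<rho> (ev i) * (\<Sum>j\<in>J - J'. \<beta> i0 j / (ev j + \<mu>) * uc j i)"
      by (simp add: e_def)
    moreover have "poly \<rho> (ev i) * (\<beta> i0 i / (ev i + \<mu>)) = \<beta> i0 i / (ev i + \<mu>) - poly p (ev i) * \<beta> i0 i"
      unfolding \<rho>p using pos[OF i] by (simp add: field_simps)
    ultimately show ?thesis by (simp add: right_diff_distrib)
  qed
  have eJ: "e i = 0" if i: "i \<in> J" for i
  proof (cases "i \<in> J'")
    case True
    then show ?thesis using e_eq[of i] \<rho>0[OF True] i J by auto
  next
    case False
    have "(\<Sum>j\<in>J - J'. \<beta> i0 j / (ev j + \<mu>) * uc j i) = (\<Sum>j\<in>J - J'. if j = i then \<beta> i0 j / (ev j + \<mu>) else 0)"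
      using Uc i False by (intro sum.cong refl) (auto simp: uc_def \<beta>_def)
    also have "\<dots> = \<beta> i0 i / (ev i + \<mu>)" using finJ i False by simp
    finally show ?thesis using e_eq[of i] i J by auto
  qed
  have e_bound: "(ev i + \<mu>) * (e i)\<^sup>2 \<le> \<tau>\<^sup>2 * (a i + \<epsilon> * (\<Sum>j\<in>{1..d}. a j))\<^sup>2" if i: "i \<in> {1..d}" for i
  proof (cases "i \<in> J")
    case True
    then show ?thesis using eJ by simp
  next
    case False
    then have iJ: "i \<in> {1..d} - J" using i by simp
    let ?r = "sqrt (ev i + \<mu>)"
    have r: "?r > 0" "?r\<^sup>2 = ev i + \<mu>" using pos[OF i] by simp_all
    have a0: "a j \<ge> 0" if "j \<in> {1..d}" for j using pos[OF that] by (simp add: a_def)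
    have t1: "?r * \<bar>\<beta> i0 i / (ev i + \<mu>)\<bar> = a i"
      using r pos[OF i] by (simp add: a_def field_simps power2_eq_square)
    have t2: "?r * \<bar>\<Sum>j\<in>J - J'. \<beta> i0 j / (ev j + \<mu>) * uc j i\<bar> \<le> \<epsilon> * (\<Sum>j\<in>{1..d}. a j)"
    proof -
      have "?r * \<bar>\<Sum>j\<in>J - J'. \<beta> i0 j / (ev j + \<mu>) * uc j i\<bar> \<le> ?r * (\<Sum>j\<in>J - J'. \<bar>\<beta> i0 j / (ev j + \<mu>) * uc j i\<bar>)"
        using r by (intro mult_left_mono sum_abs) simp
      also have "\<dots> = (\<Sum>j\<in>J - J'. ?r * \<bar>\<beta> i0 j / (ev j + \<mu>) * uc j i\<bar>)" by (rule sum_distrib_left)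
      also have "\<dots> \<le> (\<Sum>j\<in>J - J'. \<epsilon> * a j)"
      proof (rule sum_mono)
        fix j assume j: "j \<in> J - J'"
        then have jd: "j \<in> {1..d}" using J by auto
        have rj: "?r \<le> sqrt (ev j + \<mu>)" using order[of j i] j iJ by simp
        have sj: "sqrt (ev j + \<mu>) > 0" "sqrt (ev j + \<mu>) * sqrt (ev j + \<mu>) = ev j + \<mu>" using pos[OF jd] by simp_all
        have "?r * \<bar>\<beta> i0 j / (ev j + \<mu>) * uc j i\<bar> = (?r * \<bar>\<beta> i0 j / (ev j + \<mu>)\<bar>) * \<bar>uc j i\<bar>"
          by (simp add: abs_mult)
        also have "\<dots> \<le> a j * \<epsilon>"
        proof (rule mult_mono)
          have "?r * \<bar>\<beta> i0 j / (ev j + \<mu>)\<bar> \<le> sqrt (ev j + \<mu>) * \<bar>\<beta> i0 j / (ev j + \<mu>)\<bar>"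
            using rj by (intro mult_right_mono) simp_all
          also have "\<dots> = a j" using sj pos[OF jd] by (simp add: a_def field_simps)
          finally show "?r * \<bar>\<beta> i0 j / (ev j + \<mu>)\<bar> \<le> a j" .
          show "\<bar>uc j i\<bar> \<le> \<epsilon>" using U\<epsilon>[OF j iJ] by (simp add: uc_def \<beta>_def)
        qed (use a0[OF jd] in simp_all)
        finally show "?r * \<bar>\<beta> i0 j / (ev j + \<mu>) * uc j i\<bar> \<le> \<epsilon> * a j" by (simp add: mult.commute)
      qed
      also have "\<dots> \<le> (\<Sum>j\<in>{1..d}. \<epsilon> * a j)"
        using J a0 \<epsilon> by (intro sum_mono2) auto
      finally show ?thesis by (simp add: sum_distrib_left)
    qed
    have "?r * \<bar>e i\<bar> = \<bar>poly \<rho> (ev i)\<bar> * (?r * \<bar>\<beta> i0 i / (ev i + \<mu>) - (\<Sum>j\<in>J - J'. \<beta> i0 j / (ev j + \<mu>) * uc j i)\<bar>)"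
      unfolding e_eq[OF i] abs_mult by (simp only: mult_ac)
    also have "\<dots> \<le> \<tau> * (a i + \<epsilon> * (\<Sum>j\<in>{1..d}. a j))"
    proof (rule mult_mono)
      have "?r * \<bar>\<beta> i0 i / (ev i + \<mu>) - (\<Sum>j\<in>J - J'. \<beta> i0 j / (ev j + \<mu>) * uc j i)\<bar>
         \<le> ?r * (\<bar>\<beta> i0 i / (ev i + \<mu>)\<bar> + \<bar>\<Sum>j\<in>J - J'. \<beta> i0 j / (ev j + \<mu>) * uc j i\<bar>)"
        using r by (intro mult_left_mono abs_triangle_ineq4) simp
      also have "\<dots> \<le> a i + \<epsilon> * (\<Sum>j\<in>{1..d}. a j)"
        unfolding distrib_left t1 using t2 by simp
      finally show "?r * \<bar>\<beta> i0 i / (ev i + \<mu>) - (\<Sum>j\<in>J - J'. \<beta> i0 j / (ev j + \<mu>) * uc j i)\<bar> \<le> a i + \<epsilon> * (\<Sum>j\<in>{1..d}. a j)" .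
    qed (use \<rho>\<tau>[OF iJ] \<tau> r in simp_all)
    finally have "(?r * \<bar>e i\<bar>)\<^sup>2 \<le> (\<tau> * (a i + \<epsilon> * (\<Sum>j\<in>{1..d}. a j)))\<^sup>2"
      using r by (intro power_mono) simp_all
    then show ?thesis by (simp only: power_mult_distrib power2_abs r(2))
  qed
  have "energy \<mu> (cg_residual B t i0 \<mu>) \<le> energy \<mu> e"
    using cg_residual_minimal[OF B i0 \<mu>, of t Q, OF Q] by (simp only: e_def[abs_def] \<beta>_def)
  also have "\<dots> \<le> (\<Sum>i\<in>{1..d}. \<tau>\<^sup>2 * (a i + \<epsilon> * (\<Sum>j\<in>{1..d}. a j))\<^sup>2)"
    unfolding energy_def by (rule sum_mono) (rule e_bound)
  also have "\<dots> = \<tau>\<^sup>2 * (\<Sum>i\<in>{1..d}. (a i + \<epsilon> * (\<Sum>j\<in>{1..d}. a j))\<^sup>2)"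
    by (rule sum_distrib_left[symmetric])
  also have "\<dots> \<le> \<tau>\<^sup>2 * ((1 + \<epsilon> * card {1..d})\<^sup>2 * (\<Sum>i\<in>{1..d}. (a i)\<^sup>2))"
    by (intro mult_left_mono sum_mean_perturbation_bound \<epsilon>) simp_all
  also have "(\<Sum>i\<in>{1..d}. (a i)\<^sup>2) = (\<Sum>i\<in>{1..d}. (co (col B i0) i)\<^sup>2 / (ev i + \<mu>))"
  proof (intro sum.cong refl)
    fix i assume "i \<in> {1..d}"
    then show "(a i)\<^sup>2 = (co (col B i0) i)\<^sup>2 / (ev i + \<mu>)"
      using pos[of i] by (simp add: a_def \<beta>_def power_divide)
  qed
  finally show ?thesis by (simp add: power_mult_distrib mult.assoc)
qed

end

section \<open>An elliptic integral\<close>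

text \<open>
  The integrand \<open>a/(a + z\<^sup>2)\<close> has the primitive \<open>\<surd>a arctan(z/\<surd>a)\<close>.
\<close>

lemma sqrt_integral_representation:
  fixes a :: real assumes a: "a > 0"
  shows "has_bochner_integral lborel (\<lambda>z. indicator {0..} z * (a / (a + z\<^sup>2))) (pi / 2 * sqrt a)"
proof -
  define s where "s = sqrt a"
  have s: "s > 0" "a = s\<^sup>2" using a by (simp_all add: s_def)
  have pos: "s\<^sup>2 + z\<^sup>2 > 0" for z using s(1) by (simp add: add_pos_nonneg)
  have "has_bochner_integral lborel (\<lambda>z. indicator {0..} z * (s\<^sup>2 / (s\<^sup>2 + z\<^sup>2))) (pi / 2 * s)"
  proof (rule has_bochner_integral_nn_integral)
    show "(\<lambda>z. indicator {0..} z * (s\<^sup>2 / (s\<^sup>2 + z\<^sup>2))) \<in> borel_measurable lborel" by measurable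
    show "AE z in lborel. 0 \<le> indicator {0..} z * (s\<^sup>2 / (s\<^sup>2 + z\<^sup>2))" by (intro AE_I2) simp
    show "0 \<le> pi / 2 * s" using s by simp
    have "(\<integral>\<^sup>+z. ennreal (indicator {0..} z * (s\<^sup>2 / (s\<^sup>2 + z\<^sup>2))) \<partial>lborel)
        = (\<integral>\<^sup>+z. ennreal (s\<^sup>2 / (s\<^sup>2 + z\<^sup>2)) * indicator {0..} z \<partial>lborel)"
      by (intro nn_integral_cong) (simp add: indicator_def)
    also have "\<dots> = ennreal (s * (pi / 2) - s * arctan (0 / s))"
    proof (rule nn_integral_FTC_atLeast)
      show "(\<lambda>z. s\<^sup>2 / (s\<^sup>2 + z\<^sup>2)) \<in> borel_measurable borel" by measurable
      show "((\<lambda>z. s * arctan (z / s)) has_real_derivative s\<^sup>2 / (s\<^sup>2 + x\<^sup>2)) (at x)" for x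
      proof -
        have "((\<lambda>z. arctan (z / s)) has_real_derivative inverse (1 + (x / s)\<^sup>2) * (1 / s)) (at x)"
          by (rule DERIV_chain2[OF DERIV_arctan]) (use s(1) in \<open>auto intro!: derivative_eq_intros\<close>)
        then have "((\<lambda>z. s * arctan (z / s)) has_real_derivative s * (inverse (1 + (x / s)\<^sup>2) * (1 / s))) (at x)"
          by (rule DERIV_cmult)
        moreover have "s * (inverse (1 + (x / s)\<^sup>2) * (1 / s)) = s\<^sup>2 / (s\<^sup>2 + x\<^sup>2)"
        proof -
          have "1 + (x / s)\<^sup>2 = (s\<^sup>2 + x\<^sup>2) / s\<^sup>2" using s(1) by (simp add: power_divide add_divide_distrib)
          then show ?thesis using s(1) by simp
        qed
        ultimately show ?thesis by simp
      qed
      show "0 \<le> s\<^sup>2 / (s\<^sup>2 + x\<^sup>2)" for x by simp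
      have "filterlim (\<lambda>z. 1 / s * z) at_top at_top"
        using s(1) by (intro filterlim_tendsto_pos_mult_at_top[OF tendsto_const _ filterlim_ident]) simp
      then have "filterlim (\<lambda>z. z / s) at_top at_top" by simp
      then have "((\<lambda>z. arctan (z / s)) \<longlongrightarrow> pi / 2) at_top"
        by (rule filterlim_compose[OF tendsto_arctan_at_top])
      then show "((\<lambda>z. s * arctan (z / s)) \<longlongrightarrow> s * (pi / 2)) at_top"
        by (intro tendsto_intros)
    qed
    finally show "(\<integral>\<^sup>+z. ennreal (indicator {0..} z * (s\<^sup>2 / (s\<^sup>2 + z\<^sup>2))) \<partial>lborel) = ennreal (pi / 2 * s)"
      by (simp add: mult.commute)
  qed
  then show ?thesis unfolding s(2)[symmetric] by (simp only: s_def)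
qed

lemma elliptic_integrand_le:
  fixes A b z :: real assumes A: "A > 0" and b: "b > 0"
  shows "A\<^sup>2 / sqrt ((A\<^sup>2 + z\<^sup>2) * (b + z\<^sup>2)) \<le> A / sqrt (b + z\<^sup>2)"
    and "z \<ge> A \<Longrightarrow> A\<^sup>2 / sqrt ((A\<^sup>2 + z\<^sup>2) * (b + z\<^sup>2)) \<le> A\<^sup>2 / z\<^sup>2"
proof -
  define p where "p = sqrt (A\<^sup>2 + z\<^sup>2)"
  define q where "q = sqrt (b + z\<^sup>2)"
  have p: "p > 0" "A \<le> p" "z \<le> p" and q: "q > 0" "z \<le> q"
    unfolding p_def q_def using A b by (auto simp: add_pos_nonneg intro!: real_le_rsqrt)
  have pq: "sqrt ((A\<^sup>2 + z\<^sup>2) * (b + z\<^sup>2)) = p * q" by (simp only: p_def q_def real_sqrt_mult)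
  have "A\<^sup>2 / (p * q) = (A / q) * (A / p)" by (simp add: power2_eq_square)
  also have "\<dots> \<le> (A / q) * 1" using A p q by (intro mult_left_mono) simp_all
  finally show "A\<^sup>2 / sqrt ((A\<^sup>2 + z\<^sup>2) * (b + z\<^sup>2)) \<le> A / sqrt (b + z\<^sup>2)"
    unfolding pq by (simp add: q_def)
  assume z: "z \<ge> A"
  have "z * z \<le> p * q" using z A p q by (intro mult_mono) simp_all
  then show "A\<^sup>2 / sqrt ((A\<^sup>2 + z\<^sup>2) * (b + z\<^sup>2)) \<le> A\<^sup>2 / z\<^sup>2"
    unfolding pq
    unfolding power2_eq_square[of z] using z A p q by (intro divide_left_mono) simp_all
qed

lemma nn_integral_inverse_sqrt:
  fixes A b :: real assumes A: "A > 0" and b: "b > 0"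
  shows "(\<integral>\<^sup>+z. ennreal (A / sqrt (b + z\<^sup>2)) * indicator {0..A} z \<partial>lborel)
    = ennreal (A * ln (A + sqrt (b + A\<^sup>2)) - A * ln (0 + sqrt (b + 0\<^sup>2)))"
proof (rule nn_integral_FTC_Icc[where F = "\<lambda>z. A * ln (z + sqrt (b + z\<^sup>2))"])
  have pos: "b + x\<^sup>2 > 0" for x using b by (simp add: add_pos_nonneg)
  show "(\<lambda>z. A / sqrt (b + z\<^sup>2)) \<in> borel_measurable borel" by measurable
  show "((\<lambda>z. A * ln (z + sqrt (b + z\<^sup>2))) has_real_derivative A / sqrt (b + x\<^sup>2)) (at x)"
    if "x \<in> {0..A}" for x
  proof -
    have x: "0 \<le> x" using that by simp
    define q where "q = sqrt (b + x\<^sup>2)"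
    have q: "q > 0" using pos by (simp add: q_def)
    have 1: "((\<lambda>z. b + z\<^sup>2) has_real_derivative 2 * x) (at x)"
      by (auto intro!: derivative_eq_intros)
    have 2: "((\<lambda>z. sqrt (b + z\<^sup>2)) has_real_derivative (inverse (sqrt (b + x\<^sup>2)) / 2) * (2 * x)) (at x)"
      by (rule DERIV_chain2[OF DERIV_real_sqrt 1]) (rule pos)
    have 3: "((\<lambda>z. z + sqrt (b + z\<^sup>2)) has_real_derivative 1 + (inverse q / 2) * (2 * x)) (at x)"
      unfolding q_def by (rule DERIV_add[OF DERIV_ident 2])
    have "((\<lambda>z. ln (z + sqrt (b + z\<^sup>2))) has_real_derivative (1 / (x + q)) * (1 + (inverse q / 2) * (2 * x))) (at x)"
      unfolding q_def by (rule DERIV_chain2[OF DERIV_ln_divide 3[unfolded q_def]]) (use add_nonneg_pos[OF x q] in \<open>simp only: q_def\<close>)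
    then have "((\<lambda>z. A * ln (z + sqrt (b + z\<^sup>2))) has_real_derivative A * ((1 / (x + q)) * (1 + (inverse q / 2) * (2 * x)))) (at x)"
      by (rule DERIV_cmult)
    moreover have "A * ((1 / (x + q)) * (1 + (inverse q / 2) * (2 * x))) = A / q"
    proof -
      have "1 + (inverse q / 2) * (2 * x) = (x + q) / q" using q by (simp add: field_simps)
      then show ?thesis using add_nonneg_pos[OF x q] q by simp
    qed
    ultimately show ?thesis by (simp only: q_def)
  qed
  show "0 \<le> A / sqrt (b + x\<^sup>2)" for x using A pos[of x] by simp
qed (use A in simp)

lemma nn_integral_inverse_square:
  fixes A :: real assumes A: "A > 0"
  shows "(\<integral>\<^sup>+z. ennreal (A\<^sup>2 / z\<^sup>2) * indicator {A..} z \<partial>lborel) = ennreal (0 - (- (A\<^sup>2 / A)))"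
proof (rule nn_integral_FTC_atLeast[where F = "\<lambda>z. - (A\<^sup>2 / z)"])
  show "(\<lambda>z. A\<^sup>2 / z\<^sup>2) \<in> borel_measurable borel" by measurable
  show "((\<lambda>z. - (A\<^sup>2 / z)) has_real_derivative A\<^sup>2 / x\<^sup>2) (at x)" if "A \<le> x" for x
    using that A by (auto intro!: derivative_eq_intros simp: power2_eq_square)
  show "0 \<le> A\<^sup>2 / x\<^sup>2" for x by simp
  have "((\<lambda>z. A\<^sup>2 / z) \<longlongrightarrow> 0) at_top"
    by (rule tendsto_divide_0[OF tendsto_const filterlim_at_top_imp_at_infinity[OF filterlim_ident]])
  from tendsto_minus[OF this] show "((\<lambda>z. - (A\<^sup>2 / z)) \<longlongrightarrow> 0) at_top" by simp
qed

text \<open>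
  For \<open>z \<le> \<surd>a\<close> the integrand is at most \<open>\<surd>a/\<surd>(b + z\<^sup>2)\<close>, whose primitive is an inverse hyperbolic sine and contributes the
  logarithm; beyond \<open>\<surd>a\<close> it is at most \<open>a/z\<^sup>2\<close>.
\<close>

lemma elliptic_integral_bound:
  fixes a b :: real assumes b: "b > 0" and ab: "b \<le> a"
  shows "(\<integral>\<^sup>+z. ennreal (a / sqrt ((a + z\<^sup>2) * (b + z\<^sup>2))) * indicator {0..} z \<partial>lborel)
     \<le> ennreal (sqrt a * (2 + ln (a / b) / 2))"
proof -
  define A where "A = sqrt a" define B where "B = sqrt b"
  have A: "A > 0" "a = A\<^sup>2" and B: "B > 0" "b = B\<^sup>2" using assms by (simp_all add: A_def B_def)
  have BA: "B \<le> A" using ab by (simp add: A_def B_def)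
  let ?F = "\<lambda>z. A * ln (z + sqrt (b + z\<^sup>2))"
  have majorant: "ennreal (A\<^sup>2 / sqrt ((A\<^sup>2 + z\<^sup>2) * (b + z\<^sup>2))) * indicator {0..} z
      \<le> ennreal (A / sqrt (b + z\<^sup>2)) * indicator {0..A} z + ennreal (A\<^sup>2 / z\<^sup>2) * indicator {A..} z" (is "?f * _ \<le> ?g * _ + ?h * _") for z
  proof -
    have g: "?f \<le> ?g" by (rule ennreal_leI[OF elliptic_integrand_le(1)[OF A(1) b]])
    have h: "?f \<le> ?h" if "z \<ge> A" by (rule ennreal_leI[OF elliptic_integrand_le(2)[OF A(1) b that]])
    consider "z < 0" | "0 \<le> z" "z \<le> A" | "z > A" by linarith
    then show ?thesis
    proof cases
      case 2
      then have "?f * indicator {0..} z = ?f" "?g * indicator {0..A} z = ?g" by simp_all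
      then show ?thesis using add_increasing2[OF zero_le g] by simp
    next
      case 3
      then have "?f * indicator {0..} z = ?f" "?h * indicator {A..} z = ?h" using A by simp_all
      then show ?thesis using add_increasing[OF zero_le h, of "?g * indicator {0..A} z"] 3 by simp
    qed simp
  qed
  have "(\<integral>\<^sup>+z. ennreal (A\<^sup>2 / sqrt ((A\<^sup>2 + z\<^sup>2) * (b + z\<^sup>2))) * indicator {0..} z \<partial>lborel)
      \<le> (\<integral>\<^sup>+z. ennreal (A / sqrt (b + z\<^sup>2)) * indicator {0..A} z + ennreal (A\<^sup>2 / z\<^sup>2) * indicator {A..} z \<partial>lborel)"
    by (rule nn_integral_mono) (rule majorant)
  also have "\<dots> = (\<integral>\<^sup>+z. ennreal (A / sqrt (b + z\<^sup>2)) * indicator {0..A} z \<partial>lborel)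
      + (\<integral>\<^sup>+z. ennreal (A\<^sup>2 / z\<^sup>2) * indicator {A..} z \<partial>lborel)"
    by (rule nn_integral_add) measurable
  also have "\<dots> = ennreal (?F A - ?F 0) + ennreal (A\<^sup>2 / A)"
    unfolding nn_integral_inverse_sqrt[OF A(1) b] nn_integral_inverse_square[OF A(1)] by simp
  also have "\<dots> = ennreal (?F A - ?F 0 + A\<^sup>2 / A)"
  proof (rule ennreal_plus[symmetric])
    have "0 + sqrt (b + 0\<^sup>2) \<le> A + sqrt (b + A\<^sup>2)" using A(1) by (intro add_mono real_sqrt_le_mono) simp_all
    moreover have "0 < 0 + sqrt (b + 0\<^sup>2)" using b by simp
    ultimately have "ln (0 + sqrt (b + 0\<^sup>2)) \<le> ln (A + sqrt (b + A\<^sup>2))" by (rule ln_mono)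
    then show "0 \<le> ?F A - ?F 0" using A(1) by simp
  qed (use A in simp)
  also have "\<dots> \<le> ennreal (A * (2 + ln (a / b) / 2))"
  proof (rule ennreal_leI)
    have sq: "sqrt (b + A\<^sup>2) \<le> 3 / 2 * A"
    proof (rule real_le_lsqrt)
      have "b \<le> A\<^sup>2" using ab A by simp
      moreover have "(3 / 2 * A)\<^sup>2 = 9 / 4 * A\<^sup>2" by (simp add: power_mult_distrib power_divide)
      ultimately show "b + A\<^sup>2 \<le> (3 / 2 * A)\<^sup>2" using zero_le_power2[of A] by linarith
    qed (use A in simp)
    have half: "ln (a / b) / 2 = ln A - ln B"
      using A B by (simp add: ln_div ln_realpow)
    have "5 / 2 \<le> exp (1::real)" using exp_lower_Taylor_quadratic[of 1] by simp
    then have "ln (5 / 2) \<le> ln (exp (1::real))" by (intro ln_mono) simp_all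
    then have e: "ln (5 / 2) \<le> (1::real)" by simp
    have "0 < A + sqrt (b + A\<^sup>2)" using A b by (intro add_pos_nonneg) simp_all
    moreover have "A + sqrt (b + A\<^sup>2) \<le> 5 / 2 * A" using sq by simp
    ultimately have "ln (A + sqrt (b + A\<^sup>2)) \<le> ln (5 / 2 * A)" by (intro ln_mono)
    also have "ln (5 / 2 * A) = ln (5 / 2) + ln A" using A by (subst ln_mult_pos) simp_all
    finally have "ln (A + sqrt (b + A\<^sup>2)) \<le> 1 + ln A" using e by linarith
    then have "A * (ln (A + sqrt (b + A\<^sup>2)) - ln B + 1) \<le> A * (2 + (ln A - ln B))"
      using A by (intro mult_left_mono) simp_all
    moreover have "?F A - ?F 0 + A\<^sup>2 / A = A * (ln (A + sqrt (b + A\<^sup>2)) - ln B + 1)"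
      using A(1) by (simp add: B_def power2_eq_square algebra_simps)
    ultimately show "?F A - ?F 0 + A\<^sup>2 / A \<le> A * (2 + ln (a / b) / 2)" unfolding half by simp
  qed
  finally show ?thesis unfolding A(2)[symmetric] A_def[symmetric] .
qed

section \<open>Chebyshev residual polynomials\<close>

text \<open>
  The Chebyshev polynomials of the first kind.
\<close>

fun cheb :: "nat \<Rightarrow> real poly" where
  "cheb 0 = 1"
| "cheb (Suc 0) = [:0, 1:]"
| "cheb (Suc (Suc n)) = [:0, 2:] * cheb (Suc n) - cheb n"

lemma degree_cheb: "degree (cheb n) \<le> n"
proof (induction n rule: cheb.induct)
  case (3 n)
  have "degree ([:0, 2:] * cheb (Suc n)) \<le> Suc (Suc n)"
    using degree_mult_le[of "[:0, 2:]" "cheb (Suc n)"] 3(1) by simp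
  moreover have "degree (cheb n) \<le> Suc (Suc n)" using 3(2) by simp
  ultimately show ?case unfolding cheb.simps by (rule degree_diff_le)
qed simp_all

lemma poly_cheb_cos: "poly (cheb n) (cos \<theta>) = cos (real n * \<theta>)"
proof (induction n rule: cheb.induct)
  case (3 n)
  have "cos (real (Suc (Suc n)) * \<theta>) + cos (real n * \<theta>) = 2 * cos (real (Suc n) * \<theta>) * cos \<theta>"
  proof -
    have "cos (real (Suc n) * \<theta> + \<theta>) + cos (real (Suc n) * \<theta> - \<theta>) = 2 * cos (real (Suc n) * \<theta>) * cos \<theta>"
      by (simp add: cos_add cos_diff)
    moreover have "real (Suc n) * \<theta> + \<theta> = real (Suc (Suc n)) * \<theta>" "real (Suc n) * \<theta> - \<theta> = real n * \<theta>"
      by (simp_all add: algebra_simps)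
    ultimately show ?thesis by simp
  qed
  then show ?case using 3 by (simp add: mult_ac)
qed simp_all

lemma abs_poly_cheb_le_1:
  assumes "\<bar>x\<bar> \<le> 1" shows "\<bar>poly (cheb n) x\<bar> \<le> 1"
  using poly_cheb_cos[of n "arccos x"] assms by (simp add: cos_arccos_abs)

lemma poly_cheb_growth:
  assumes z: "z > 0" shows "poly (cheb n) ((z + 1 / z) / 2) = (z ^ n + (1 / z) ^ n) / 2"
proof (induction n rule: cheb.induct)
  case (3 n)
  have "z * (1 / z) = 1" using z by simp
  then have "(z + 1 / z) * (z ^ Suc n + (1 / z) ^ Suc n) - (z ^ n + (1 / z) ^ n) = z ^ Suc (Suc n) + (1 / z) ^ Suc (Suc n)"
    using z by (simp add: field_simps)
  then show ?case using 3 by (simp add: field_simps)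
qed simp_all

text \<open>
  With \<open>z = \<xi> + \<surd>(\<xi>\<^sup>2 - 1)\<close> one has \<open>\<xi> = (z + 1/z)/2\<close>, so the value is \<open>(z\<^sup>n + z\<^sup>-\<^sup>n)/2\<close>, and \<open>\<xi>\<^sup>2 - 1 \<ge> 2 (\<xi> - 1)\<close>.
\<close>

lemma poly_cheb_ge:
  assumes \<xi>: "\<xi> \<ge> 1" and w: "w \<le> 1 + sqrt (2 * (\<xi> - 1))" "w \<ge> 0"
  shows "w ^ n / 2 \<le> poly (cheb n) \<xi>"
proof -
  define q where "q = sqrt (\<xi>\<^sup>2 - 1)"
  have q2: "q\<^sup>2 = \<xi>\<^sup>2 - 1" using \<xi> by (simp add: q_def one_le_power)
  have q0: "q \<ge> 0" using \<xi> by (simp add: q_def one_le_power)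
  define z where "z = \<xi> + q"
  have z: "z > 0" using \<xi> q0 by (simp add: z_def)
  have "z * (\<xi> - q) = 1" using q2 by (simp add: z_def power2_eq_square algebra_simps)
  then have "1 / z = \<xi> - q" using z by (simp add: field_simps)
  then have \<xi>z: "(z + 1 / z) / 2 = \<xi>" by (simp add: z_def)
  have "sqrt (2 * (\<xi> - 1)) \<le> q"
  proof -
    have "2 * (\<xi> - 1) \<le> (\<xi> + 1) * (\<xi> - 1)" using \<xi> by (intro mult_right_mono) auto
    then show ?thesis unfolding q_def by (simp add: power2_eq_square algebra_simps)
  qed
  then have "w \<le> z" using w(1) \<xi> by (simp add: z_def)
  then have "w ^ n \<le> z ^ n" using w(2) by (intro power_mono)
  moreover have "0 \<le> (1 / z) ^ n" using z by simp
  ultimately have "w ^ n / 2 \<le> (z ^ n + (1 / z) ^ n) / 2" by simp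
  then show ?thesis using poly_cheb_growth[OF z, of n] unfolding \<xi>z by simp
qed

lemma exp_third_le: assumes "0 \<le> (y::real)" "y \<le> 1" shows "exp (y / 3) \<le> 1 + y"
proof -
  have "exp (y / 3) \<le> 1 + y / 3 + (y / 3)\<^sup>2" using assms by (intro exp_bound) auto
  also have "(y / 3)\<^sup>2 \<le> (y / 3) * 1" unfolding power2_eq_square using assms by (intro mult_left_mono) simp_all
  finally show ?thesis using assms by simp
qed

text \<open>
  The decreasing affine map that takes the interval from \<open>a\<close> to \<open>b\<close> onto \<open>[-1, 1]\<close> takes \<open>-\<mu>\<close> to \<open>\<xi> = (b + a + 2 \<mu>)/(b - a)\<close>.
  The factor 4 in \<open>b = 4 c\<close> cancels against the factor 4 in \<open>2 (\<xi> - 1) = 4 (a + \<mu>)/(b - a)\<close>, which is why enlarging the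
  interval from \<open>c\<close> to \<open>4 c\<close> leaves a rate in terms of \<open>c/a\<close>.
\<close>

lemma inverse_sqrt_cond_le:
  fixes a b c \<mu> :: real
  assumes a: "0 < a" and ac: "a \<le> c" and \<mu>: "0 \<le> \<mu>" and b: "b = 4 * c"
  shows "1 / sqrt (c / a) \<le> sqrt (2 * ((b + a + 2 * \<mu>) / (b - a) - 1))"
proof -
  have ab: "0 < b - a" using a ac b by simp
  have "(b + a + 2 * \<mu>) / (b - a) - 1 = ((b + a + 2 * \<mu>) - (b - a)) / (b - a)"
    using divide_self[of "b - a"] ab unfolding diff_divide_distrib[of "b + a + 2 * \<mu>"] by simp
  also have "(b + a + 2 * \<mu>) - (b - a) = 2 * (a + \<mu>)" by simp
  finally have \<xi>: "2 * ((b + a + 2 * \<mu>) / (b - a) - 1) = 4 * ((a + \<mu>) / (b - a))" by simp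
  have "a / b \<le> (a + \<mu>) / (b - a)" using a ab \<mu> by (intro frac_le) simp_all
  moreover have "4 * (a / b) = a / c" using b by simp
  ultimately have "a / c \<le> 2 * ((b + a + 2 * \<mu>) / (b - a) - 1)" unfolding \<xi> by linarith
  then have "sqrt (a / c) \<le> sqrt (2 * ((b + a + 2 * \<mu>) / (b - a) - 1))" by (rule real_sqrt_le_mono)
  moreover have "1 / sqrt (c / a) = sqrt (a / c)" by (simp add: real_sqrt_divide)
  ultimately show ?thesis by simp
qed

text \<open>
  The Chebyshev polynomial of the interval, divided by its value at \<open>-\<mu>\<close>.  The rate is that of the worst case \<open>\<mu> = 0\<close>.
\<close>

lemma chebyshev_residual_polynomial:
  fixes a c \<mu> :: real
  assumes a: "0 < a" and ac: "a \<le> c" and \<mu>: "0 \<le> \<mu>"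
  obtains \<rho> where "degree \<rho> \<le> n" "poly \<rho> (- \<mu>) = 1"
    "\<And>y. a \<le> y \<Longrightarrow> y \<le> 4 * c \<Longrightarrow> \<bar>poly \<rho> y\<bar> \<le> 2 * exp (- real n / (3 * sqrt (c / a)))"
proof -
  define b where "b = 4 * c"
  have ab: "0 < b - a" using a ac by (simp add: b_def)
  define \<xi> where "\<xi> = (b + a + 2 * \<mu>) / (b - a)"
  define y0 where "y0 = 1 / sqrt (c / a)"
  have "1 \<le> sqrt (c / a)" using a ac by (intro real_le_rsqrt) simp
  then have y0: "0 \<le> y0" "y0 \<le> 1" unfolding y0_def by simp_all
  have \<xi>1: "1 \<le> \<xi>" unfolding \<xi>_def using ab a \<mu> by (subst le_divide_eq_1_pos) simp_all
  have "y0 \<le> sqrt (2 * (\<xi> - 1))"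
    unfolding y0_def \<xi>_def by (rule inverse_sqrt_cond_le[OF a ac \<mu> b_def])
  then have "exp (y0 / 3) \<le> 1 + sqrt (2 * (\<xi> - 1))" using exp_third_le[OF y0] by linarith
  then have big: "exp (y0 / 3) ^ n / 2 \<le> poly (cheb n) \<xi>" by (rule poly_cheb_ge[OF \<xi>1 _ exp_ge_zero])
  have big0: "0 < poly (cheb n) \<xi>" by (rule less_le_trans[OF _ big]) simp
  define L where "L = [:(b + a) / (b - a), - 2 / (b - a):]"
  define \<rho> where "\<rho> = Polynomial.smult (1 / poly (cheb n) \<xi>) (pcompose (cheb n) L)"
  have L: "poly L y = (b + a - 2 * y) / (b - a)" for y
    by (simp add: L_def diff_divide_distrib)
  have \<rho>: "poly \<rho> y = poly (cheb n) ((b + a - 2 * y) / (b - a)) / poly (cheb n) \<xi>" for y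
    by (simp add: \<rho>_def poly_pcompose L)
  have degL: "degree L \<le> 1" by (simp add: L_def)
  show ?thesis
  proof (rule that[of \<rho>])
    have "degree \<rho> \<le> degree (pcompose (cheb n) L)" unfolding \<rho>_def by (rule degree_smult_le)
    also have "\<dots> \<le> degree (cheb n) * degree L" by (rule degree_pcompose_le)
    also have "\<dots> \<le> n * 1" by (rule mult_le_mono[OF degree_cheb degL])
    finally show "degree \<rho> \<le> n" by simp
    have "(b + a - 2 * (- \<mu>)) / (b - a) = \<xi>" by (simp add: \<xi>_def)
    then show "poly \<rho> (- \<mu>) = 1" unfolding \<rho> using big0 by simp
    fix y assume y: "a \<le> y" "y \<le> 4 * c"
    have "\<bar>b + a - 2 * y\<bar> \<le> b - a" using y unfolding b_def by linarith
    then have "\<bar>(b + a - 2 * y) / (b - a)\<bar> \<le> 1" using ab by (simp add: abs_divide)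
    from abs_poly_cheb_le_1[OF this, of n]
    have "\<bar>poly \<rho> y\<bar> \<le> 1 / poly (cheb n) \<xi>"
      unfolding \<rho> abs_divide abs_of_pos[OF big0] using big0 by (intro divide_right_mono) simp_all
    also have "\<dots> \<le> 1 / (exp (y0 / 3) ^ n / 2)"
      by (rule divide_left_mono[OF big]) (use big0 in simp_all)
    also have "exp (y0 / 3) ^ n = exp (real n * (y0 / 3))" by (rule exp_of_nat_mult[symmetric])
    also have "1 / (exp (real n * (y0 / 3)) / 2) = 2 * exp (- (real n * (y0 / 3)))"
      by (simp only: exp_minus divide_divide_eq_right mult_1 inverse_eq_divide times_divide_eq_right mult_1_right)
    also have "- (real n * (y0 / 3)) = - real n / (3 * sqrt (c / a))" by (simp add: y0_def)
    finally show "\<bar>poly \<rho> y\<bar> \<le> 2 * exp (- real n / (3 * sqrt (c / a)))" .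
  qed
qed

section \<open>The square root iterate\<close>

context eigenbasis
begin

lemma cg_residual_measurable:
  assumes \<beta>: "\<And>j i. j < m \<Longrightarrow> i \<in> {1..d} \<Longrightarrow> (\<lambda>p. co (col (Bf p) j) i) \<in> borel_measurable M"
    and Bf: "\<And>p. Bf p \<in> carrier_mat d m" and \<mu>: "\<mu> \<in> borel_measurable M"
    and i0: "i0 < m" and i: "i \<in> {1..d}"
  shows "(\<lambda>p. cg_residual (Bf p) t i0 (\<mu> p) i) \<in> borel_measurable M"
proof -
  have dimB: "dim_col (Bf p) = m" for p using Bf[of p] by simp
  let ?w = "\<lambda>jk p i. ev i ^ snd jk * co (col (Bf p) (fst jk)) i"
  have eq: "cg_residual (Bf p) t i0 (\<mu> p) i
     = residual {1..d} ((\<lambda>p i. ev i + \<mu> p) p) (map (\<lambda>jk. ?w jk p) (List.product [0..<m] [0..<t]))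
         ((\<lambda>p i. co (col (Bf p) i0) i / (ev i + \<mu> p)) p) i" for p
    unfolding cg_residual_def dimB by (simp only: split_def)
  show ?thesis
    unfolding eq
  proof (rule residual_measurable)
    show "(\<lambda>p. ev x + \<mu> p) \<in> borel_measurable M" for x using \<mu> by measurable
    show "(\<lambda>p. co (col (Bf p) i0) x / (ev x + \<mu> p)) \<in> borel_measurable M" if "x \<in> {1..d}" for x
      using \<mu> \<beta>[OF i0 that] by measurable
    show "(\<lambda>p. ?w k p x) \<in> borel_measurable M" if "k \<in> set (List.product [0..<m] [0..<t])" "x \<in> {1..d}" for k x
    proof -
      have "fst k < m" using that(1) by auto
      from \<beta>[OF this that(2)] show ?thesis by measurable
    qed
  qed (use i in auto)
qed

text \<open>
  The first term integrates to the exact square root, the second one is the error.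
\<close>

lemma index_A_bcg:
  assumes B: "B \<in> carrier_mat d m" and i0: "i0 < m" and p: "p < d"
  shows "(A *\<^sub>v bcg A B t i0 (z\<^sup>2)) $ p
    = (\<Sum>i\<in>{1..d}. (co (col B i0) i * (ev i / (ev i + z\<^sup>2)) - ev i * cg_residual B t i0 (z\<^sup>2) i) * v i $ p)"
proof -
  have z: "z\<^sup>2 \<ge> 0" by simp
  have c: "bcg A B t i0 (z\<^sup>2) \<in> carrier_vec d" by (rule bcg_carrier_and_residual(1)[OF B i0 z])
  have Ac: "A *\<^sub>v bcg A B t i0 (z\<^sup>2) \<in> carrier_vec d" using c by simp
  show ?thesis
    unfolding index_eq_co[OF Ac p]
  proof (intro sum.cong refl)
    fix i assume i: "i \<in> {1..d}"
    have "co (bcg A B t i0 (z\<^sup>2)) i = co (col B i0) i / (ev i + z\<^sup>2) - cg_residual B t i0 (z\<^sup>2) i"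
      using bcg_carrier_and_residual(2)[OF B i0 z i, of t] by linarith
    then show "co (A *\<^sub>v bcg A B t i0 (z\<^sup>2)) i * v i $ p
      = (co (col B i0) i * (ev i / (ev i + z\<^sup>2)) - ev i * cg_residual B t i0 (z\<^sup>2) i) * v i $ p"
      by (simp add: co_A[OF i c] right_diff_distrib)
  qed
qed

text \<open>
  The error is \<open>2/\<pi>\<close> times the integral of the vector with coordinates \<open>\<lambda>\<^sub>i r\<^sub>i(z)\<close>, where \<open>r(z)\<close> is the block-CG error at shift
  \<open>z\<^sup>2\<close>.  Since \<open>\<lambda>\<^sub>i\<^sup>2/(\<lambda>\<^sub>i + z\<^sup>2)\<close> increases with \<open>\<lambda>\<^sub>i\<close>, the norm of that vector is at most the square root of
  \<open>\<lambda>\<^sub>1\<^sup>2/(\<lambda>\<^sub>1 + z\<^sup>2)\<close> times the energy, which leads to the elliptic integrand.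
\<close>

lemma bsq_error_bound:
  assumes B: "B \<in> carrier_mat d m" and i0: "i0 < m" and d: "d \<ge> 1" and F: "F \<ge> 0"
    and energy: "\<And>z. z \<ge> 0 \<Longrightarrow> energy (z\<^sup>2) (cg_residual B t i0 (z\<^sup>2))
         \<le> F\<^sup>2 * (\<Sum>i\<in>{1..d}. (co (col B i0) i)\<^sup>2 / (ev i + z\<^sup>2))"
  shows "norm2 (mat_sqrt A *\<^sub>v col B i0 - bsq A B t i0)
    \<le> F * norm2 (col B i0) * (2 / pi * (sqrt (ev 1) * (2 + ln (ev 1 / ev d) / 2)))"
proof -
  define \<beta> where "\<beta> i = co (col B i0) i" for i
  define r where "r i z = cg_residual B t i0 (z\<^sup>2) i" for i z
  define nb where "nb = norm2 (col B i0)"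
  have colB: "col B i0 \<in> carrier_vec d" using B by auto
  have nb: "nb \<ge> 0" "nb\<^sup>2 = (\<Sum>i\<in>{1..d}. (\<beta> i)\<^sup>2)"
    by (simp_all add: nb_def norm2_co[OF colB] \<beta>_def sum_nonneg)
  have evd: "ev d > 0" "ev d \<le> ev 1" and ev1: "ev 1 > 0"
    using ev_pos[of d] ev_pos[of 1] ev_antimono[of 1 d] d by simp_all
  define g where "g z = F * nb * (ev 1 / sqrt ((ev 1 + z\<^sup>2) * (ev d + z\<^sup>2)))" for z
  define IG where "IG = sqrt (ev 1) * (2 + ln (ev 1 / ev d) / 2)"
  have g0: "g z \<ge> 0" for z
    unfolding g_def using F nb(1) ev1 evd by (intro mult_nonneg_nonneg divide_nonneg_nonneg) simp_all
  have r_meas: "r i \<in> borel_measurable borel" if i: "i \<in> {1..d}" for i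
    unfolding r_def by (rule cg_residual_measurable[OF _ B _ i0 i]) simp_all
  (* The pointwise bound of the error vector by the elliptic integrand. *)
  have sumsq: "(\<Sum>i\<in>{1..d}. (ev i * r i z)\<^sup>2) \<le> (g z)\<^sup>2" if z: "z \<ge> 0" for z
  proof -
    have pos: "ev i + z\<^sup>2 > 0" if "i \<in> {1..d}" for i using ev_pos[OF that] by (simp add: add_pos_nonneg)
    have p1: "ev 1 + z\<^sup>2 > 0" and pd: "ev d + z\<^sup>2 > 0" using ev1 evd by (simp_all add: add_pos_nonneg)
    have "(\<Sum>i\<in>{1..d}. (ev i * r i z)\<^sup>2) \<le> (\<Sum>i\<in>{1..d}. (ev 1)\<^sup>2 / (ev 1 + z\<^sup>2) * ((ev i + z\<^sup>2) * (r i z)\<^sup>2))"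
    proof (rule sum_mono)
      fix i assume i: "i \<in> {1..d}"
      have le: "ev i \<le> ev 1" "ev i > 0" using ev_antimono[of 1 i] ev_pos[OF i] i by auto
      have "(ev i)\<^sup>2 * (ev 1 + z\<^sup>2) \<le> (ev 1)\<^sup>2 * (ev i + z\<^sup>2)"
      proof -
        have "ev i * ev i * ev 1 \<le> ev 1 * ev 1 * ev i" using le ev1 by (simp add: mult_right_mono)
        moreover have "(ev i)\<^sup>2 * z\<^sup>2 \<le> (ev 1)\<^sup>2 * z\<^sup>2" using le by (intro mult_right_mono power_mono) simp_all
        ultimately show ?thesis by (simp add: power2_eq_square algebra_simps)
      qed
      then have "(ev i)\<^sup>2 \<le> (ev 1)\<^sup>2 / (ev 1 + z\<^sup>2) * (ev i + z\<^sup>2)"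
        using p1 by (simp add: pos_le_divide_eq)
      from mult_right_mono[OF this, of "(r i z)\<^sup>2"]
      show "(ev i * r i z)\<^sup>2 \<le> (ev 1)\<^sup>2 / (ev 1 + z\<^sup>2) * ((ev i + z\<^sup>2) * (r i z)\<^sup>2)"
        by (simp only: power_mult_distrib mult.assoc zero_le_power2 simp_thms)
    qed
    also have "\<dots> = (ev 1)\<^sup>2 / (ev 1 + z\<^sup>2) * energy (z\<^sup>2) (cg_residual B t i0 (z\<^sup>2))"
      unfolding energy_def r_def by (rule sum_distrib_left[symmetric])
    also have "\<dots> \<le> (ev 1)\<^sup>2 / (ev 1 + z\<^sup>2) * (F\<^sup>2 * (\<Sum>i\<in>{1..d}. (\<beta> i)\<^sup>2 / (ev i + z\<^sup>2)))"
      unfolding \<beta>_def using p1 by (intro mult_left_mono energy z) simp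
    also have "\<dots> \<le> (ev 1)\<^sup>2 / (ev 1 + z\<^sup>2) * (F\<^sup>2 * (nb\<^sup>2 / (ev d + z\<^sup>2)))"
    proof (intro mult_left_mono)
      have "(\<Sum>i\<in>{1..d}. (\<beta> i)\<^sup>2 / (ev i + z\<^sup>2)) \<le> (\<Sum>i\<in>{1..d}. (\<beta> i)\<^sup>2 / (ev d + z\<^sup>2))"
      proof (rule sum_mono)
        fix i assume i: "i \<in> {1..d}"
        have "ev d \<le> ev i" using ev_antimono[of i d] i by simp
        then show "(\<beta> i)\<^sup>2 / (ev i + z\<^sup>2) \<le> (\<beta> i)\<^sup>2 / (ev d + z\<^sup>2)"
          using pd pos[OF i] by (intro divide_left_mono) simp_all
      qed
      then show "(\<Sum>i\<in>{1..d}. (\<beta> i)\<^sup>2 / (ev i + z\<^sup>2)) \<le> nb\<^sup>2 / (ev d + z\<^sup>2)"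
        by (simp only: nb(2) sum_divide_distrib)
    qed (use p1 in simp_all)
    also have "\<dots> = (g z)\<^sup>2"
      unfolding g_def power_mult_distrib power_divide using p1 pd
      by (simp add: real_sqrt_pow2)
    finally show ?thesis .
  qed
  have g_nn: "(\<integral>\<^sup>+z. ennreal (g z) * indicator {0..} z \<partial>lborel) \<le> ennreal (F * nb * IG)"
  proof -
    have "(\<integral>\<^sup>+z. ennreal (g z) * indicator {0..} z \<partial>lborel)
      = (\<integral>\<^sup>+z. ennreal (F * nb) * (ennreal (ev 1 / sqrt ((ev 1 + z\<^sup>2) * (ev d + z\<^sup>2))) * indicator {0..} z) \<partial>lborel)"
      unfolding g_def ennreal_mult'[OF mult_nonneg_nonneg[OF F nb(1)]] by (simp only: mult.assoc)
    also have "\<dots> = ennreal (F * nb) * (\<integral>\<^sup>+z. ennreal (ev 1 / sqrt ((ev 1 + z\<^sup>2) * (ev d + z\<^sup>2))) * indicator {0..} z \<partial>lborel)"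
      by (rule nn_integral_cmult) measurable
    also have "\<dots> \<le> ennreal (F * nb) * ennreal IG"
      unfolding IG_def by (intro mult_left_mono elliptic_integral_bound evd) simp
    also have "\<dots> = ennreal (F * nb * IG)" using F nb(1) by (simp add: ennreal_mult')
    finally show ?thesis .
  qed
  have g_meas: "g \<in> borel_measurable borel" unfolding g_def by measurable
  have gI: "integrable lborel (\<lambda>z. indicator {0..} z * g z)"
  proof (rule integrableI_nonneg)
    have "(\<integral>\<^sup>+z. ennreal (indicator {0..} z * g z) \<partial>lborel) = (\<integral>\<^sup>+z. ennreal (g z) * indicator {0..} z \<partial>lborel)"
      by (intro nn_integral_cong) (simp add: indicator_def)
    then show "(\<integral>\<^sup>+z. ennreal (indicator {0..} z * g z) \<partial>lborel) < \<infinity>" using g_nn by (simp add: order.strict_trans1)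
    show "(\<lambda>z. indicator {0..} z * g z) \<in> borel_measurable lborel" using g_meas by measurable
  qed (use g0 in simp)
  have IG0: "IG \<ge> 0" unfolding IG_def using ev1 evd by (intro mult_nonneg_nonneg add_nonneg_nonneg) simp_all
  have g_int: "(\<integral>z. indicator {0..} z * g z \<partial>lborel) \<le> F * nb * IG"
  proof -
    have "ennreal (\<integral>z. indicator {0..} z * g z \<partial>lborel) = (\<integral>\<^sup>+z. ennreal (indicator {0..} z * g z) \<partial>lborel)"
      by (rule nn_integral_eq_integral[symmetric, OF gI]) (use g0 in simp)
    also have "\<dots> = (\<integral>\<^sup>+z. ennreal (g z) * indicator {0..} z \<partial>lborel)"
      by (intro nn_integral_cong) (simp add: indicator_def)
    finally have "ennreal (\<integral>z. indicator {0..} z * g z \<partial>lborel) \<le> ennreal (F * nb * IG)" using g_nn by simp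
    then show ?thesis using F nb(1) IG0 by (simp add: ennreal_le_iff)
  qed
  have rI: "integrable lborel (\<lambda>z. indicator {0..} z * (ev i * r i z))" if i: "i \<in> {1..d}" for i
  proof (rule Bochner_Integration.integrable_bound[OF gI])
    show "(\<lambda>z. indicator {0..} z * (ev i * r i z)) \<in> borel_measurable lborel" using r_meas[OF i] by measurable
    show "AE z in lborel. norm (indicator {0..} z * (ev i * r i z)) \<le> norm (indicator {0..} z * g z)"
    proof (rule AE_I2)
      fix z :: real
      show "norm (indicator {0..} z * (ev i * r i z)) \<le> norm (indicator {0..} z * g z)"
      proof (cases "z \<ge> 0")
        case True
        have "(ev i * r i z)\<^sup>2 \<le> (\<Sum>i\<in>{1..d}. (ev i * r i z)\<^sup>2)" using i by (intro member_le_sum) simp_all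
        also have "\<dots> \<le> (g z)\<^sup>2" by (rule sumsq[OF True])
        finally have "\<bar>ev i * r i z\<bar> \<le> \<bar>g z\<bar>" by (rule iffD2[OF abs_le_square_iff])
        then show ?thesis using True by simp
      qed simp
    qed
  qed
  define E where "E i = 2 / pi * (\<integral>z. indicator {0..} z * (ev i * r i z) \<partial>lborel)" for i
  have bsq_p: "bsq A B t i0 $ p = (\<Sum>i\<in>{1..d}. (sqrt (ev i) * \<beta> i - E i) * v i $ p)" if p: "p < d" for p
  proof -
    have main: "has_bochner_integral lborel (\<lambda>z. indicator {0..} z * (ev i / (ev i + z\<^sup>2))) (pi / 2 * sqrt (ev i))" if "i \<in> {1..d}" for i
      by (rule sqrt_integral_representation[OF ev_pos[OF that]])
    have "(LBINT z:{0..}. (A *\<^sub>v bcg A B t i0 (z\<^sup>2)) $ p)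
       = (\<integral>z. (\<Sum>i\<in>{1..d}. v i $ p * (\<beta> i * (indicator {0..} z * (ev i / (ev i + z\<^sup>2))) - indicator {0..} z * (ev i * r i z))) \<partial>lborel)"
      unfolding set_lebesgue_integral_def index_A_bcg[OF B i0 p]
      by (intro Bochner_Integration.integral_cong refl)
         (simp add: sum_distrib_left \<beta>_def r_def algebra_simps)
    also have "\<dots> = (\<Sum>i\<in>{1..d}. (\<integral>z. v i $ p * (\<beta> i * (indicator {0..} z * (ev i / (ev i + z\<^sup>2))) - indicator {0..} z * (ev i * r i z)) \<partial>lborel))"
      by (rule Bochner_Integration.integral_sum)
         (intro integrable_mult_right Bochner_Integration.integrable_diff rI integrable.intros[OF main])
    also have "\<dots> = (\<Sum>i\<in>{1..d}. v i $ p * (\<beta> i * (pi / 2 * sqrt (ev i)) - pi / 2 * E i))"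
    proof (intro sum.cong refl)
      fix i assume i: "i \<in> {1..d}"
      have "(\<integral>z. \<beta> i * (indicator {0..} z * (ev i / (ev i + z\<^sup>2))) - indicator {0..} z * (ev i * r i z) \<partial>lborel)
         = (\<integral>z. \<beta> i * (indicator {0..} z * (ev i / (ev i + z\<^sup>2))) \<partial>lborel) - (\<integral>z. indicator {0..} z * (ev i * r i z) \<partial>lborel)"
        by (intro Bochner_Integration.integral_diff integrable_mult_right rI[OF i] integrable.intros[OF main[OF i]])
      also have "(\<integral>z. \<beta> i * (indicator {0..} z * (ev i / (ev i + z\<^sup>2))) \<partial>lborel) = \<beta> i * (pi / 2 * sqrt (ev i))"
        by (simp only: integral_mult_right_zero has_bochner_integral_integral_eq[OF main[OF i]])
      also have "(\<integral>z. indicator {0..} z * (ev i * r i z) \<partial>lborel) = pi / 2 * E i" by (simp add: E_def)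
      finally show "(\<integral>z. v i $ p * (\<beta> i * (indicator {0..} z * (ev i / (ev i + z\<^sup>2))) - indicator {0..} z * (ev i * r i z)) \<partial>lborel)
        = v i $ p * (\<beta> i * (pi / 2 * sqrt (ev i)) - pi / 2 * E i)"
        by (simp only: integral_mult_right_zero)
    qed
    also have "\<dots> = pi / 2 * (\<Sum>i\<in>{1..d}. (sqrt (ev i) * \<beta> i - E i) * v i $ p)"
      unfolding sum_distrib_left by (intro sum.cong refl) (simp add: algebra_simps)
    finally have I: "(LBINT z:{0..}. (A *\<^sub>v bcg A B t i0 (z\<^sup>2)) $ p)
       = pi / 2 * (\<Sum>i\<in>{1..d}. (sqrt (ev i) * \<beta> i - E i) * v i $ p)" .
    have "bsq A B t i0 $ p = 2 / pi * (LBINT z:{0..}. (A *\<^sub>v bcg A B t i0 (z\<^sup>2)) $ p)"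
      unfolding bsq_def A_dim by (rule index_vec[OF p])
    then show ?thesis unfolding I by simp
  qed
  have bsq_c: "bsq A B t i0 \<in> carrier_vec d" by (simp add: bsq_def)
  have "bsq A B t i0 = of_co (\<lambda>i. sqrt (ev i) * \<beta> i - E i)"
    by (rule eq_vecI) (simp_all only: of_co_def dim_vec index_vec bsq_p carrier_vecD[OF bsq_c])
  then have cobsq: "co (bsq A B t i0) i = sqrt (ev i) * \<beta> i - E i" if "i \<in> {1..d}" for i
    using that by (simp only: co_of_co)
  define e where "e = mat_sqrt A *\<^sub>v col B i0 - bsq A B t i0"
  have Sb: "mat_sqrt A *\<^sub>v col B i0 \<in> carrier_vec d" using mat_sqrt_carrier colB by (rule mult_mat_vec_carrier)
  have ec: "e \<in> carrier_vec d" unfolding e_def using Sb bsq_c by simp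
  have coe: "co e i = E i" if "i \<in> {1..d}" for i
    unfolding e_def co_diff[OF that Sb bsq_c] cobsq[OF that] co_mat_sqrt[OF that colB] by (simp add: \<beta>_def)
  define N where "N = norm2 e"
  have N: "N \<ge> 0" "N\<^sup>2 = (\<Sum>i\<in>{1..d}. (E i)\<^sup>2)"
    unfolding N_def norm2_co[OF ec] by (simp_all add: sum_nonneg coe del: One_nat_def atLeastAtMost_iff)
  have N_int: "N\<^sup>2 = 2 / pi * (\<Sum>i\<in>{1..d}. E i * (\<integral>z. indicator {0..} z * (ev i * r i z) \<partial>lborel))"
    unfolding N(2) sum_distrib_left by (intro sum.cong refl) (simp add: E_def power2_eq_square)
  have "(\<Sum>i\<in>{1..d}. E i * (\<integral>z. indicator {0..} z * (ev i * r i z) \<partial>lborel))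
     = (\<integral>z. (\<Sum>i\<in>{1..d}. E i * (indicator {0..} z * (ev i * r i z))) \<partial>lborel)"
    by (subst Bochner_Integration.integral_sum) (intro integrable_mult_right rI, assumption, simp)
  also have "\<dots> \<le> (\<integral>z. N * (indicator {0..} z * g z) \<partial>lborel)"
  proof (rule integral_mono)
    show "integrable lborel (\<lambda>z. \<Sum>i\<in>{1..d}. E i * (indicator {0..} z * (ev i * r i z)))"
      by (intro Bochner_Integration.integrable_sum integrable_mult_right rI)
    show "integrable lborel (\<lambda>z. N * (indicator {0..} z * g z))" by (intro integrable_mult_right gI)
    fix z :: real
    show "(\<Sum>i\<in>{1..d}. E i * (indicator {0..} z * (ev i * r i z))) \<le> N * (indicator {0..} z * g z)"
    proof (cases "z \<ge> 0")
      case True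
      have "(\<Sum>i\<in>{1..d}. E i * (ev i * r i z))\<^sup>2 \<le> (\<Sum>i\<in>{1..d}. (E i)\<^sup>2) * (\<Sum>i\<in>{1..d}. (ev i * r i z)\<^sup>2)"
        by (rule Cauchy_Schwarz_ineq_sum)
      also have "\<dots> \<le> N\<^sup>2 * (g z)\<^sup>2" unfolding N(2)[symmetric] by (intro mult_left_mono sumsq True) simp
      also have "\<dots> = (N * g z)\<^sup>2" by (rule power_mult_distrib[symmetric])
      finally have "(\<Sum>i\<in>{1..d}. E i * (ev i * r i z)) \<le> N * g z"
        by (rule power2_le_imp_le) (use N(1) g0 in simp)
      then show ?thesis using True by simp
    qed simp
  qed
  also have "(\<integral>z. N * (indicator {0..} z * g z) \<partial>lborel) = N * (\<integral>z. indicator {0..} z * g z \<partial>lborel)"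
    by (rule integral_mult_right_zero)
  also have "\<dots> \<le> N * (F * nb * IG)" by (rule mult_left_mono[OF g_int N(1)])
  finally have "(\<Sum>i\<in>{1..d}. E i * (\<integral>z. indicator {0..} z * (ev i * r i z) \<partial>lborel)) \<le> N * (F * nb * IG)" .
  then have "N\<^sup>2 \<le> 2 / pi * (N * (F * nb * IG))" unfolding N_int by (rule mult_left_mono) simp
  then have NN: "N * N \<le> N * (2 / pi * (F * nb * IG))" by (simp only: power2_eq_square mult_ac)
  have "N \<le> 2 / pi * (F * nb * IG)"
  proof (cases "N = 0")
    case True
    then show ?thesis using F nb(1) IG0 by simp
  next
    case False
    then have "N > 0" using N(1) by simp
    with NN show ?thesis by (simp only: mult_le_cancel_left_pos)
  qed
  then show ?thesis unfolding N_def e_def nb_def IG_def by (simp only: mult_ac)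
qed

end

section \<open>Discarding ill-conditioned rows\<close>

text \<open>
  A quantitative form of uniqueness in polynomial interpolation.  Divide \<open>p\<close> by \<open>X - x\<^sub>0\<close> for one node \<open>x\<^sub>0\<close>: the quotient
  is of size \<open>2 \<eta>/\<Delta>\<close> at the other nodes, and multiplying back at most doubles the sum of the coefficients; altogether
  each degree costs a factor \<open>1/\<Delta> + 4/\<Delta> = 5/\<Delta>\<close>.  Only one factor for each of the \<open>q\<close> degrees appears, not one for each of
  the \<open>q + 1\<close> nodes.
\<close>

lemma sum_abs_coeff_le_of_small_values:
  fixes x :: "'i \<Rightarrow> real" and p :: "real poly"
  assumes "finite T" "card T = Suc q" "degree_below (Suc q) p"
    and "\<And>j. j \<in> T \<Longrightarrow> 0 \<le> x j \<and> x j \<le> 1"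
    and "\<And>i j. i \<in> T \<Longrightarrow> j \<in> T \<Longrightarrow> i \<noteq> j \<Longrightarrow> \<Delta> \<le> \<bar>x i - x j\<bar>"
    and "\<And>j. j \<in> T \<Longrightarrow> \<bar>poly p (x j)\<bar> \<le> \<eta>" and "0 < \<Delta>" "\<Delta> \<le> 1"
  shows "(\<Sum>a<Suc q. \<bar>coeff p a\<bar>) \<le> (5 / \<Delta>) ^ q * \<eta>"
  using assms
proof (induction q arbitrary: T p \<eta>)
  case 0
  then obtain j where j: "j \<in> T" by (metis card_eq_0_iff ex_in_conv nat.simps(3))
  have "poly p (x j) = coeff p 0"
    using poly_degree_below[OF 0(3), of "x j"] by simp
  then show ?case using 0(6)[OF j] by simp
next
  case (Suc q)
  then obtain j0 where j0: "j0 \<in> T" by (metis card_eq_0_iff ex_in_conv nat.simps(3))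
  define x0 where "x0 = x j0"
  have x0: "0 \<le> x0" "x0 \<le> 1" using Suc(5)[OF j0] by (simp_all add: x0_def)
  have "poly (p - [:poly p x0:]) x0 = 0" by simp
  then have "[:- x0, 1:] dvd p - [:poly p x0:]" by (simp only: poly_eq_0_iff_dvd)
  then obtain p1 where "p - [:poly p x0:] = [:- x0, 1:] * p1" by (elim dvdE)
  then have p: "p = [:poly p x0:] + [:- x0, 1:] * p1" by (simp add: algebra_simps)
  have deg: "degree_below (Suc q) p1"
  proof (cases "p1 = 0")
    case False
    have "degree_below (Suc (Suc q)) ([:- x0, 1:] * p1)"
    proof -
      have "[:- x0, 1:] * p1 = p - [:poly p x0:]" using p by (simp add: algebra_simps)
      moreover have "degree_below (Suc (Suc q)) [:poly p x0:]" by (simp add: degree_below_iff)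
      ultimately show ?thesis using Suc(4) degree_below_diff by simp
    qed
    moreover have "degree ([:- x0, 1:] * p1) = 1 + degree p1" using False by (subst degree_mult_eq) simp_all
    moreover have "[:- x0, 1:] * p1 \<noteq> 0" using False unfolding mult_eq_0_iff by simp
    ultimately show ?thesis by (simp only: degree_below_iff) simp
  qed (simp add: degree_below_def)
  have \<eta>: "\<eta> \<ge> 0" using Suc(7)[OF j0] by linarith
  have small: "\<bar>poly p1 (x j)\<bar> \<le> 2 * \<eta> / \<Delta>" if j: "j \<in> T - {j0}" for j
  proof -
    have sep: "\<Delta> \<le> \<bar>x j - x0\<bar>" using Suc(6)[of j j0] j j0 by (simp add: x0_def)
    have "(x j - x0) * poly p1 (x j) = poly p (x j) - poly p x0"
      using arg_cong[OF p, of "\<lambda>q. poly q (x j)"] by (simp add: algebra_simps)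
    then have "\<bar>x j - x0\<bar> * \<bar>poly p1 (x j)\<bar> = \<bar>poly p (x j) - poly p x0\<bar>" by (simp only: abs_mult[symmetric])
    also have "\<dots> \<le> 2 * \<eta>" using Suc(7)[of j] Suc(7)[OF j0] j by (simp add: x0_def)
    finally have "\<bar>x j - x0\<bar> * \<bar>poly p1 (x j)\<bar> \<le> 2 * \<eta>" .
    moreover have "\<Delta> * \<bar>poly p1 (x j)\<bar> \<le> \<bar>x j - x0\<bar> * \<bar>poly p1 (x j)\<bar>" by (intro mult_right_mono sep) simp
    ultimately have "\<Delta> * \<bar>poly p1 (x j)\<bar> \<le> 2 * \<eta>" by linarith
    then show ?thesis using \<open>0 < \<Delta>\<close> by (simp add: pos_le_divide_eq mult.commute)
  qed
  have IH: "(\<Sum>a<Suc q. \<bar>coeff p1 a\<bar>) \<le> (5 / \<Delta>) ^ q * (2 * \<eta> / \<Delta>)"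
    by (rule Suc.IH[of "T - {j0}"]) (use Suc.prems j0 deg small in simp_all)
  have last: "coeff p1 (Suc q) = 0" using deg by (simp add: degree_below_def)
  have coeffs: "\<bar>coeff p a\<bar> \<le> (if a = 0 then \<eta> else 0) + (if a = 0 then 0 else \<bar>coeff p1 (a - 1)\<bar>) + \<bar>coeff p1 a\<bar>" for a
  proof -
    have "coeff p a = (if a = 0 then poly p x0 else 0) + ((if a = 0 then 0 else coeff p1 (a - 1)) - x0 * coeff p1 a)"
      by (subst p) (cases a; simp add: coeff_pCons)
    moreover have "\<bar>x0 * coeff p1 a\<bar> \<le> 1 * \<bar>coeff p1 a\<bar>" unfolding abs_mult using x0 by (intro mult_right_mono) simp_all
    moreover have "\<bar>poly p x0\<bar> \<le> \<eta>" using Suc(7)[OF j0] by (simp add: x0_def)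
    ultimately show ?thesis by (cases "a = 0") auto
  qed
  have "(\<Sum>a<Suc (Suc q). \<bar>coeff p a\<bar>)
      \<le> (\<Sum>a<Suc (Suc q). (if a = 0 then \<eta> else 0) + (if a = 0 then 0 else \<bar>coeff p1 (a - 1)\<bar>) + \<bar>coeff p1 a\<bar>)"
    by (rule sum_mono) (rule coeffs)
  also have "\<dots> = \<eta> + (\<Sum>a<Suc q. \<bar>coeff p1 a\<bar>) + (\<Sum>a<Suc q. \<bar>coeff p1 a\<bar>)"
  proof -
    have "(\<Sum>a<Suc (Suc q). if a = 0 then 0 else \<bar>coeff p1 (a - 1)\<bar>) = (\<Sum>a<Suc q. \<bar>coeff p1 a\<bar>)"
      by (subst sum.lessThan_Suc_shift) simp
    moreover have "(\<Sum>a<Suc (Suc q). \<bar>coeff p1 a\<bar>) = (\<Sum>a<Suc q. \<bar>coeff p1 a\<bar>)"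
      by (subst sum.lessThan_Suc) (simp add: last)
    moreover have "(\<Sum>a<Suc (Suc q). if a = 0 then \<eta> else 0) = \<eta>"
      by (subst sum.lessThan_Suc_shift) simp
    ultimately show ?thesis unfolding sum.distrib by (simp only:)
  qed
  also have "\<dots> \<le> \<eta> + 2 * ((5 / \<Delta>) ^ q * (2 * \<eta> / \<Delta>))" using IH by simp
  also have "\<dots> \<le> (5 / \<Delta>) ^ q * (\<eta> / \<Delta>) + 2 * ((5 / \<Delta>) ^ q * (2 * \<eta> / \<Delta>))"
  proof -
    have "1 \<le> (5 / \<Delta>) ^ q" using \<open>0 < \<Delta>\<close> \<open>\<Delta> \<le> 1\<close> by (intro one_le_power) simp
    moreover have "\<eta> \<le> \<eta> / \<Delta>" using \<open>0 < \<Delta>\<close> \<open>\<Delta> \<le> 1\<close> \<eta> by (simp add: pos_le_divide_eq mult_left_le)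
    ultimately have "1 * \<eta> \<le> (5 / \<Delta>) ^ q * (\<eta> / \<Delta>)" using \<eta> by (intro mult_mono) simp_all
    then show ?thesis by (intro add_right_mono) (simp only: mult_1)
  qed
  also have "\<dots> = (5 / \<Delta>) ^ Suc q * \<eta>" by (simp add: field_simps)
  finally show ?case .
qed

text \<open>
  Vectors are indexed by pairs of a column index in \<open>L\<close> and an exponent below \<open>q\<close>.  In the application \<open>x i\<close> is a scaled
  eigenvalue and \<open>g i l\<close> the coordinate of column \<open>l\<close> along the eigenvector \<open>v i\<close>; row \<open>i\<close> then lists the \<open>i\<close>-th coordinates of
  a spanning family of the block Krylov space.
\<close>

locale block_rows =
  fixes L :: "nat set" and q :: nat and x :: "nat \<Rightarrow> real" and g :: "nat \<Rightarrow> nat \<Rightarrow> real"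
  assumes finite_L: "finite L"
begin

definition X :: "(nat \<times> nat) set" where "X = L \<times> {..<q}"

definition row :: "nat \<Rightarrow> nat \<times> nat \<Rightarrow> real" where
  "row i = (\<lambda>(l, a). g i l * x i ^ a)"

text \<open>
  The derivative of \<open>row j\<close> with respect to \<open>g j l\<close>.
\<close>

definition node :: "nat \<Rightarrow> nat \<Rightarrow> nat \<times> nat \<Rightarrow> real" where
  "node l j = (\<lambda>(l', a). if l' = l then x j ^ a else 0)"

definition resid :: "nat set \<Rightarrow> (nat \<times> nat \<Rightarrow> real) \<Rightarrow> nat \<times> nat \<Rightarrow> real" where
  "resid S f = residual X (\<lambda>_. 1) (map row (sorted_list_of_set S)) f"

text \<open>
  The squared distance of \<open>f\<close> from the span of the rows in \<open>S\<close>.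
\<close>

definition dsq :: "nat set \<Rightarrow> (nat \<times> nat \<Rightarrow> real) \<Rightarrow> real" where
  "dsq S f = ip X (\<lambda>_. 1) (resid S f) (resid S f)"

lemma finite_X [simp]: "finite X"
  by (simp add: X_def finite_L)

lemma card_X: "card X = card L * q"
  by (simp add: X_def card_cartesian_product)

lemma resid_orthogonal:
  assumes "finite S" "i \<in> S" shows "ip X (\<lambda>_. 1) (resid S f) (row i) = 0"
  unfolding resid_def by (rule residual_orthogonal) (use assms in simp_all)

lemma resid_span: "\<exists>y. \<forall>z. resid S f z = f z - (\<Sum>k<length (sorted_list_of_set S). y k * row (sorted_list_of_set S ! k) z)"
proof -
  obtain y where y: "\<And>z. resid S f z = f z - (\<Sum>k<length (map row (sorted_list_of_set S)). y k * (map row (sorted_list_of_set S) ! k) z)"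
    unfolding resid_def using residual_in_span[of X "\<lambda>_. 1" "map row (sorted_list_of_set S)" f] by (elim exE) simp
  show ?thesis
    by (rule exI[of _ y]) (simp add: y)
qed

lemma ip_resid_right:
  assumes S: "finite S" and N: "\<And>i. i \<in> S \<Longrightarrow> ip X (\<lambda>_. 1) N (row i) = 0"
  shows "ip X (\<lambda>_. 1) N (resid S f) = ip X (\<lambda>_. 1) N f"
proof -
  obtain y where y: "\<And>z. resid S f z = f z - (\<Sum>k<length (sorted_list_of_set S). y k * row (sorted_list_of_set S ! k) z)"
    using resid_span[of S f] by (elim exE) simp
  have "ip X (\<lambda>_. 1) N (row (sorted_list_of_set S ! k)) = 0" if "k < length (sorted_list_of_set S)" for k
    using N nth_mem[OF that] S by simp
  then show ?thesis
    unfolding y ip_diff_right ip_sum_right ip_scale_right by simp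
qed

lemma dsq_antimono:
  assumes "S \<subseteq> S'" "finite S'" shows "dsq S' f \<le> dsq S f"
proof -
  have S: "finite S" using assms by (rule finite_subset)
  obtain y where y: "\<And>z. resid S f z = f z - (\<Sum>k<length (map row (sorted_list_of_set S)). y k * (map row (sorted_list_of_set S) ! k) z)"
    unfolding resid_def using residual_in_span[of X "\<lambda>_. 1" "map row (sorted_list_of_set S)" f] by (elim exE) simp
  show ?thesis
    unfolding dsq_def resid_def[of S']
    by (rule residual_minimal_le[OF finite_X _ y]) (use assms S in auto)
qed

text \<open>
  Fewer rows than coordinates; see \<open>sum_residual_basis\<close>.
\<close>

lemma exists_orthogonal_unit:
  assumes S: "finite S" "card S < card L * q"
  obtains N where "\<And>i. i \<in> S \<Longrightarrow> ip X (\<lambda>_. 1) N (row i) = 0" "ip X (\<lambda>_. 1) N N > 0"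
proof -
  have "(\<Sum>z\<in>X. dsq S (indicator {z})) \<ge> real (card X) - real (card S)"
    unfolding dsq_def resid_def
    using sum_residual_basis[OF finite_X, of "map row (sorted_list_of_set S)"] S(1) by simp
  moreover have "real (card X) - real (card S) > 0" using S(2) by (simp add: card_X del: of_nat_mult)
  ultimately have "\<not> (\<forall>z\<in>X. dsq S (indicator {z}) \<le> 0)"
    using sum_nonpos[of X "\<lambda>z. dsq S (indicator {z})"] by auto
  then obtain z where "dsq S (indicator {z}) > 0" by (auto simp: not_le)
  then show ?thesis
    using that[of "resid S (indicator {z})"] resid_orthogonal[OF S(1)] by (simp add: dsq_def)
qed

lemma ip_node:
  assumes "l \<in> L"
  shows "ip X (\<lambda>_. 1) N (node l j) = (\<Sum>a<q. N (l, a) * x j ^ a)"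
proof -
  have "ip X (\<lambda>_. 1) N (node l j) = (\<Sum>l'\<in>L. \<Sum>a<q. N (l', a) * (if l' = l then x j ^ a else 0))"
    by (simp add: ip_def X_def node_def sum.cartesian_product split_def)
  also have "\<dots> = (\<Sum>l'\<in>L. if l' = l then (\<Sum>a<q. N (l, a) * x j ^ a) else 0)"
    by (intro sum.cong refl) simp
  finally show ?thesis using assms finite_L by simp
qed

text \<open>
  Take \<open>N \<noteq> 0\<close> orthogonal to the rows in \<open>S\<close>.  Its inner product with \<open>node l j\<close> is the value at \<open>x j\<close> of the
  polynomial with coefficients \<open>N (l, _)\<close>, and it is small since the node is close to the span of these rows.  By
  interpolation at the \<open>q\<close> points all coefficients are small, so \<open>N\<close> would be shorter than itself.
\<close>

lemma not_all_nodes_small: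
  assumes S: "finite S" "card S < card L * q" and q: "q \<ge> 1"
    and T: "finite T" "card T = q"
    and x01: "\<And>j. j \<in> T \<Longrightarrow> 0 \<le> x j \<and> x j \<le> 1"
    and sep: "\<And>i j. i \<in> T \<Longrightarrow> j \<in> T \<Longrightarrow> i \<noteq> j \<Longrightarrow> \<Delta> \<le> \<bar>x i - x j\<bar>"
    and \<Delta>: "0 < \<Delta>" "\<Delta> \<le> 1"
    and small: "\<And>j l. j \<in> T \<Longrightarrow> l \<in> L \<Longrightarrow> dsq S (node l j) \<le> ((\<Delta> / 5) ^ (q - 1) / (2 * card L))\<^sup>2"
  shows False
proof -
  let ?ip = "ip X (\<lambda>_. 1)"
  define k where "k = real (card L)"
  have "card L > 0" using S(2) by (cases "card L") auto
  then have k: "k \<ge> 1" by (simp add: k_def)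
  define \<eta> where "\<eta> = (\<Delta> / 5) ^ (q - 1) / (2 * k)"
  have \<eta>: "\<eta> \<ge> 0" using \<Delta> k by (simp add: \<eta>_def)
  obtain N where N: "\<And>i. i \<in> S \<Longrightarrow> ?ip N (row i) = 0" and Npos: "?ip N N > 0"
    using exists_orthogonal_unit[OF S] by blast
  define n where "n = sqrt (?ip N N)"
  have n: "n > 0" "n\<^sup>2 = ?ip N N" using Npos by (simp_all add: n_def)
  define P where "P l = (\<Sum>a<q. monom (N (l, a)) a)" for l
  have val: "\<bar>poly (P l) (x j)\<bar> \<le> \<eta> * n" if j: "j \<in> T" and l: "l \<in> L" for j l
  proof -
    have "?ip N (resid S (node l j)) = ?ip N (node l j)" by (rule ip_resid_right[OF S(1)]) (rule N)
    then have "poly (P l) (x j) = ?ip N (resid S (node l j))"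
      unfolding ip_node[OF l] by (simp add: P_def poly_sum poly_monom)
    then have "(poly (P l) (x j))\<^sup>2 = (\<Sum>z\<in>X. N z * resid S (node l j) z)\<^sup>2" by (simp add: ip_def)
    also have "\<dots> \<le> (\<Sum>z\<in>X. (N z)\<^sup>2) * (\<Sum>z\<in>X. (resid S (node l j) z)\<^sup>2)" by (rule Cauchy_Schwarz_ineq_sum)
    also have "\<dots> = n\<^sup>2 * dsq S (node l j)" unfolding n(2) by (simp add: ip_def dsq_def power2_eq_square)
    also have "\<dots> \<le> n\<^sup>2 * \<eta>\<^sup>2" using small[OF j l] by (intro mult_left_mono) (simp_all add: \<eta>_def k_def)
    also have "\<dots> = (\<eta> * n)\<^sup>2" by (simp add: power_mult_distrib)
    finally have "\<bar>poly (P l) (x j)\<bar> \<le> \<bar>\<eta> * n\<bar>" by (rule iffD2[OF abs_le_square_iff])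
    then show ?thesis using \<eta> n(1) by simp
  qed
  have coeffs: "(\<Sum>a<q. (N (l, a))\<^sup>2) \<le> (n / (2 * k))\<^sup>2" if l: "l \<in> L" for l
  proof -
    obtain q' where q': "q = Suc q'" using q by (cases q) auto
    have cN: "coeff (P l) a = N (l, a)" if "a < q" for a
      using that by (simp add: P_def coeff_sum coeff_monom)
    have "(\<Sum>a<Suc q'. \<bar>coeff (P l) a\<bar>) \<le> (5 / \<Delta>) ^ q' * (\<eta> * n)"
    proof (rule sum_abs_coeff_le_of_small_values[where x = x and \<Delta> = \<Delta>, OF T(1)])
      show "degree_below (Suc q') (P l)" unfolding P_def q'[symmetric] by (rule degree_below_sum_monom)
    qed (use T(2) q' x01 sep val[OF _ l] \<Delta> in auto)
    also have "\<dots> = n / (2 * k)"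
    proof -
      have "(5 / \<Delta>) ^ q' * (\<Delta> / 5) ^ q' = 1" using \<Delta> by (simp add: power_mult_distrib[symmetric])
      moreover have "\<eta> = (\<Delta> / 5) ^ q' / (2 * k)" by (simp add: \<eta>_def q')
      ultimately show ?thesis by (simp add: mult.assoc[symmetric])
    qed
    finally have l1: "(\<Sum>a<q. \<bar>N (l, a)\<bar>) \<le> n / (2 * k)" using cN q' by simp
    have "(\<Sum>a<q. (N (l, a))\<^sup>2) \<le> (\<Sum>a<q. \<bar>N (l, a)\<bar> * (\<Sum>a<q. \<bar>N (l, a)\<bar>))"
    proof (rule sum_mono)
      fix a assume a: "a \<in> {..<q}"
      have "\<bar>N (l, a)\<bar> \<le> (\<Sum>a<q. \<bar>N (l, a)\<bar>)" using a by (intro member_le_sum) simp_all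
      then have "\<bar>N (l, a)\<bar> * \<bar>N (l, a)\<bar> \<le> \<bar>N (l, a)\<bar> * (\<Sum>a<q. \<bar>N (l, a)\<bar>)" by (intro mult_left_mono) simp_all
      then show "(N (l, a))\<^sup>2 \<le> \<bar>N (l, a)\<bar> * (\<Sum>a<q. \<bar>N (l, a)\<bar>)" by (simp add: power2_eq_square abs_mult[symmetric])
    qed
    also have "\<dots> = (\<Sum>a<q. \<bar>N (l, a)\<bar>)\<^sup>2" by (simp add: sum_distrib_right power2_eq_square)
    also have "\<dots> \<le> (n / (2 * k))\<^sup>2" by (rule power_mono[OF l1]) (simp add: sum_nonneg)
    finally show ?thesis .
  qed
  have "n\<^sup>2 = (\<Sum>l\<in>L. \<Sum>a<q. (N (l, a))\<^sup>2)"
    unfolding n(2) by (simp add: ip_def X_def sum.cartesian_product split_def power2_eq_square)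
  also have "\<dots> \<le> (\<Sum>l\<in>L. (n / (2 * k))\<^sup>2)" by (rule sum_mono) (rule coeffs)
  also have "\<dots> = k * (n\<^sup>2 / (4 * k\<^sup>2))" by (simp add: k_def power_divide power_mult_distrib)
  also have "\<dots> = n\<^sup>2 / (4 * k)" using k by (simp add: power2_eq_square)
  also have "\<dots> \<le> n\<^sup>2 / 4" using k by (intro divide_left_mono) simp_all
  finally show False using n(1) by simp
qed

text \<open>
  Remove indices one at a time, each time one whose row is within \<open>\<surd>\<eta>\<close> of the span of the rest.  If this does
  not stop before \<open>q\<close> removals, all \<open>q\<close> removed indices have nodes close to the span of the rows other than the first
  removed one, because distances only decrease when rows are added.  This contradicts \<open>not_all_nodes_small\<close>.
\<close>

theorem exists_well_conditioned_rows:
  assumes K: "finite K" "card K \<le> card L * q" and q: "q \<ge> 1"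
    and x01: "\<And>j. j \<in> K \<Longrightarrow> 0 \<le> x j \<and> x j \<le> 1"
    and sep: "\<And>i j. i \<in> K \<Longrightarrow> j \<in> K \<Longrightarrow> i \<noteq> j \<Longrightarrow> \<Delta> \<le> \<bar>x i - x j\<bar>"
    and \<Delta>: "0 < \<Delta>" "\<Delta> \<le> 1"
    and good: "\<And>T j l. T \<subseteq> K \<Longrightarrow> card T \<le> q \<Longrightarrow> j \<in> T \<Longrightarrow> l \<in> L \<Longrightarrow> dsq (K - T) (row j) < \<eta> \<Longrightarrow>
        dsq (K - T) (node l j) < ((\<Delta> / 5) ^ (q - 1) / (2 * card L))\<^sup>2"
  shows "\<exists>J1\<subseteq>K. card J1 < q \<and> (\<forall>j\<in>K - J1. \<eta> \<le> dsq (K - J1 - {j}) (row j))"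
proof (rule ccontr)
  assume neg: "\<not> ?thesis"
  define \<theta> where "\<theta> = ((\<Delta> / 5) ^ (q - 1) / (2 * card L))\<^sup>2"
  (* As T is not a valid choice of J1, another index can be removed, and its nodes are then close as well. *)
  have next_row: "\<exists>j\<in>K - T. \<forall>l\<in>L. dsq (K - insert j T) (node l j) < \<theta>" if T: "T \<subseteq> K" "card T < q" for T
  proof -
    have "\<not> (\<forall>j\<in>K - T. \<eta> \<le> dsq (K - T - {j}) (row j))" using neg T by blast
    then obtain j where j: "j \<in> K - T" "dsq (K - T - {j}) (row j) < \<eta>" by (auto simp: not_le)
    have eq: "K - insert j T = K - T - {j}" by auto
    have card: "card (insert j T) \<le> q" using card_insert_le_m1[of q T j] T(2) by simp
    have "dsq (K - insert j T) (node l j) < \<theta>" if "l \<in> L" for l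
      unfolding \<theta>_def by (rule good[OF _ card]) (use j T that eq in auto)
    then show ?thesis using j(1) by blast
  qed
  (* j1 is the index removed first; all distances are measured against the rows other than j1. *)
  have chain: "\<exists>T j1. T \<subseteq> K \<and> card T = n \<and> j1 \<in> T \<and> (\<forall>j\<in>T. \<forall>l\<in>L. dsq (K - {j1}) (node l j) < \<theta>)"
    if "1 \<le> n" "n \<le> q" for n
    using that
  proof (induction n rule: dec_induct)
    case base
    obtain j where "j \<in> K" "\<forall>l\<in>L. dsq (K - {j}) (node l j) < \<theta>" using next_row[of "{}"] q by auto
    then show ?case by (intro exI[of _ "{j}"] exI[of _ j]) simp
  next
    case (step n)
    obtain T j1 where T: "T \<subseteq> K" "card T = n" "j1 \<in> T" "\<forall>j\<in>T. \<forall>l\<in>L. dsq (K - {j1}) (node l j) < \<theta>"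
      using step by auto
    obtain j where j: "j \<in> K - T" "\<forall>l\<in>L. dsq (K - insert j T) (node l j) < \<theta>"
      using next_row[OF T(1)] T(2) step by auto
    have "dsq (K - {j1}) (node l j) < \<theta>" if "l \<in> L" for l
    proof -
      have "dsq (K - {j1}) (node l j) \<le> dsq (K - insert j T) (node l j)"
        by (rule dsq_antimono) (use T K in auto)
      also have "\<dots> < \<theta>" using j that by simp
      finally show ?thesis .
    qed
    moreover have "card (insert j T) = Suc n" using T j finite_subset[OF T(1) K(1)] by simp
    ultimately show ?case using T j by (intro exI[of _ "insert j T"] exI[of _ j1]) auto
  qed
  obtain T j1 where T: "T \<subseteq> K" "card T = q" "j1 \<in> T" "\<forall>j\<in>T. \<forall>l\<in>L. dsq (K - {j1}) (node l j) < \<theta>"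
    using chain[OF q] by auto
  show False
  proof (rule not_all_nodes_small[OF _ _ q _ T(2) _ _ \<Delta>])
    show "finite (K - {j1})" "finite T" using K T(1) finite_subset by auto
    have "j1 \<in> K" using T by auto
    then have "card (K - {j1}) < card K" using K(1) by (intro psubset_card_mono) auto
    then show "card (K - {j1}) < card L * q" using K(2) by simp
    show "dsq (K - {j1}) (node l j) \<le> ((\<Delta> / 5) ^ (q - 1) / (2 * card L))\<^sup>2" if "j \<in> T" "l \<in> L" for j l
      using T(4) that by (auto simp: \<theta>_def less_imp_le)
    show "0 \<le> x j \<and> x j \<le> 1" if "j \<in> T" for j using x01[of j] that T(1) by blast
    show "\<Delta> \<le> \<bar>x i - x j\<bar>" if "i \<in> T" "j \<in> T" "i \<noteq> j" for i j
      using sep[of i j] that T(1) by blast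
  qed
qed

end

section \<open>Approximate eigenvectors in the Krylov space\<close>

context eigenbasis
begin

abbreviation top_set :: "nat \<Rightarrow> nat set" where
  "top_set r \<equiv> {j \<in> {1..r}. 4 * ev (r + 1) < ev j}"

abbreviation gram_rows :: "real mat \<Rightarrow> nat \<Rightarrow> nat \<Rightarrow> real" where
  "gram_rows B i l \<equiv> co (col B l) i"

abbreviation rel_ev :: "nat \<Rightarrow> real" where
  "rel_ev i \<equiv> ev i / ev 1"

text \<open>
  Fix a top index \<open>j\<close> outside \<open>J1\<close>.  The normalised residual of row \<open>j\<close> is a combination \<open>w\<close> of the vectors \<open>A\<^sup>a b\<^sub>l\<close>, \<open>a < q\<close>,
  with coordinate 1 at \<open>j\<close> and 0 at the other top indices outside \<open>J1\<close>.  Fewer than \<open>q\<close> further linear factors make the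
  coordinates in \<open>J1\<close> vanish at a cost of \<open>1/\<Delta>\<close> each, and the factor \<open>(A/\<lambda>\<^sub>j)\<^sup>s\<^sup>'\<close> reduces the coordinates beyond \<open>r\<close>, where
  \<open>\<lambda>\<^sub>i/\<lambda>\<^sub>j < 1/4\<close>.  Only indices with \<open>\<lambda>\<^sub>j > 4 \<lambda>\<^sub>r\<^sub>+\<^sub>1\<close> need this; the others stay in the range of the Chebyshev polynomial.
\<close>

lemma approximate_top_eigenvectors:
  fixes B :: "real mat" and L :: "nat set"
  assumes B: "B \<in> carrier_mat d m" and L: "L \<subseteq> {..<m}"
    and r: "r + 1 \<le> d" and q: "q \<ge> 1"
    and \<Delta>: "0 < \<Delta>"
    and sep: "\<And>i j. i \<in> {1..r} \<Longrightarrow> j \<in> {1..r} \<Longrightarrow> i \<noteq> j \<Longrightarrow> \<Delta> * ev 1 \<le> \<bar>ev i - ev j\<bar>"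
    and J1: "J1 \<subseteq> {1..r}" "card J1 < q" and \<Delta>1: "\<Delta> \<le> 1"
    and \<eta>: "0 < \<eta>"
    and good: "\<And>j. j \<in> {1..r} - J1 \<Longrightarrow>
      \<eta> \<le> block_rows.dsq L q rel_ev (gram_rows B) ({1..r} - J1 - {j}) (block_rows.row rel_ev (gram_rows B) j)"
    and T: "(\<Sum>l<m. (norm2 (col B l))\<^sup>2) \<le> T"
    and \<epsilon>: "(1 / 4) ^ s' * (1 / \<Delta>) ^ (q - 1) * sqrt (q * T / \<eta>) \<le> \<epsilon>"
  shows "\<exists>U. (\<forall>j\<in>top_set r - J1. \<forall>l<m. degree_below (2 * q + s') (U j l)) \<and>
    (\<forall>j\<in>top_set r - J1. \<forall>i\<in>top_set r - J1. (\<Sum>l<m. poly (U j l) (ev i) * co (col B l) i) = (if i = j then 1 else 0)) \<and>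
    (\<forall>j\<in>top_set r - J1. \<forall>i\<in>{1..d} - top_set r. \<bar>\<Sum>l<m. poly (U j l) (ev i) * co (col B l) i\<bar> \<le> \<epsilon>)"
proof -
  note One_nat_def [simp del]
  have finL: "finite L" using L finite_subset by blast
  interpret R: block_rows L q rel_ev "gram_rows B" by standard (rule finL)
  let ?ip = "ip R.X (\<lambda>_. 1)"
  have d1: "d \<ge> 1" using r by simp
  have ev1: "ev 1 > 0" using ev_pos[of 1] d1 by simp
  have finJ1: "finite J1" using J1(1) finite_subset by blast
  define N where "N j = (let R = R.resid ({1..r} - J1 - {j}) (R.row j) in (\<lambda>z. R z / ?ip R R))" for j
  define W where "W j i = (\<Sum>l\<in>L. \<Sum>a<q. N j (l, a) * rel_ev i ^ a * co (col B l) i)" for j i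
  have W_ip: "W j i = ?ip (N j) (R.row i)" for j i
    by (simp add: W_def ip_def R.X_def R.row_def sum.cartesian_product split_def mult_ac)
  have N_props: "W j i = (if i = j then 1 else 0)" "?ip (N j) (N j) \<le> 1 / \<eta>"
    if j: "j \<in> {1..r} - J1" and i: "i \<in> {1..r} - J1" for i j
  proof -
    define S where "S = {1..r} - J1 - {j}"
    define R where "R = R.resid S (R.row j)"
    have S: "finite S" by (simp add: S_def)
    have dsq: "?ip R R = R.dsq S (R.row j)" by (simp add: R_def R.dsq_def)
    have ge: "\<eta> \<le> ?ip R R" using good[OF j] unfolding dsq S_def .
    have pos: "?ip R R > 0" using ge \<eta> by simp
    have Nj: "N j = (\<lambda>z. (1 / ?ip R R) * R z)" by (simp add: N_def R_def S_def Let_def)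
    have self: "?ip R (R.row j) = ?ip R R"
      using R.ip_resid_right[OF S, of R "R.row j"] R.resid_orthogonal[OF S] by (simp add: R_def)
    have other: "?ip R (R.row i) = 0" if "i \<noteq> j"
      unfolding R_def by (rule R.resid_orthogonal[OF S]) (use i that in \<open>simp add: S_def\<close>)
    show "W j i = (if i = j then 1 else 0)"
      unfolding W_ip Nj ip_scale_left using self other pos by simp
    have "?ip (N j) (N j) = 1 / ?ip R R"
      unfolding Nj ip_scale_left ip_scale_right using pos by simp
    also have "\<dots> \<le> 1 / \<eta>" using ge \<eta> by (intro divide_left_mono) (simp_all add: pos)
    finally show "?ip (N j) (N j) \<le> 1 / \<eta>" .
  qed
  have rel01: "0 \<le> rel_ev i \<and> rel_ev i \<le> 1" if "i \<in> {1..d}" for i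
    using ev_pos[OF that] ev_antimono[of 1 i] that ev1 by (simp add: pos_divide_le_eq)
  have T0: "0 \<le> T" by (rule order_trans[OF _ T]) (simp add: sum_nonneg)
  have W_bound: "\<bar>W j i\<bar> \<le> sqrt (q * T / \<eta>)" if j: "j \<in> {1..r} - J1" and i: "i \<in> {1..d}" for i j
  proof -
    have col: "col B l \<in> carrier_vec d" for l using B by auto
    have "(W j i)\<^sup>2 = (\<Sum>z\<in>R.X. N j z * R.row i z)\<^sup>2" unfolding W_ip ip_def by simp
    also have "\<dots> \<le> (\<Sum>z\<in>R.X. (N j z)\<^sup>2) * (\<Sum>z\<in>R.X. (R.row i z)\<^sup>2)" by (rule Cauchy_Schwarz_ineq_sum)
    also have "\<dots> \<le> 1 / \<eta> * (q * T)"
    proof (rule mult_mono)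
      show "(\<Sum>z\<in>R.X. (N j z)\<^sup>2) \<le> 1 / \<eta>" using N_props(2)[OF j j] by (simp add: ip_def power2_eq_square)
      have "(\<Sum>z\<in>R.X. (R.row i z)\<^sup>2) = (\<Sum>l\<in>L. \<Sum>a<q. (co (col B l) i * rel_ev i ^ a)\<^sup>2)"
        by (simp add: R.X_def R.row_def sum.cartesian_product split_def)
      also have "\<dots> \<le> (\<Sum>l\<in>L. \<Sum>a<q. (norm2 (col B l))\<^sup>2)"
      proof (intro sum_mono)
        fix l a
        have "(co (col B l) i * rel_ev i ^ a)\<^sup>2 = (co (col B l) i)\<^sup>2 * (rel_ev i ^ a)\<^sup>2" by (rule power_mult_distrib)
        also have "\<dots> \<le> (co (col B l) i)\<^sup>2 * 1"
          using rel01[OF i] by (intro mult_left_mono power_le_one) (simp_all add: power_le_one)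
        also have "\<dots> \<le> (\<Sum>i\<in>{1..d}. (co (col B l) i)\<^sup>2)"
          unfolding mult_1_right using i by (intro member_le_sum) simp_all
        also have "\<dots> = (norm2 (col B l))\<^sup>2" unfolding norm2_co[OF col] by (simp add: sum_nonneg)
        finally show "(co (col B l) i * rel_ev i ^ a)\<^sup>2 \<le> (norm2 (col B l))\<^sup>2" .
      qed
      also have "\<dots> = q * (\<Sum>l\<in>L. (norm2 (col B l))\<^sup>2)" by (simp add: sum_distrib_left)
      also have "\<dots> \<le> q * T"
        by (intro mult_left_mono order_trans[OF sum_mono2 T] L) simp_all
      finally show "(\<Sum>z\<in>R.X. (R.row i z)\<^sup>2) \<le> q * T" .
    qed (use \<eta> in \<open>simp_all add: sum_nonneg\<close>)
    finally have "(W j i)\<^sup>2 \<le> q * T / \<eta>" by simp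
    then have "sqrt ((W j i)\<^sup>2) \<le> sqrt (q * T / \<eta>)" by (rule real_sqrt_le_mono)
    then show ?thesis by simp
  qed
  (* kill j vanishes on J1 and is 1 at j; base j realises the residual as polynomials in A. *)
  define kill where "kill j = (\<Prod>i\<in>J1. Polynomial.smult (1 / (ev j - ev i)) [:- ev i, 1:])" for j
  define base where "base j l = (\<Sum>a<q. monom (N j (l, a) / ev 1 ^ a) a)" for j l
  define U where "U j l = (if l \<in> L then kill j * (monom (1 / ev j ^ s') s' * base j l) else 0)" for j l
  have deg: "degree_below (2 * q + s') (U j l)" for j l
  proof (cases "l \<in> L")
    case True
    have 1: "degree_below q (base j l)" unfolding base_def by (rule degree_below_sum_monom)
    have 2: "degree_below (s' + q) (monom (1 / ev j ^ s') s' * base j l)"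
      by (rule degree_below_mult[OF degree_monom_le 1])
    have "degree (kill j) \<le> (\<Sum>i\<in>J1. degree (Polynomial.smult (1 / (ev j - ev i)) [:- ev i, 1:]))"
      unfolding kill_def using degree_prod_sum_le[OF finJ1, of "\<lambda>i. Polynomial.smult (1 / (ev j - ev i)) [:- ev i, 1:]"]
      by (simp only: comp_def)
    also have "\<dots> \<le> (\<Sum>i\<in>J1. 1)" by (intro sum_mono order_trans[OF degree_smult_le]) simp
    also have "\<dots> \<le> q" using J1(2) by simp
    finally have "degree_below (q + (s' + q)) (kill j * (monom (1 / ev j ^ s') s' * base j l))"
      by (rule degree_below_mult[OF _ 2])
    moreover have "q + (s' + q) = 2 * q + s'" by simp
    ultimately show ?thesis using True by (simp only: U_def if_True)
  qed (simp add: U_def degree_below_def)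
  have value_U: "(\<Sum>l<m. poly (U j l) (ev i) * co (col B l) i) = poly (kill j) (ev i) * ((ev i / ev j) ^ s' * W j i)" for i j
  proof -
    have base: "poly (base j l) (ev i) = (\<Sum>a<q. N j (l, a) * rel_ev i ^ a)" for l
      by (simp add: base_def poly_sum poly_monom power_divide)
    have "(\<Sum>l<m. poly (U j l) (ev i) * co (col B l) i) = (\<Sum>l\<in>L. poly (U j l) (ev i) * co (col B l) i)"
      by (rule sum.mono_neutral_right) (use L in \<open>auto simp: U_def\<close>)
    also have "\<dots> = (\<Sum>l\<in>L. poly (kill j) (ev i) * ((ev i / ev j) ^ s' * (\<Sum>a<q. N j (l, a) * rel_ev i ^ a * co (col B l) i)))"
    proof (intro sum.cong refl)
      fix l assume l: "l \<in> L"
      have "(\<Sum>a<q. N j (l, a) * rel_ev i ^ a * co (col B l) i) = poly (base j l) (ev i) * co (col B l) i"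
        unfolding base by (rule sum_distrib_right[symmetric])
      then show "poly (U j l) (ev i) * co (col B l) i
         = poly (kill j) (ev i) * ((ev i / ev j) ^ s' * (\<Sum>a<q. N j (l, a) * rel_ev i ^ a * co (col B l) i))"
        using l by (simp add: U_def poly_monom power_divide)
    qed
    also have "\<dots> = poly (kill j) (ev i) * ((ev i / ev j) ^ s' * W j i)"
      unfolding W_def by (simp add: sum_distrib_left)
    finally show ?thesis .
  qed
  have kill_eq: "poly (kill j) y = (\<Prod>i\<in>J1. (y - ev i) / (ev j - ev i))" for j y
    by (simp add: kill_def poly_prod diff_divide_distrib)
  have gap: "\<Delta> * ev 1 \<le> \<bar>ev j - ev i\<bar>" "\<bar>ev j - ev i\<bar> > 0" if "j \<in> {1..r} - J1" "i \<in> J1" for i j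
  proof -
    have "i \<noteq> j" "i \<in> {1..r}" using that J1(1) by auto
    then show "\<Delta> * ev 1 \<le> \<bar>ev j - ev i\<bar>" using sep[of j i] that(1) by auto
    moreover have "0 < \<Delta> * ev 1" using \<Delta> ev1 by simp
    ultimately show "\<bar>ev j - ev i\<bar> > 0" by linarith
  qed
  have kill_self: "poly (kill j) (ev j) = 1" if "j \<in> {1..r} - J1" for j
    unfolding kill_eq using gap(2)[OF that] by (intro prod.neutral) auto
  have kill_bound: "\<bar>poly (kill j) (ev i)\<bar> \<le> (1 / \<Delta>) ^ (q - 1)" if j: "j \<in> {1..r} - J1" and i: "i \<in> {1..d}" for i j
  proof -
    have "\<bar>poly (kill j) (ev i)\<bar> = (\<Prod>i'\<in>J1. \<bar>(ev i - ev i') / (ev j - ev i')\<bar>)"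
      unfolding kill_eq by (rule abs_prod)
    also have "\<dots> \<le> (\<Prod>i'\<in>J1. 1 / \<Delta>)"
    proof (intro prod_mono conjI abs_ge_zero)
      fix i' assume i': "i' \<in> J1"
      then have i'd: "i' \<in> {1..d}" using J1(1) r by auto
      have "\<bar>ev i - ev i'\<bar> \<le> ev 1"
        using ev_pos[OF i] ev_pos[OF i'd] ev_antimono[of 1 i] ev_antimono[of 1 i'] i i'd by auto
      moreover have "0 < \<Delta> * ev 1" using \<Delta> ev1 by simp
      ultimately have "\<bar>ev i - ev i'\<bar> / \<bar>ev j - ev i'\<bar> \<le> ev 1 / (\<Delta> * ev 1)"
        using gap(1)[OF j i'] ev1 by (intro frac_le) simp_all
      then show "\<bar>(ev i - ev i') / (ev j - ev i')\<bar> \<le> 1 / \<Delta>" using ev1 by (simp add: abs_divide)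
    qed
    also have "\<dots> = (1 / \<Delta>) ^ card J1" by simp
    also have "\<dots> \<le> (1 / \<Delta>) ^ (q - 1)" using J1(2) \<Delta> \<Delta>1 by (intro power_increasing) simp_all
    finally show ?thesis .
  qed
  show ?thesis
  proof (intro exI[of _ U] conjI ballI allI impI)
    show "degree_below (2 * q + s') (U j l)" for j l by (rule deg)
    show "(\<Sum>l<m. poly (U j l) (ev i) * co (col B l) i) = (if i = j then 1 else 0)"
      if "j \<in> top_set r - J1" "i \<in> top_set r - J1" for i j
    proof -
      have ij: "j \<in> {1..r} - J1" "i \<in> {1..r} - J1" using that by auto
      have "ev j \<noteq> 0" using ev_pos[of j] ij(1) r by auto
      then show ?thesis unfolding value_U N_props(1)[OF ij] using kill_self[OF ij(1)] by simp
    qed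
    show "\<bar>\<Sum>l<m. poly (U j l) (ev i) * co (col B l) i\<bar> \<le> \<epsilon>"
      if j: "j \<in> top_set r - J1" and i: "i \<in> {1..d} - top_set r" for i j
    proof -
      have j': "j \<in> {1..r} - J1" using j by auto
      have \<epsilon>0: "0 \<le> \<epsilon>" by (rule order_trans[OF _ \<epsilon>]) (use \<Delta> T0 \<eta> in simp)
      consider "i \<in> J1" | "i \<in> {1..r} - J1" | "i > r" using i by force
      then show ?thesis
      proof cases
        case 1
        then have "poly (kill j) (ev i) = 0" unfolding kill_eq using finJ1 by (intro prod_zero) auto
        then show ?thesis unfolding value_U using \<epsilon>0 by simp
      next
        case 2
        then have "W j i = 0" using N_props(1)[OF j' 2] i j by auto
        then show ?thesis unfolding value_U using \<epsilon>0 by simp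
      next
        case 3
        have id: "i \<in> {1..d}" using i by simp
        have "ev i \<le> ev (r + 1)" using 3 id by (intro ev_antimono) auto
        moreover have "4 * ev (r + 1) < ev j" using j by simp
        moreover have "0 < ev i" by (rule ev_pos[OF id])
        ultimately have "0 \<le> ev i / ev j" "ev i / ev j \<le> 1 / 4" by (simp_all add: divide_le_eq)
        then have pw: "\<bar>(ev i / ev j) ^ s'\<bar> \<le> (1 / 4) ^ s'" by (simp add: power_mono)
        have "\<bar>\<Sum>l<m. poly (U j l) (ev i) * co (col B l) i\<bar>
            = \<bar>(ev i / ev j) ^ s'\<bar> * \<bar>poly (kill j) (ev i)\<bar> * \<bar>W j i\<bar>"
          unfolding value_U abs_mult by (simp only: mult_ac)
        also have "\<dots> \<le> (1 / 4) ^ s' * (1 / \<Delta>) ^ (q - 1) * sqrt (q * T / \<eta>)"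
          using \<Delta> by (intro mult_mono pw kill_bound[OF j' id] W_bound[OF j' id]) simp_all
        also have "\<dots> \<le> \<epsilon>" by (rule \<epsilon>)
        finally show ?thesis .
      qed
    qed
  qed
qed

text \<open>
  Comparison with the zero vector; it serves the iterations \<open>t < s\<close>, where the claimed rate is at least 1.
\<close>

lemma cg_energy_trivial:
  assumes B: "B \<in> carrier_mat d m" and i0: "i0 < m" and \<mu>: "\<mu> \<ge> 0"
  shows "energy \<mu> (cg_residual B t i0 \<mu>) \<le> (\<Sum>i\<in>{1..d}. (co (col B i0) i)\<^sup>2 / (ev i + \<mu>))"
proof -
  have "energy \<mu> (cg_residual B t i0 \<mu>) \<le> energy \<mu> (\<lambda>i. co (col B i0) i / (ev i + \<mu>) - (\<Sum>j<m. poly 0 (ev i) * co (col B j) i))"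
    by (rule cg_residual_minimal[OF B i0 \<mu>]) (simp add: degree_below_def)
  also have "\<dots> = (\<Sum>i\<in>{1..d}. (co (col B i0) i)\<^sup>2 / (ev i + \<mu>))"
    unfolding energy_def
  proof (intro sum.cong refl)
    fix i assume "i \<in> {1..d}"
    then have "ev i + \<mu> > 0" using ev_pos[of i] \<mu> by simp
    then show "(ev i + \<mu>) * (co (col B i0) i / (ev i + \<mu>) - (\<Sum>j<m. poly 0 (ev i) * co (col B j) i))\<^sup>2 = (co (col B i0) i)\<^sup>2 / (ev i + \<mu>)"
      by (simp add: power_divide power2_eq_square)
  qed
  finally show ?thesis .
qed

text \<open>
  The linear polynomial with value 1 at \<open>-\<mu>\<close> and a zero at \<open>\<lambda>\<^sub>j\<close>; its modulus is at most 1 at all smaller eigenvalues.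
\<close>

definition root_factor :: "real \<Rightarrow> nat \<Rightarrow> real poly" where
  "root_factor \<mu> j = [:ev j / (ev j + \<mu>), - 1 / (ev j + \<mu>):]"

lemma poly_root_factor: "poly (root_factor \<mu> j) y = (ev j - y) / (ev j + \<mu>)"
  by (simp add: root_factor_def diff_divide_distrib)

lemma degree_prod_root_factor: "finite S \<Longrightarrow> degree (\<Prod>j\<in>S. root_factor \<mu> j) \<le> card S"
proof -
  assume S: "finite S"
  have "degree (\<Prod>j\<in>S. root_factor \<mu> j) \<le> (\<Sum>j\<in>S. degree (root_factor \<mu> j))"
    using degree_prod_sum_le[OF S, of "root_factor \<mu>"] by (simp add: comp_def)
  also have "\<dots> \<le> (\<Sum>j\<in>S. 1)" by (intro sum_mono) (simp add: root_factor_def)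
  finally show ?thesis by simp
qed

text \<open>
  After \<open>d\<close> steps \<open>\<rho>\<close> can vanish at all eigenvalues.
\<close>

lemma cg_energy_exact:
  assumes B: "B \<in> carrier_mat d m" and i0: "i0 < m" and \<mu>: "\<mu> \<ge> 0" and t: "d \<le> t"
  shows "energy \<mu> (cg_residual B t i0 \<mu>) \<le> 0"
proof -
  have pos: "ev i + \<mu> > 0" if "i \<in> {1..d}" for i using ev_pos[OF that] \<mu> by simp
  have "energy \<mu> (cg_residual B t i0 \<mu>) \<le> ((0::real) * (1 + 0 * real d))\<^sup>2 * (\<Sum>i\<in>{1..d}. (co (col B i0) i)\<^sup>2 / (ev i + \<mu>))"
  proof (rule cg_residual_deflation_bound[OF B i0 \<mu>, where J = "{}" and J' = "{}" and s = 0 and n = d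
        and \<rho> = "\<Prod>j\<in>{1..d}. root_factor \<mu> j" and U = "\<lambda>_ _. 0"])
    show "poly (\<Prod>j\<in>{1..d}. root_factor \<mu> j) (- \<mu>) = 1"
      unfolding poly_prod poly_root_factor using pos by (intro prod.neutral) force
    show "degree (\<Prod>j\<in>{1..d}. root_factor \<mu> j) \<le> d" using degree_prod_root_factor[of "{1..d}" \<mu>] by simp
    show "\<bar>poly (\<Prod>j\<in>{1..d}. root_factor \<mu> j) (ev i)\<bar> \<le> 0" if "i \<in> {1..d} - {}" for i
    proof -
      have "(\<Prod>j\<in>{1..d}. (ev j - ev i) / (ev j + \<mu>)) = 0" using that by (intro prod_zero) auto
      then show ?thesis unfolding poly_prod poly_root_factor by simp
    qed
  qed (use t in simp_all)
  then show ?thesis by simp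
qed

text \<open>
  The polynomial \<open>\<rho>\<close> is the Chebyshev residual polynomial on \<open>[\<lambda>\<^sub>d, 4 \<lambda>\<^sub>r\<^sub>+\<^sub>1]\<close> times one \<open>root_factor\<close> for each
  large eigenvalue that was given up.  The constant is \<open>2 (1 + 1/40) = 41/20\<close>.
\<close>

lemma cg_energy_deflated:
  assumes B: "B \<in> carrier_mat d m" and i0: "i0 < m" and \<mu>: "\<mu> \<ge> 0" and r: "r + 1 \<le> d"
    and J1: "finite J1" "card J1 \<le> c" and t: "s + c \<le> t"
    and U: "\<And>j l. j \<in> top_set r - J1 \<Longrightarrow> l < m \<Longrightarrow> degree_below s (U j l)"
    and Uc: "\<And>j i. j \<in> top_set r - J1 \<Longrightarrow> i \<in> top_set r - J1 \<Longrightarrow>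
        (\<Sum>l<m. poly (U j l) (ev i) * co (col B l) i) = (if i = j then 1 else 0)"
    and U\<epsilon>: "\<And>j i. j \<in> top_set r - J1 \<Longrightarrow> i \<in> {1..d} - top_set r \<Longrightarrow>
        \<bar>\<Sum>l<m. poly (U j l) (ev i) * co (col B l) i\<bar> \<le> 1 / (40 * real d)"
  shows "energy \<mu> (cg_residual B t i0 \<mu>)
     \<le> (41 / 20 * exp (- (real t - real (s + c)) / (3 * sqrt (ev (r + 1) / ev d))))\<^sup>2
        * (\<Sum>i\<in>{1..d}. (co (col B i0) i)\<^sup>2 / (ev i + \<mu>))"
proof -
  define n where "n = t - (s + c)"
  have n: "real n = real t - real (s + c)" using t by (simp add: n_def)
  have pos: "ev i + \<mu> > 0" if "i \<in> {1..d}" for i using ev_pos[OF that] \<mu> by simp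
  have evd: "0 < ev d" "ev d \<le> ev (r + 1)" using ev_pos[of d] ev_antimono[of "r + 1" d] r by simp_all
  obtain \<rho>0 where \<rho>0: "degree \<rho>0 \<le> n" "poly \<rho>0 (- \<mu>) = 1"
    "\<And>y. ev d \<le> y \<Longrightarrow> y \<le> 4 * ev (r + 1) \<Longrightarrow> \<bar>poly \<rho>0 y\<bar> \<le> 2 * exp (- real n / (3 * sqrt (ev (r + 1) / ev d)))"
    using chebyshev_residual_polynomial[OF evd \<mu>, of n] by blast
  define S where "S = top_set r \<inter> J1"
  have Sf: "finite S" using J1(1) by (simp add: S_def)
  have Sc: "card S \<le> c" using card_mono[OF J1(1), of S] J1(2) by (simp add: S_def)
  have Sd: "S \<subseteq> {1..d}" using r by (auto simp: S_def)
  define \<rho> where "\<rho> = \<rho>0 * (\<Prod>j\<in>S. root_factor \<mu> j)"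
  define \<tau> where "\<tau> = 2 * exp (- real n / (3 * sqrt (ev (r + 1) / ev d)))"
  have low: "ev d \<le> ev i" "ev i \<le> 4 * ev (r + 1)" if i: "i \<in> {1..d} - top_set r" for i
  proof -
    show "ev d \<le> ev i" using i by (intro ev_antimono) auto
    show "ev i \<le> 4 * ev (r + 1)"
    proof (cases "i \<le> r")
      case True
      then show ?thesis using i by force
    next
      case False
      then have "ev i \<le> ev (r + 1)" using i by (intro ev_antimono) auto
      then show ?thesis using evd by linarith
    qed
  qed
  have "energy \<mu> (cg_residual B t i0 \<mu>) \<le> (\<tau> * (1 + 1 / (40 * real d) * real d))\<^sup>2 * (\<Sum>i\<in>{1..d}. (co (col B i0) i)\<^sup>2 / (ev i + \<mu>))"
  proof (rule cg_residual_deflation_bound[OF B i0 \<mu>, where J = "top_set r" and J' = S and \<rho> = \<rho> and n = "n + c" and s = s and U = U])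
    show "top_set r \<subseteq> {1..d}" using r by auto
    show "S \<subseteq> top_set r" by (simp add: S_def)
    have "(\<Prod>j\<in>S. poly (root_factor \<mu> j) (- \<mu>)) = 1"
      unfolding poly_root_factor using pos Sd by (intro prod.neutral) force
    then show "poly \<rho> (- \<mu>) = 1" by (simp add: \<rho>_def poly_prod \<rho>0(2))
    show "degree \<rho> \<le> n + c"
      unfolding \<rho>_def using degree_mult_le[of \<rho>0 "\<Prod>j\<in>S. root_factor \<mu> j"] \<rho>0(1) degree_prod_root_factor[OF Sf, of \<mu>] Sc by linarith
    show "n + c + s \<le> t" using t by (simp add: n_def)
    show "poly \<rho> (ev j) = 0" if "j \<in> S" for j
    proof -
      have "(\<Prod>j'\<in>S. poly (root_factor \<mu> j') (ev j)) = 0" using that Sf by (intro prod_zero) (auto simp: poly_root_factor)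
      then show ?thesis by (simp add: \<rho>_def poly_prod)
    qed
    show "\<bar>poly \<rho> (ev i)\<bar> \<le> \<tau>" if i: "i \<in> {1..d} - top_set r" for i
    proof -
      have "\<bar>poly (\<Prod>j\<in>S. root_factor \<mu> j) (ev i)\<bar> = (\<Prod>j\<in>S. \<bar>(ev j - ev i) / (ev j + \<mu>)\<bar>)"
        unfolding poly_prod poly_root_factor by (rule abs_prod)
      also have "\<dots> \<le> (\<Prod>j\<in>S. 1)"
      proof (intro prod_mono conjI abs_ge_zero)
        fix j assume j: "j \<in> S"
        have "ev i < ev j" using low(2)[OF i] j by (auto simp: S_def)
        moreover have "0 < ev i" using ev_pos[of i] i by simp
        ultimately show "\<bar>(ev j - ev i) / (ev j + \<mu>)\<bar> \<le> 1" using \<mu> by (simp add: divide_le_eq)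
      qed
      finally have 1: "\<bar>poly (\<Prod>j\<in>S. root_factor \<mu> j) (ev i)\<bar> \<le> 1" by simp
      have "\<bar>poly \<rho> (ev i)\<bar> = \<bar>poly \<rho>0 (ev i)\<bar> * \<bar>poly (\<Prod>j\<in>S. root_factor \<mu> j) (ev i)\<bar>"
        by (simp add: \<rho>_def abs_mult)
      also have "\<dots> \<le> \<tau> * 1"
        unfolding \<tau>_def using \<rho>0(3)[OF low[OF i]] 1 by (intro mult_mono) simp_all
      finally show ?thesis by simp
    qed
    have minus: "top_set r - S = top_set r - J1" by (auto simp: S_def)
    show "degree_below s (U j l)" if "j \<in> top_set r - S" "l < m" for j l
      using U that unfolding minus by blast
    show "(\<Sum>l<m. poly (U j l) (ev i) * co (col B l) i) = (if i = j then 1 else 0)"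
      if "j \<in> top_set r - S" "i \<in> top_set r - S" for j i using Uc that unfolding minus by blast
    show "\<bar>\<Sum>l<m. poly (U j l) (ev i) * co (col B l) i\<bar> \<le> 1 / (40 * real d)"
      if "j \<in> top_set r - S" "i \<in> {1..d} - top_set r" for j i using U\<epsilon> that unfolding minus by blast
    show "ev i \<le> ev j" if "j \<in> top_set r" "i \<in> {1..d} - top_set r" for i j
      using low(2)[OF that(2)] that(1) by simp
    show "0 \<le> \<tau>" by (simp add: \<tau>_def)
    show "0 \<le> 1 / (40 * real d)" by simp
  qed
  moreover have "\<tau> * (1 + 1 / (40 * real d) * real d) = 41 / 20 * exp (- (real t - real (s + c)) / (3 * sqrt (ev (r + 1) / ev d)))"
    using r by (simp add: \<tau>_def n)
  ultimately show ?thesis by (simp only:)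
qed

end

section \<open>The probability of ill-conditioned rows\<close>

lemma ip_cong:
  "(\<And>x. x \<in> X \<Longrightarrow> f x = f' x) \<Longrightarrow> (\<And>x. x \<in> X \<Longrightarrow> g x = g' x) \<Longrightarrow> ip X c f g = ip X c f' g'"
  unfolding ip_def by (intro sum.cong) simp_all

lemma residual_cong:
  assumes "\<And>k x. k \<in> set ks \<Longrightarrow> x \<in> X \<Longrightarrow> w k x = w' k x"
    and "\<And>x. x \<in> X \<Longrightarrow> f x = f' x" and "x \<in> X"
  shows "residual X c (map w ks) f x = residual X c (map w' ks) f' x"
  using assms
proof (induction ks arbitrary: f f' x)
  case (Cons k ks)
  have 1: "residual X c (map w ks) f x = residual X c (map w' ks) f' x" if "x \<in> X" for x
    by (rule Cons.IH) (use Cons.prems that in simp_all)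
  have 2: "residual X c (map w ks) (w k) x = residual X c (map w' ks) (w' k) x" if "x \<in> X" for x
    by (rule Cons.IH) (use Cons.prems that in simp_all)
  show ?case
    unfolding list.map residual.simps
    by (simp only: 1[OF Cons.prems(3)] 2[OF Cons.prems(3)] ip_cong[OF 1 2] ip_cong[OF 2 2])
qed simp

lemma dsq_cong:
  assumes L: "finite L" and S: "finite S"
    and g: "\<And>i l. i \<in> S \<Longrightarrow> l \<in> L \<Longrightarrow> g i l = g' i l"
    and f: "\<And>z. z \<in> L \<times> {..<q} \<Longrightarrow> f z = f' z"
  shows "block_rows.dsq L q x g S f = block_rows.dsq L q x g' S f'"
proof -
  interpret G: block_rows L q x g by standard (rule L)
  interpret G': block_rows L q x g' by standard (rule L)
  have res: "G.resid S f z = G'.resid S f' z" if "z \<in> G.X" for z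
    unfolding G.resid_def G'.resid_def
  proof (rule residual_cong[OF _ _ that])
    fix k z assume k: "k \<in> set (sorted_list_of_set S)" and z: "z \<in> G.X"
    have "k \<in> S" using k S by simp
    moreover have "fst z \<in> L" using z by (simp add: G.X_def mem_Times_iff)
    ultimately show "G.row k z = G'.row k z" by (simp add: G.row_def G'.row_def split_def g)
  next
    fix z assume "z \<in> G.X"
    then show "f z = f' z" unfolding G.X_def by (rule f)
  qed
  show ?thesis
    unfolding G.dsq_def G'.dsq_def by (rule ip_cong) (rule res, assumption)+
qed

lemma dsq_measurable:
  assumes L: "finite L" and S: "finite S"
    and g: "\<And>i l. i \<in> S \<Longrightarrow> l \<in> L \<Longrightarrow> (\<lambda>p. g p i l) \<in> borel_measurable M"
    and f: "\<And>z. z \<in> L \<times> {..<q} \<Longrightarrow> (\<lambda>p. f p z) \<in> borel_measurable M"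
  shows "(\<lambda>p. block_rows.dsq L q x (g p) S (f p)) \<in> borel_measurable M"
proof -
  have BR: "block_rows L" using L by (rule block_rows.intro)
  note defs = block_rows.dsq_def[OF BR] block_rows.resid_def[OF BR] block_rows.X_def[OF BR] block_rows.row_def[OF BR]
  have fin: "finite (L \<times> {..<q})" using L by simp
  have res: "(\<lambda>p. residual (L \<times> {..<q}) (\<lambda>_. 1) (map (\<lambda>i z. g p i (fst z) * x i ^ snd z) (sorted_list_of_set S)) (f p) z) \<in> borel_measurable M"
    if z: "z \<in> L \<times> {..<q}" for z
  proof (rule residual_measurable[where c = "\<lambda>_ _. 1" and w = "\<lambda>i p z. g p i (fst z) * x i ^ snd z", OF fin _ _ f z])
    show "(\<lambda>p. g p k (fst z) * x k ^ snd z) \<in> borel_measurable M"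
      if "k \<in> set (sorted_list_of_set S)" "z \<in> L \<times> {..<q}" for k z
    proof -
      have "k \<in> S" "fst z \<in> L" using that S by auto
      from g[OF this] show ?thesis by measurable
    qed
  qed simp
  show ?thesis
    unfolding defs split_def
    by (rule ip_measurable[where c = "\<lambda>_ _. 1", OF fin])
       (rule borel_measurable_const, (rule res, assumption)+)
qed

context eigenbasis
begin

text \<open>
  The coordinate along \<open>v i\<close> of column \<open>l\<close>, as a linear form on the outcomes.
\<close>

definition gauss_coord :: "(nat \<times> nat \<Rightarrow> real) \<Rightarrow> nat \<Rightarrow> nat \<Rightarrow> real" where
  "gauss_coord \<omega> i l = (\<Sum>p<d. v i $ p * \<omega> (p, l))"

lemma gram_rows_block_of:
  assumes "l < m" shows "gram_rows (block_of d m \<omega>) i l = gauss_coord \<omega> i l"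
  using assms by (simp add: co_def gauss_coord_def block_of_def scalar_prod_def atLeast0LessThan)

lemma gauss_coord_measurable:
  assumes "l < m" shows "(\<lambda>\<omega>. gauss_coord \<omega> i l) \<in> borel_measurable (\<Pi>\<^sub>M k\<in>{..<d} \<times> {..<m}. borel)"
  unfolding gauss_coord_def using assms
  by (intro borel_measurable_sum borel_measurable_times borel_measurable_const measurable_component_singleton) auto

text \<open>
  Moving the outcome in the direction of \<open>v j\<close> placed in column \<open>l\<close> changes only the coordinate \<open>(j, l)\<close>, by
  orthonormality.
\<close>

lemma gauss_coord_shift:
  assumes i: "i \<in> {1..d}" and j: "j \<in> {1..d}" and l: "l < m" and l': "l' < m"
  shows "gauss_coord (shift_on ({..<d} \<times> {..<m}) (\<lambda>(p, b). if b = l then v j $ p else 0) t \<omega>) i l'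
    = gauss_coord \<omega> i l' + t * (if i = j \<and> l' = l then 1 else 0)"
proof -
  have "gauss_coord (shift_on ({..<d} \<times> {..<m}) (\<lambda>(p, b). if b = l then v j $ p else 0) t \<omega>) i l'
     = (\<Sum>p<d. v i $ p * \<omega> (p, l') + t * (if l' = l then v i $ p * v j $ p else 0))"
    unfolding gauss_coord_def using l' by (intro sum.cong refl) (simp add: shift_on_def algebra_simps)
  also have "\<dots> = gauss_coord \<omega> i l' + t * (if l' = l then (\<Sum>p<d. v i $ p * v j $ p) else 0)"
    by (simp add: sum.distrib gauss_coord_def sum_distrib_left)
  also have "(\<Sum>p<d. v i $ p * v j $ p) = v i \<bullet> v j"
    using v_carrier[OF j] by (simp add: scalar_prod_def atLeast0LessThan)
  also have "v i \<bullet> v j = (if i = j then 1 else 0)" by (rule v_orthonormal[OF i j])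
  finally show ?thesis by (cases "i = j"; cases "l' = l") simp_all
qed

text \<open>
  Row \<open>j\<close> is close to the span of the rows in \<open>S\<close>, although \<open>node l j\<close>, in whose direction it moves, is not.
\<close>

definition bad_event :: "nat \<Rightarrow> nat set \<Rightarrow> nat \<Rightarrow> real \<Rightarrow> real \<Rightarrow> nat set \<Rightarrow> nat \<Rightarrow> nat \<Rightarrow> (nat \<times> nat \<Rightarrow> real) set" where
  "bad_event m L q \<eta> \<theta> S j l = {\<omega> \<in> space (\<Pi>\<^sub>M k\<in>{..<d} \<times> {..<m}. borel).
     block_rows.dsq L q rel_ev (gauss_coord \<omega>) S (block_rows.row rel_ev (gauss_coord \<omega>) j) < \<eta> \<and>
     \<theta> \<le> block_rows.dsq L q rel_ev (gauss_coord \<omega>) S (block_rows.node rel_ev l j)}"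

lemma bad_event_measurable:
  assumes L: "L \<subseteq> {..<m}" and S: "finite S"
  shows "bad_event m L q \<eta> \<theta> S j l \<in> sets (\<Pi>\<^sub>M k\<in>{..<d} \<times> {..<m}. borel)"
proof -
  have finL: "finite L" using L finite_subset by blast
  have BR: "block_rows L" using finL by (simp add: block_rows_def)
  have g: "(\<lambda>\<omega>. gauss_coord \<omega> i b) \<in> borel_measurable (\<Pi>\<^sub>M k\<in>{..<d} \<times> {..<m}. borel)" if "b \<in> L" for i b
    using gauss_coord_measurable that L by blast
  have 1[measurable]: "(\<lambda>\<omega>. block_rows.dsq L q rel_ev (gauss_coord \<omega>) S (block_rows.row rel_ev (gauss_coord \<omega>) j)) \<in> borel_measurable (\<Pi>\<^sub>M k\<in>{..<d} \<times> {..<m}. borel)"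
  proof (rule dsq_measurable[OF finL S g])
    fix z assume "z \<in> L \<times> {..<q}"
    then have "(\<lambda>\<omega>. gauss_coord \<omega> j (fst z)) \<in> borel_measurable (\<Pi>\<^sub>M k\<in>{..<d} \<times> {..<m}. borel)" by (intro g) auto
    then show "(\<lambda>\<omega>. block_rows.row rel_ev (gauss_coord \<omega>) j z) \<in> borel_measurable (\<Pi>\<^sub>M k\<in>{..<d} \<times> {..<m}. borel)"
      unfolding block_rows.row_def[OF BR] split_def by measurable
  qed
  have 2[measurable]: "(\<lambda>\<omega>. block_rows.dsq L q rel_ev (gauss_coord \<omega>) S (block_rows.node rel_ev l j)) \<in> borel_measurable (\<Pi>\<^sub>M k\<in>{..<d} \<times> {..<m}. borel)"
    by (rule dsq_measurable[OF finL S g]) simp_all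
  show ?thesis unfolding bad_event_def by measurable
qed

text \<open>
  On the lines along which only the coordinate \<open>(j, l)\<close> moves, the rows in \<open>S\<close> are fixed because \<open>j\<close> is not in \<open>S\<close>, and the
  residual of row \<open>j\<close> is \<open>R + t N\<close> with \<open>N\<close> the residual of \<open>node l j\<close>.  Two parameters with \<open>|R + t N|\<^sup>2 < \<eta>\<close> differ by at most
  \<open>2 \<surd>(\<eta>/|N|\<^sup>2) \<le> 2 \<surd>(\<eta>/\<theta>)\<close>, so the line bound applies.
\<close>

lemma prob_bad_event:
  assumes L: "L \<subseteq> {..<m}" and S: "finite S" "S \<subseteq> {1..d}" and j: "j \<in> {1..d}" "j \<notin> S" and l: "l \<in> L"
    and \<eta>: "0 \<le> \<eta>" and \<theta>: "0 < \<theta>"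
  shows "emeasure (gaussian_law d m) (bad_event m L q \<eta> \<theta> S j l) \<le> ennreal (16 * sqrt (\<eta> / \<theta>))"
proof -
  let ?K = "{..<d} \<times> {..<m}"
  let ?w = "\<lambda>(p, b). if b = l then v j $ p else 0"
  have finL: "finite L" using L finite_subset by blast
  have lm: "l < m" using l L by auto
  have BR: "block_rows L" using finL by (simp add: block_rows_def)
  have norm1: "(\<Sum>k\<in>?K. (?w k)\<^sup>2) = 1"
  proof -
    have "(\<Sum>k\<in>?K. (?w k)\<^sup>2) = (\<Sum>p<d. \<Sum>b<m. if b = l then (v j $ p)\<^sup>2 else 0)"
      unfolding sum.cartesian_product by (intro sum.cong) auto
    also have "\<dots> = (\<Sum>p<d. (v j $ p)\<^sup>2)" using lm by simp
    also have "\<dots> = v j \<bullet> v j" using v_carrier[OF j(1)] by (simp add: scalar_prod_def atLeast0LessThan power2_eq_square)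
    finally show ?thesis using v_orthonormal[OF j(1) j(1)] by simp
  qed
  have "emeasure (std_normal_prod ?K) (bad_event m L q \<eta> \<theta> S j l) \<le> ennreal (8 * (2 * sqrt (\<eta> / \<theta>)))"
  proof (rule std_normal_prod_line_bound[OF _ norm1 bad_event_measurable[OF L S(1)]])
    fix x s t
    assume s: "shift_on ?K ?w s x \<in> bad_event m L q \<eta> \<theta> S j l" and t: "shift_on ?K ?w t x \<in> bad_event m L q \<eta> \<theta> S j l"
    interpret R: block_rows L q rel_ev "gauss_coord x" by standard (rule finL)
    let ?ip = "ip R.X (\<lambda>_. 1)"
    let ?R0 = "R.resid S (R.row j)" and ?Rn = "R.resid S (R.node l j)"
    have row: "block_rows.dsq L q rel_ev (gauss_coord (shift_on ?K ?w u x)) S (block_rows.row rel_ev (gauss_coord (shift_on ?K ?w u x)) j)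
       = ?ip (\<lambda>z. ?R0 z + u * ?Rn z) (\<lambda>z. ?R0 z + u * ?Rn z)" for u
    proof -
      have "block_rows.dsq L q rel_ev (gauss_coord (shift_on ?K ?w u x)) S (block_rows.row rel_ev (gauss_coord (shift_on ?K ?w u x)) j)
         = R.dsq S (\<lambda>z. R.row j z + u * R.node l j z)"
      proof (rule dsq_cong[OF finL S(1)])
        show "gauss_coord (shift_on ?K ?w u x) i b = gauss_coord x i b" if "i \<in> S" "b \<in> L" for i b
        proof -
          have "i \<in> {1..d}" "b < m" "i \<noteq> j" using that S(2) L j(2) by auto
          then show ?thesis using gauss_coord_shift[OF _ j(1) lm, of i b u x] by simp
        qed
        fix z assume z: "z \<in> L \<times> {..<q}"
        then obtain b a where zz: "z = (b, a)" and "b < m" using L by auto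
        show "block_rows.row rel_ev (gauss_coord (shift_on ?K ?w u x)) j z = R.row j z + u * R.node l j z"
          unfolding block_rows.row_def[OF BR] R.node_def zz prod.case gauss_coord_shift[OF j(1) j(1) lm \<open>b < m\<close>]
          by (cases "b = l") (simp_all add: distrib_right)
      qed
      also have "\<dots> = ?ip (\<lambda>z. ?R0 z + u * ?Rn z) (\<lambda>z. ?R0 z + u * ?Rn z)"
        unfolding R.dsq_def R.resid_def by (rule ip_cong) (rule residual_affine)+
      finally show ?thesis .
    qed
    have node: "block_rows.dsq L q rel_ev (gauss_coord (shift_on ?K ?w u x)) S (block_rows.node rel_ev l j) = ?ip ?Rn ?Rn" for u
      unfolding R.dsq_def[symmetric]
    proof (rule dsq_cong[OF finL S(1)])
      show "gauss_coord (shift_on ?K ?w u x) i b = gauss_coord x i b" if "i \<in> S" "b \<in> L" for i b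
      proof -
        have "i \<in> {1..d}" "b < m" "i \<noteq> j" using that S(2) L j(2) by auto
        then show ?thesis using gauss_coord_shift[OF _ j(1) lm, of i b u x] by simp
      qed
    qed simp
    have sm: "?ip (\<lambda>z. ?R0 z + s * ?Rn z) (\<lambda>z. ?R0 z + s * ?Rn z) < \<eta>" "\<theta> \<le> ?ip ?Rn ?Rn"
      using s unfolding bad_event_def by (simp_all only: mem_Collect_eq row node)
    have tm: "?ip (\<lambda>z. ?R0 z + t * ?Rn z) (\<lambda>z. ?R0 z + t * ?Rn z) < \<eta>"
      using t unfolding bad_event_def by (simp only: mem_Collect_eq row)
    have "(s - t)\<^sup>2 * ?ip ?Rn ?Rn = ?ip (\<lambda>z. (?R0 z + s * ?Rn z) - (?R0 z + t * ?Rn z)) (\<lambda>z. (?R0 z + s * ?Rn z) - (?R0 z + t * ?Rn z))"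
      unfolding ip_def sum_distrib_left by (intro sum.cong refl) (simp add: power2_eq_square algebra_simps)
    also have "\<dots> \<le> 2 * (?ip (\<lambda>z. ?R0 z + s * ?Rn z) (\<lambda>z. ?R0 z + s * ?Rn z) + ?ip (\<lambda>z. ?R0 z + t * ?Rn z) (\<lambda>z. ?R0 z + t * ?Rn z))"
      unfolding ip_def sum.distrib[symmetric] sum_distrib_left
    proof (rule sum_mono)
      fix z
      have gen: "1 * (a - b) * (a - b) \<le> 2 * (1 * a * a + 1 * b * b)" for a b :: real
        using zero_le_square[of "a + b"] by (simp add: algebra_simps)
      show "1 * (?R0 z + s * ?Rn z - (?R0 z + t * ?Rn z)) * (?R0 z + s * ?Rn z - (?R0 z + t * ?Rn z))
         \<le> 2 * (1 * (?R0 z + s * ?Rn z) * (?R0 z + s * ?Rn z) + 1 * (?R0 z + t * ?Rn z) * (?R0 z + t * ?Rn z))"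
        by (rule gen)
    qed
    also have "\<dots> \<le> 4 * \<eta>" using sm(1) tm by simp
    finally have "(s - t)\<^sup>2 * ?ip ?Rn ?Rn \<le> 4 * \<eta>" .
    moreover have "(s - t)\<^sup>2 * \<theta> \<le> (s - t)\<^sup>2 * ?ip ?Rn ?Rn" by (intro mult_left_mono sm(2)) simp
    ultimately have "(s - t)\<^sup>2 * \<theta> \<le> 4 * \<eta>" by linarith
    then have "(s - t)\<^sup>2 \<le> 4 * (\<eta> / \<theta>)" using \<theta> by (simp add: pos_le_divide_eq)
    then have "sqrt ((s - t)\<^sup>2) \<le> sqrt (4 * (\<eta> / \<theta>))" by (rule real_sqrt_le_mono)
    moreover have "sqrt (4 * (\<eta> / \<theta>)) = 2 * sqrt (\<eta> / \<theta>)" by (simp only: real_sqrt_mult real_sqrt_four)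
    ultimately show "\<bar>s - t\<bar> \<le> 2 * sqrt (\<eta> / \<theta>)" by (simp only: real_sqrt_abs)
  next
    show "0 \<le> 2 * sqrt (\<eta> / \<theta>)" using \<eta> \<theta> by simp
  qed simp
  then show ?thesis by (simp add: gaussian_law_def)
qed

end

text \<open>
  Markov's inequality; each coordinate has second moment 1.
\<close>

lemma std_normal_prod_sum_squares_tail:
  fixes K :: "'k set"
  assumes K: "finite K" and c: "c > 0"
  shows "emeasure (std_normal_prod K) {\<omega> \<in> space (std_normal_prod K). c \<le> (\<Sum>k\<in>K. (\<omega> k)\<^sup>2)} \<le> ennreal (card K / c)"
proof -
  interpret N: prob_space std_normal_distribution by (rule prob_space_normal_density) simp
  interpret P: product_prob_space "\<lambda>_::'k. std_normal_distribution" K by standard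
  have second: "(\<integral>\<^sup>+x. ennreal (x\<^sup>2) \<partial>std_normal_distribution) = 1"
  proof -
    have "has_bochner_integral lborel (\<lambda>x. std_normal_density x * x ^ (2 * 1)) (fact (2 * 1) / (2 ^ 1 * fact 1))"
      by (rule std_normal_moment_even)
    then have hb: "has_bochner_integral lborel (\<lambda>x. std_normal_density x * x\<^sup>2) 1" by simp
    have "(\<integral>\<^sup>+x. ennreal (x\<^sup>2) \<partial>std_normal_distribution) = (\<integral>\<^sup>+x. ennreal (std_normal_density x * x\<^sup>2) \<partial>lborel)"
      by (subst nn_integral_density) (simp_all add: ennreal_mult')
    also have "\<dots> = ennreal (\<integral>x. std_normal_density x * x\<^sup>2 \<partial>lborel)"
      by (rule nn_integral_eq_integral[OF integrable.intros[OF hb]]) simp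
    also have "\<dots> = 1" using has_bochner_integral_integral_eq[OF hb] by simp
    finally show ?thesis .
  qed
  have meas: "(\<lambda>\<omega>. \<omega> k) \<in> std_normal_prod K \<rightarrow>\<^sub>M std_normal_distribution" if "k \<in> K" for k
    using that by (rule measurable_component_singleton)
  have meas': "(\<lambda>\<omega>. \<omega> k) \<in> borel_measurable (std_normal_prod K)" if "k \<in> K" for k
    using meas[OF that] by simp
  have comp: "(\<integral>\<^sup>+\<omega>. ennreal ((\<omega> k)\<^sup>2) \<partial>std_normal_prod K) = 1" if k: "k \<in> K" for k
  proof -
    have "(\<integral>\<^sup>+\<omega>. ennreal ((\<omega> k)\<^sup>2) \<partial>std_normal_prod K)
      = (\<integral>\<^sup>+x. ennreal (x\<^sup>2) \<partial>distr (std_normal_prod K) std_normal_distribution (\<lambda>\<omega>. \<omega> k))"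
      by (rule nn_integral_distr[OF meas[OF k], symmetric]) simp
    also have "distr (std_normal_prod K) std_normal_distribution (\<lambda>\<omega>. \<omega> k) = std_normal_distribution"
      by (rule P.PiM_component[OF k])
    finally show ?thesis by (simp add: second)
  qed
  let ?u = "\<lambda>\<omega>. \<Sum>k\<in>K. ennreal ((\<omega> k)\<^sup>2)"
  have u: "?u \<in> borel_measurable (std_normal_prod K)"
    using meas' by (intro borel_measurable_sum measurable_compose[OF _ measurable_ennreal] borel_measurable_power) auto
  have int: "(\<integral>\<^sup>+\<omega>. ?u \<omega> \<partial>std_normal_prod K) = ennreal (card K)"
    using meas' by (subst nn_integral_sum) (auto simp: comp ennreal_of_nat_eq_real_of_nat)
  have "emeasure (std_normal_prod K) {\<omega> \<in> space (std_normal_prod K). c \<le> (\<Sum>k\<in>K. (\<omega> k)\<^sup>2)}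
     \<le> emeasure (std_normal_prod K) ({\<omega> \<in> space (std_normal_prod K). 1 \<le> ennreal (1 / c) * ?u \<omega>})"
  proof (rule emeasure_mono)
    show "{\<omega> \<in> space (std_normal_prod K). c \<le> (\<Sum>k\<in>K. (\<omega> k)\<^sup>2)} \<subseteq> {\<omega> \<in> space (std_normal_prod K). 1 \<le> ennreal (1 / c) * ?u \<omega>}"
    proof safe
      fix \<omega> assume "c \<le> (\<Sum>k\<in>K. (\<omega> k)\<^sup>2)"
      then have "1 \<le> 1 / c * (\<Sum>k\<in>K. (\<omega> k)\<^sup>2)" using c by (simp add: pos_le_divide_eq)
      then have "ennreal 1 \<le> ennreal (1 / c * (\<Sum>k\<in>K. (\<omega> k)\<^sup>2))" by (rule ennreal_leI)
      also have "\<dots> = ennreal (1 / c) * ?u \<omega>"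
        using c by (subst ennreal_mult') (simp_all add: sum_ennreal)
      finally show "1 \<le> ennreal (1 / c) * ?u \<omega>" by simp
    qed
    show "{\<omega> \<in> space (std_normal_prod K). 1 \<le> ennreal (1 / c) * ?u \<omega>} \<in> sets (std_normal_prod K)"
      using u by measurable
  qed
  also have "\<dots> \<le> ennreal (1 / c) * (\<integral>\<^sup>+\<omega>. ?u \<omega> * indicator (space (std_normal_prod K)) \<omega> \<partial>std_normal_prod K)"
  proof (rule nn_integral_Markov_inequality)
    show "(\<lambda>\<omega>. ?u \<omega> * indicator (space (std_normal_prod K)) \<omega>) \<in> borel_measurable (std_normal_prod K)"
      using u by measurable
  qed (rule sets.top)
  also have "(\<integral>\<^sup>+\<omega>. ?u \<omega> * indicator (space (std_normal_prod K)) \<omega> \<partial>std_normal_prod K) = ennreal (card K)"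
    unfolding int[symmetric] by (intro nn_integral_cong) simp
  also have "ennreal (1 / c) * ennreal (card K) = ennreal (card K / c)"
    using c by (subst ennreal_mult'[symmetric]) simp_all
  finally show ?thesis .
qed

section \<open>The number of lost iterations\<close>

text \<open>
  The parameters are those of \<open>error_probability_separated\<close>: \<open>\<theta>s\<close> and \<open>\<eta>s\<close> are the thresholds for the distances
  of nodes and of rows, \<open>T\<close> bounds the squared norms of the columns, and \<open>Z\<close> is the factor by which the damping has to reduce the
  coordinates beyond \<open>r\<close>.  All powers have the exponent \<open>q - 1 < r/(m-1) \<le> 2 r/m\<close>, except for \<open>r\<^sup>q\<^sup>+\<^sup>1\<close>, whose surplus factor
  \<open>r\<^sup>2\<close> contributes a multiple of \<open>log d\<close> only.  So \<open>log Z\<close> is at most a multiple of \<open>(q - 1) (log(1/\<Delta>) + log r) + log(d/\<delta>)\<close>; and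
  \<open>log r \<le> 2 log(1/\<Delta>)\<close> as soon as \<open>k q \<ge> 3\<close>, since \<open>\<Delta> (k q - 1) \<le> 1\<close>.
\<close>

lemma iteration_count_bound:
  fixes d m r q k :: nat and \<delta> \<Delta> \<theta>s \<eta>s T Z :: real
  assumes d: "2 \<le> d" and m: "2 \<le> m" and r: "1 \<le> r" and rd: "r + 1 \<le> d"
    and k: "k = m - 1" and q: "1 \<le> q" and qr: "real (q - 1) < r / k" and R: "k * q \<le> d" and rR: "r \<le> k * q"
    and \<delta>: "0 < \<delta>" "\<delta> < 1"
    and \<Delta>: "0 < \<Delta>" "\<Delta> \<le> 1" and \<Delta>R: "\<Delta> * (real (k * q) - 1) \<le> 1"
    and \<theta>s: "\<theta>s = (\<Delta> / 5) ^ (q - 1) / (2 * k)"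
    and \<eta>s: "\<eta>s = \<theta>s * \<delta> / (32 * m * r ^ (q + 1))"
    and T: "T = 2 * d * m / \<delta>"
    and Z: "Z = 40 * d * (1 / \<Delta>) ^ (q - 1) * (sqrt (q * T) / \<eta>s)"
  shows "real (3 * q) + (ln Z + 1) \<le> 50 * (r / m * ln (1 / \<Delta>) + ln (d / \<delta>))"
    and "Z > 0" "ln Z \<ge> 0"
proof -
  define \<Lambda> where "\<Lambda> = ln (d / \<delta>)"
  define D where "D = ln (1 / \<Delta>)"
  have D0: "D \<ge> 0" using \<Delta> by (simp add: D_def)
  have ld: "ln (real d) \<le> \<Lambda>" "ln (real d) \<ge> 0" and l\<delta>: "ln (1 / \<delta>) \<le> \<Lambda>" "ln (1 / \<delta>) \<ge> 0"
    and \<Lambda>2: "ln 2 \<le> \<Lambda>"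
  proof -
    have eq: "\<Lambda> = ln (real d) + ln (1 / \<delta>)" using d \<delta> by (simp add: \<Lambda>_def ln_div)
    show a: "ln (real d) \<ge> 0" "ln (1 / \<delta>) \<ge> 0" using d \<delta> by simp_all
    show "ln (real d) \<le> \<Lambda>" "ln (1 / \<delta>) \<le> \<Lambda>" using eq a by simp_all
    have "ln 2 \<le> ln (real d)" using d by (subst ln_le_cancel_iff) simp_all
    then show "ln 2 \<le> \<Lambda>" using \<open>ln (real d) \<le> \<Lambda>\<close> by linarith
  qed
  have \<Lambda>23: "2 / 3 \<le> \<Lambda>" using \<Lambda>2 ln2_ge_two_thirds by linarith
  have kpos: "k \<ge> 1" "k \<le> m" using k m by simp_all
  have kd: "k \<le> d"
    by (rule order_trans[OF _ R]) (use q in simp)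
  have qd: "q \<le> d"
    by (rule order_trans[OF _ R]) (use kpos in simp)
  have m2d: "m \<le> 2 * d" using kd k d by simp
  have ln2d: "ln (real (2 * d)) \<le> 2 * \<Lambda>" using ld \<Lambda>2 d by (simp add: ln_mult)
  have lm: "0 \<le> ln (real m)" "ln (real m) \<le> 2 * \<Lambda>"
  proof -
    show "0 \<le> ln (real m)" using m by simp
    have "ln (real m) \<le> ln (real (2 * d))" using m2d m by (subst ln_le_cancel_iff) simp_all
    then show "ln (real m) \<le> 2 * \<Lambda>" using ln2d by linarith
  qed
  have lk: "0 \<le> ln (2 * real k)" "ln (2 * real k) \<le> 3 * \<Lambda>"
  proof -
    show "0 \<le> ln (2 * real k)" using kpos by simp
    have "ln (2 * real k) = ln 2 + ln (real k)" using kpos by (simp add: ln_mult)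
    moreover have "ln (real k) \<le> ln (real m)" using kpos m by (subst ln_le_cancel_iff) simp_all
    ultimately show "ln (2 * real k) \<le> 3 * \<Lambda>" using lm \<Lambda>2 by linarith
  qed
  have lq: "0 \<le> ln (real q)" "ln (real q) \<le> \<Lambda>"
  proof -
    show "0 \<le> ln (real q)" using q by simp
    have "ln (real q) \<le> ln (real d)" using qd q by (subst ln_le_cancel_iff) simp_all
    then show "ln (real q) \<le> \<Lambda>" using ld by linarith
  qed
  have lr: "0 \<le> ln (real r)" "ln (real r) \<le> \<Lambda>"
  proof -
    show "0 \<le> ln (real r)" using r by simp
    have "ln (real r) \<le> ln (real d)" using rd r by (subst ln_le_cancel_iff) simp_all
    then show "ln (real r) \<le> \<Lambda>" using ld by linarith
  qed
  have pow2: "ln (2 ^ n :: real) = n * ln 2" for n by (simp add: ln_realpow)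
  have ln21: "ln 2 \<le> (1::real)" using ln_2_less_1 by simp
  have l40: "0 \<le> ln (40::real)" "ln (40::real) \<le> 6 * ln 2"
  proof -
    have "ln (40::real) \<le> ln (2 ^ 6)" by (subst ln_le_cancel_iff) simp_all
    also have "\<dots> = 6 * ln 2" using pow2[of 6] by (simp only: of_nat_numeral)
    finally show "ln (40::real) \<le> 6 * ln 2" .
  qed simp
  have l32: "0 \<le> ln (32::real)" "ln (32::real) = 5 * ln 2"
    using pow2[of 5] by simp_all
  have l5: "0 \<le> ln (5::real)" "ln (5::real) \<le> 3"
  proof -
    have "ln (5::real) \<le> ln (2 ^ 3)" by (subst ln_le_cancel_iff) simp_all
    also have "\<dots> = 3 * ln 2" using pow2[of 3] by (simp only: of_nat_numeral)
    finally show "ln (5::real) \<le> 3" using ln21 by linarith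
  qed simp
  define n where "n = real (q - 1)"
  have n0: "n \<ge> 0" and qn: "real q = n + 1" using q by (simp_all add: n_def of_nat_diff)
  have kp: "0 < real k" and mp: "0 < real m" and rp: "0 < real r" and qp: "0 < real q" and dp: "0 < real d"
    using kpos m r q d by simp_all
  have \<theta>p: "\<theta>s > 0" unfolding \<theta>s using \<Delta> kp by simp
  have \<eta>p: "\<eta>s > 0" unfolding \<eta>s using \<theta>p \<delta> mp rp by simp
  have Tp: "T > 0" unfolding T using dp mp \<delta> by simp
  show Zp: "Z > 0" unfolding Z using dp \<Delta> qp Tp \<eta>p by simp
  have ln\<theta>: "- ln \<theta>s = n * (ln 5 + D) + ln (2 * real k)"
  proof -
    have "ln \<theta>s = ln ((\<Delta> / 5) ^ (q - 1)) - ln (2 * real k)" unfolding \<theta>s using \<Delta> kp by (subst ln_div) simp_all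
    also have "ln ((\<Delta> / 5) ^ (q - 1)) = n * ln (\<Delta> / 5)" unfolding n_def using \<Delta> by (simp add: ln_realpow)
    also have "ln (\<Delta> / 5) = - D - ln 5" using \<Delta> by (simp add: D_def ln_div)
    finally show ?thesis by (simp add: algebra_simps)
  qed
  have ln\<eta>: "- ln \<eta>s = - ln \<theta>s + ln (1 / \<delta>) + ln 32 + ln (real m) + (n + 2) * ln (real r)"
  proof -
    have "ln \<eta>s = ln (\<theta>s * \<delta>) - ln (32 * m * r ^ (q + 1))"
      unfolding \<eta>s using \<theta>p \<delta> mp rp by (subst ln_div) simp_all
    also have "ln (\<theta>s * \<delta>) = ln \<theta>s + ln \<delta>" using \<theta>p \<delta> by (subst ln_mult_pos) simp_all
    also have "ln (32 * m * r ^ (q + 1)) = ln 32 + ln (real m) + (n + 2) * ln (real r)"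
    proof -
      have "ln (32 * real m * real (r ^ (q + 1))) = ln 32 + ln (real m) + ln (real r ^ (q + 1))"
        using mp rp by (simp add: ln_mult_pos)
      also have "ln (real r ^ (q + 1)) = (n + 2) * ln (real r)" unfolding ln_realpow using qn by simp
      finally show ?thesis by simp
    qed
    finally show ?thesis using \<delta> by (simp add: ln_div)
  qed
  have lnT: "ln T = ln 2 + ln (real d) + ln (real m) + ln (1 / \<delta>)"
  proof -
    have "ln T = ln (2 * real d * real m) - ln \<delta>" unfolding T using dp mp \<delta> by (subst ln_div) simp_all
    also have "ln (2 * real d * real m) = ln 2 + ln (real d) + ln (real m)" using dp mp by (simp add: ln_mult_pos)
    finally show ?thesis using \<delta> by (simp add: ln_div)
  qed
  have lnZ: "ln Z = ln 40 + ln (real d) + n * D + (ln (real q) + ln T) / 2 - ln \<eta>s"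
  proof -
    have "ln Z = ln (40 * real d * (1 / \<Delta>) ^ (q - 1)) + ln (sqrt (q * T) / \<eta>s)"
      unfolding Z using dp \<Delta> qp Tp \<eta>p by (subst ln_mult_pos) simp_all
    also have "ln (40 * real d * (1 / \<Delta>) ^ (q - 1)) = ln (40 * real d) + ln ((1 / \<Delta>) ^ (q - 1))"
      using dp \<Delta> by (subst ln_mult_pos) simp_all
    also have "ln (40 * real d) = ln 40 + ln (real d)" using dp by (subst ln_mult_pos) simp_all
    also have "ln ((1 / \<Delta>) ^ (q - 1)) = n * D" unfolding n_def D_def using \<Delta> by (subst ln_realpow) simp_all
    also have "ln (sqrt (q * T) / \<eta>s) = ln (sqrt (q * T)) - ln \<eta>s" using qp Tp \<eta>p by (subst ln_div) simp_all
    also have "ln (sqrt (q * T)) = ln (q * T) / 2" using qp Tp by (simp add: ln_sqrt)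
    also have "ln (q * T) = ln (real q) + ln T" using qp Tp by (subst ln_mult_pos) simp_all
    finally show ?thesis by simp
  qed
  have nD: "0 \<le> n * D" "0 \<le> n * ln 5" "0 \<le> n * ln (real r)" using n0 D0 l5 lr by simp_all
  have expand: "ln Z = ln 40 + ln (real d) + n * D + (ln (real q) + ln 2 + ln (real d) + ln (real m) + ln (1 / \<delta>)) / 2
     + n * ln 5 + n * D + ln (2 * real k) + ln (1 / \<delta>) + ln 32 + ln (real m) + n * ln (real r) + 2 * ln (real r)"
    using lnZ lnT ln\<eta> ln\<theta> by (simp add: algebra_simps)
  have ln20: "0 \<le> ln (2::real)" by simp
  show "ln Z \<ge> 0"
    unfolding expand using nD l40(1) ld(2) lq(1) lm(1) l\<delta>(2) lk(1) l32(1) lr(1) ln20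
    by (intro add_nonneg_nonneg divide_nonneg_nonneg) simp_all
  have upper: "ln Z \<le> 2 * (n * D) + n * (ln 5 + ln (real r)) + 30 * \<Lambda>"
  proof -
    have "(ln (real q) + ln 2 + ln (real d) + ln (real m) + ln (1 / \<delta>)) / 2 \<le> 3 * \<Lambda>"
      using lq(2) \<Lambda>2 ld(1) lm(2) l\<delta>(1) by simp
    then show ?thesis
      unfolding expand distrib_left using l40(2) ld(1) \<Lambda>2 lm(2) l\<delta>(1) lk(2) l32(2) lr(2) \<Lambda>23 by linarith
  qed
  (* For q = 1 the left-hand side is 0; for k q = 2 it is bounded by a constant, as D may be 0 then. *)
  have tail: "n * (3 + ln 5 + ln (real r)) \<le> 11 * (n * D) + 11 * \<Lambda>"
  proof (cases "q = 1")
    case True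
    then show ?thesis using \<Lambda>23 by (simp add: n_def)
  next
    case False
    then have q2: "q \<ge> 2" using q by simp
    have Rq: "q \<le> k * q" using kpos by simp
    show ?thesis
    proof (cases "k * q = 2")
      case True
      then have "q = 2" "r \<le> 2" using q2 Rq rR by simp_all
      then have n1: "n = 1" by (simp add: n_def)
      have "ln (real r) \<le> ln 2" using \<open>r \<le> 2\<close> r by (subst ln_le_cancel_iff) simp_all
      then have "3 + ln 5 + ln (real r) \<le> 7" using l5 ln21 by linarith
      then show ?thesis unfolding n1 using \<Lambda>23 D0 by simp
    next
      case False
      then have R3: "k * q \<ge> 3" using Rq q2 by linarith
      define R where "R = real (k * q)"
      have R3': "R \<ge> 3" using R3 by (simp add: R_def del: of_nat_mult)
      have "R - 1 \<le> 1 / \<Delta>" using \<Delta>R \<Delta> by (simp add: R_def pos_le_divide_eq mult.commute del: of_nat_mult)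
      then have lnR1: "ln (R - 1) \<le> D" unfolding D_def using R3' \<Delta> by (subst ln_le_cancel_iff) simp_all
      have "ln 2 \<le> ln (R - 1)" using R3' by (subst ln_le_cancel_iff) simp_all
      then have D23: "2 / 3 \<le> D" using lnR1 ln2_ge_two_thirds by linarith
      have "R \<le> (R - 1)\<^sup>2"
      proof -
        have "0 \<le> (R - 3) * R" using R3' by simp
        then show ?thesis by (simp add: power2_eq_square algebra_simps)
      qed
      then have "ln R \<le> ln ((R - 1)\<^sup>2)" using R3' by (subst ln_le_cancel_iff) simp_all
      also have "\<dots> = 2 * ln (R - 1)" using R3' by (simp add: ln_realpow)
      finally have "ln R \<le> 2 * D" using lnR1 by linarith
      moreover have "ln (real r) \<le> ln R"
      proof -
        have "real r \<le> R" using rR unfolding R_def by (simp only: of_nat_le_iff)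
        then show ?thesis using rp by (subst ln_le_cancel_iff) simp_all
      qed
      ultimately have "3 + ln 5 + ln (real r) \<le> 11 * D" using l5 D23 by linarith
      then have "n * (3 + ln 5 + ln (real r)) \<le> n * (11 * D)" using n0 by (rule mult_left_mono)
      then show ?thesis using \<Lambda>23 by simp
    qed
  qed
  have n_le: "n \<le> 2 * (r / m)"
  proof -
    have "real m \<le> 2 * real k" using k m by (simp add: of_nat_diff)
    then have "r / k \<le> r / (m / 2)" using rp mp kp by (intro divide_left_mono) simp_all
    also have "\<dots> = 2 * (r / m)" by simp
    finally show ?thesis using qr unfolding n_def by linarith
  qed
  have "3 * real q + (ln Z + 1) \<le> 13 * (n * D) + 47 * \<Lambda>"
    using upper tail \<Lambda>23 unfolding qn by (simp add: algebra_simps)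
  also have "\<dots> \<le> 13 * (2 * (r / m) * D) + 47 * \<Lambda>"
    using mult_right_mono[OF n_le D0] by simp
  also have "\<dots> = 26 * (r / m * D) + 47 * \<Lambda>" by simp
  also have "\<dots> \<le> 50 * (r / m * D) + 50 * \<Lambda>"
  proof (rule add_mono)
    show "26 * (r / m * D) \<le> 50 * (r / m * D)" using D0 by (intro mult_right_mono) simp_all
    show "47 * \<Lambda> \<le> 50 * \<Lambda>" using \<Lambda>23 by simp
  qed
  also have "\<dots> = 50 * (r / m * D + \<Lambda>)" by (simp only: distrib_left)
  finally show "real (3 * q) + (ln Z + 1) \<le> 50 * (r / m * ln (1 / \<Delta>) + ln (d / \<delta>))"
    by (simp add: D_def \<Lambda>_def)
qed

section \<open>Relative error of a fixed block\<close>

context eigenbasis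
begin

text \<open>
  Numerically, \<open>(41/20) (2/\<pi>) (2 + l/2) \<le> log 16 + l\<close> for \<open>l = log \<kappa> \<ge> 0\<close>, as the left-hand constant term
  is about 2.61 and \<open>log 16\<close> about 2.77.
\<close>

lemma relative_error_bound:
  assumes B: "B \<in> carrier_mat d m" and i0: "i0 < m" and d: "d \<ge> 1" and F: "0 \<le> F" "F \<le> 41 / 20 * X"
    and energy: "\<And>z. z \<ge> 0 \<Longrightarrow> energy (z\<^sup>2) (cg_residual B t i0 (z\<^sup>2))
         \<le> F\<^sup>2 * (\<Sum>i\<in>{1..d}. (co (col B i0) i)\<^sup>2 / (ev i + z\<^sup>2))"
  shows "norm2 (mat_sqrt A *\<^sub>v col B i0 - bsq A B t i0) / (mat_norm (mat_sqrt A) * norm2 (col B i0))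
    \<le> ln (16 * (ev 1 / ev d)) * X"
proof -
  note One_nat_def [simp del]
  have evd: "ev d > 0" "ev d \<le> ev 1" and ev1: "ev 1 > 0"
    using ev_pos[of d] ev_pos[of 1] ev_antimono[of 1 d] d by simp_all
  define l where "l = ln (ev 1 / ev d)"
  have l0: "l \<ge> 0" using evd by (simp add: l_def)
  have X0: "0 \<le> X" using F by linarith
  have ln16: "ln (16 * (ev 1 / ev d)) = ln 16 + l"
    unfolding l_def using evd ev1 by (subst ln_mult_pos) simp_all
  have l16: "8 / 3 \<le> ln (16::real)"
  proof -
    have "ln (16::real) = ln (2 ^ 4)" by simp
    also have "\<dots> = 4 * ln 2" by (simp only: ln_realpow of_nat_numeral)
    finally show ?thesis using ln2_ge_two_thirds by linarith
  qed
  have const: "41 / 20 * (2 / pi * (2 + l / 2)) \<le> ln 16 + l"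
  proof -
    have "pi \<ge> 31 / 10" using pi_approx(1) by simp
    then have "2 / pi \<le> 2 / (31 / 10)" by (intro divide_left_mono) simp_all
    then have "41 / 20 * (2 / pi * (2 + l / 2)) \<le> 41 / 20 * (2 / (31 / 10) * (2 + l / 2))"
      using l0 by (intro mult_left_mono mult_right_mono) simp_all
    also have "\<dots> = 82 / 31 + 41 / 62 * l" by simp
    finally show ?thesis using l16 l0 by linarith
  qed
  define nb where "nb = norm2 (col B i0)"
  have colB: "col B i0 \<in> carrier_vec d" using B by auto
  have nb: "nb \<ge> 0" by (simp add: nb_def norm2_co[OF colB] sum_nonneg)
  define N where "N = mat_norm (mat_sqrt A)"
  have S: "sqrt (ev 1) > 0" "sqrt (ev 1) \<le> N" using ev1 mat_norm_sqrt_ge[OF d] by (simp_all add: N_def)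
  have K0: "0 \<le> ln 16 + l" using l16 l0 by simp
  show ?thesis
  proof (cases "nb = 0")
    case True
    then show ?thesis using K0 X0 unfolding ln16 nb_def[symmetric] by simp
  next
    case False
    then have nbp: "nb > 0" using nb by simp
    have "norm2 (mat_sqrt A *\<^sub>v col B i0 - bsq A B t i0)
        \<le> F * nb * (2 / pi * (sqrt (ev 1) * (2 + l / 2)))"
      unfolding nb_def l_def by (rule bsq_error_bound[OF B i0 d F(1) energy])
    also have "\<dots> \<le> (41 / 20 * X) * nb * (2 / pi * (sqrt (ev 1) * (2 + l / 2)))"
      using F(2) nb S l0 by (intro mult_right_mono) simp_all
    also have "\<dots> = X * nb * sqrt (ev 1) * (41 / 20 * (2 / pi * (2 + l / 2)))" by (simp only: mult_ac)
    also have "\<dots> \<le> X * nb * N * (ln 16 + l)"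
    proof (rule mult_mono)
      show "X * nb * sqrt (ev 1) \<le> X * nb * N" using X0 nb S(2) by (intro mult_left_mono) simp_all
      show "0 \<le> X * nb * N" using X0 nb S by (intro mult_nonneg_nonneg) linarith+
      show "0 \<le> 41 / 20 * (2 / pi * (2 + l / 2))" using l0 by simp
    qed (rule const)
    also have "\<dots> = (ln 16 + l) * X * (N * nb)" by simp
    finally have num: "norm2 (mat_sqrt A *\<^sub>v col B i0 - bsq A B t i0) \<le> (ln 16 + l) * X * (N * nb)" .
    have "0 < N * nb" using nbp S by (intro mult_pos_pos) linarith+
    with num show ?thesis unfolding ln16 N_def[symmetric] nb_def[symmetric] by (simp only: pos_divide_le_eq)
  qed
qed

abbreviation error_ratio :: "real mat \<Rightarrow> nat \<Rightarrow> nat \<Rightarrow> real" where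
  "error_ratio B t i \<equiv> norm2 (mat_sqrt A *\<^sub>v col B i - bsq A B t i) / (mat_norm (mat_sqrt A) * norm2 (col B i))"

abbreviation rate_bound :: "nat \<Rightarrow> nat \<Rightarrow> nat \<Rightarrow> real" where
  "rate_bound r s t \<equiv> ln (16 * (ev 1 / ev d)) * exp (- (real t - real s) / (3 * sqrt (ev (r + 1) / ev d)))"

lemma error_ratio_startup:
  assumes B: "B \<in> carrier_mat d m" and i0: "i0 < m" and d: "d \<ge> 1" and r: "r + 1 \<le> d" and t: "t < s"
  shows "error_ratio B t i0 \<le> rate_bound r s t"
proof (rule relative_error_bound[OF B i0 d, where F = 1])
  have "0 \<le> ev (r + 1) / ev d" using ev_pos[of d] ev_pos[of "r + 1"] r by (simp add: divide_nonneg_nonneg)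
  then have "1 \<le> exp (- (real t - real s) / (3 * sqrt (ev (r + 1) / ev d)))"
    using t by simp
  then show "1 \<le> 41 / 20 * exp (- (real t - real s) / (3 * sqrt (ev (r + 1) / ev d)))" by linarith
next
  fix z :: real
  have "energy (z\<^sup>2) (cg_residual B t i0 (z\<^sup>2)) \<le> (\<Sum>i\<in>{1..d}. (co (col B i0) i)\<^sup>2 / (ev i + z\<^sup>2))"
    by (rule cg_energy_trivial[OF B i0]) simp
  then show "energy (z\<^sup>2) (cg_residual B t i0 (z\<^sup>2)) \<le> 1\<^sup>2 * (\<Sum>i\<in>{1..d}. (co (col B i0) i)\<^sup>2 / (ev i + z\<^sup>2))" by simp
qed simp

lemma error_ratio_exact:
  assumes B: "B \<in> carrier_mat d m" and i0: "i0 < m" and r: "r + 1 \<le> d"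
  shows "error_ratio B t i0 \<le> rate_bound r d t"
proof (cases "t < d")
  case True
  then show ?thesis using error_ratio_startup[OF B i0 _ r, of t d] r by simp
next
  case False
  then have t: "d \<le> t" by simp
  show ?thesis
  proof (rule relative_error_bound[OF B i0, where F = 0])
    fix z :: real
    have "energy (z\<^sup>2) (cg_residual B t i0 (z\<^sup>2)) \<le> 0"
      by (rule cg_energy_exact[OF B i0 _ t]) simp
    then show "energy (z\<^sup>2) (cg_residual B t i0 (z\<^sup>2)) \<le> 0\<^sup>2 * (\<Sum>i\<in>{1..d}. (co (col B i0) i)\<^sup>2 / (ev i + z\<^sup>2))" by simp
  qed (use r in simp_all)
qed

lemma error_ratio_deflated:
  assumes B: "B \<in> carrier_mat d m" and i0: "i0 < m" and r: "r + 1 \<le> d"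
    and J1: "finite J1" "card J1 \<le> c"
    and U: "\<And>j l. j \<in> top_set r - J1 \<Longrightarrow> l < m \<Longrightarrow> degree_below n (U j l)"
    and Uc: "\<And>j i. j \<in> top_set r - J1 \<Longrightarrow> i \<in> top_set r - J1 \<Longrightarrow>
        (\<Sum>l<m. poly (U j l) (ev i) * co (col B l) i) = (if i = j then 1 else 0)"
    and U\<epsilon>: "\<And>j i. j \<in> top_set r - J1 \<Longrightarrow> i \<in> {1..d} - top_set r \<Longrightarrow>
        \<bar>\<Sum>l<m. poly (U j l) (ev i) * co (col B l) i\<bar> \<le> 1 / (40 * real d)"
  shows "error_ratio B t i0 \<le> rate_bound r (n + c) t"
proof (cases "t < n + c")
  case True
  then show ?thesis using error_ratio_startup[OF B i0 _ r True] r by linarith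
next
  case False
  then have t: "n + c \<le> t" by simp
  show ?thesis
  proof (rule relative_error_bound[OF B i0 _ _ order.refl])
    fix z :: real
    show "energy (z\<^sup>2) (cg_residual B t i0 (z\<^sup>2))
      \<le> (41 / 20 * exp (- (real t - real (n + c)) / (3 * sqrt (ev (r + 1) / ev d))))\<^sup>2
        * (\<Sum>i\<in>{1..d}. (co (col B i0) i)\<^sup>2 / (ev i + z\<^sup>2))"
      by (rule cg_energy_deflated[OF B i0 _ r J1 t U Uc U\<epsilon>]) simp
  qed (use r in simp_all)
qed

lemma error_ratio_no_deflation:
  assumes B: "B \<in> carrier_mat d m" and i0: "i0 < m" and d: "d \<ge> 1"
  shows "error_ratio B t i0 \<le> rate_bound 0 0 t"
  using error_ratio_deflated[OF B i0, of 0 "{}" 0 0 "\<lambda>_ _. 0" t] d by simp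

text \<open>
  Combines \<open>exists_well_conditioned_rows\<close>, \<open>approximate_top_eigenvectors\<close> and \<open>error_ratio_deflated\<close>.  The loss \<open>3 q + s'\<close> is
  the degree \<open>2 q + s'\<close> of the approximate eigenvectors plus \<open>q\<close> zeros for the indices given up.  Deflation works
  with the first \<open>m - 1\<close> columns because the gap condition is about multiples of \<open>m - 1\<close>.
\<close>

lemma error_ratio_good_block:
  assumes B: "B \<in> carrier_mat d m" and i0: "i0 < m" and r: "r + 1 \<le> d"
    and q: "q \<ge> 1" and rq: "r \<le> (m - 1) * q"
    and \<Delta>: "0 < \<Delta>" "\<Delta> \<le> 1"
    and sep: "\<And>i j. i \<in> {1..r} \<Longrightarrow> j \<in> {1..r} \<Longrightarrow> i \<noteq> j \<Longrightarrow> \<Delta> * ev 1 \<le> \<bar>ev i - ev j\<bar>"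
    and \<eta>: "0 < \<eta>"
    and good: "\<And>T j l. T \<subseteq> {1..r} \<Longrightarrow> card T \<le> q \<Longrightarrow> j \<in> T \<Longrightarrow> l < m - 1 \<Longrightarrow>
       block_rows.dsq {..<m - 1} q rel_ev (gram_rows B) ({1..r} - T) (block_rows.row rel_ev (gram_rows B) j) < \<eta> \<Longrightarrow>
       block_rows.dsq {..<m - 1} q rel_ev (gram_rows B) ({1..r} - T) (block_rows.node rel_ev l j)
         < ((\<Delta> / 5) ^ (q - 1) / (2 * real (m - 1)))\<^sup>2"
    and T: "(\<Sum>l<m. (norm2 (col B l))\<^sup>2) \<le> T"
    and \<epsilon>: "(1 / 4) ^ s' * (1 / \<Delta>) ^ (q - 1) * sqrt (q * T / \<eta>) \<le> 1 / (40 * real d)"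
  shows "error_ratio B t i0 \<le> rate_bound r (3 * q + s') t"
proof -
  note One_nat_def [simp del]
  have BR: "block_rows {..<m - 1}" by standard simp
  have d1: "d \<ge> 1" and ev1: "ev 1 > 0" using ev_pos[of 1] r by simp_all
  have "\<exists>J1\<subseteq>{1..r}. card J1 < q \<and> (\<forall>j\<in>{1..r} - J1. \<eta> \<le> block_rows.dsq {..<m - 1} q rel_ev (gram_rows B) ({1..r} - J1 - {j}) (block_rows.row rel_ev (gram_rows B) j))"
  proof (rule block_rows.exists_well_conditioned_rows[OF BR _ _ q _ _ \<Delta>])
    show "card {1..r} \<le> card {..<m - 1} * q" using rq by simp
    show "0 \<le> rel_ev j \<and> rel_ev j \<le> 1" if "j \<in> {1..r}" for j
      using that ev_pos[of j] ev_antimono[of 1 j] ev1 r by simp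
    show "\<Delta> \<le> \<bar>rel_ev i - rel_ev j\<bar>" if "i \<in> {1..r}" "j \<in> {1..r}" "i \<noteq> j" for i j
    proof -
      have "\<Delta> \<le> \<bar>ev i - ev j\<bar> / ev 1" using sep[OF that] ev1 by (simp add: pos_le_divide_eq)
      also have "\<dots> = \<bar>rel_ev i - rel_ev j\<bar>" using ev1 by (simp add: diff_divide_distrib[symmetric])
      finally show ?thesis .
    qed
    show "block_rows.dsq {..<m - 1} q rel_ev (gram_rows B) ({1..r} - T) (block_rows.node rel_ev l j)
         < ((\<Delta> / 5) ^ (q - 1) / real (2 * card {..<m - 1}))\<^sup>2"
      if "T \<subseteq> {1..r}" "card T \<le> q" "j \<in> T" "l \<in> {..<m - 1}"
       "block_rows.dsq {..<m - 1} q rel_ev (gram_rows B) ({1..r} - T) (block_rows.row rel_ev (gram_rows B) j) < \<eta>" for T j l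
      using good[OF that(1-3) _ that(5), of l] that(4) by simp
  qed simp
  then obtain J1 where J1: "J1 \<subseteq> {1..r}" "card J1 < q"
    and wc: "\<And>j. j \<in> {1..r} - J1 \<Longrightarrow> \<eta> \<le> block_rows.dsq {..<m - 1} q rel_ev (gram_rows B) ({1..r} - J1 - {j}) (block_rows.row rel_ev (gram_rows B) j)"
    by (elim exE conjE) (rule that, assumption+, rule bspec)
  have L: "{..<m - 1} \<subseteq> {..<m}" by auto
  have "\<exists>U. (\<forall>j\<in>top_set r - J1. \<forall>l<m. degree_below (2 * q + s') (U j l)) \<and>
    (\<forall>j\<in>top_set r - J1. \<forall>i\<in>top_set r - J1. (\<Sum>l<m. poly (U j l) (ev i) * co (col B l) i) = (if i = j then 1 else 0)) \<and>
    (\<forall>j\<in>top_set r - J1. \<forall>i\<in>{1..d} - top_set r. \<bar>\<Sum>l<m. poly (U j l) (ev i) * co (col B l) i\<bar> \<le> 1 / (40 * real d))"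
    by (rule approximate_top_eigenvectors[OF B L r q \<Delta>(1) _ J1 \<Delta>(2) \<eta> _ T \<epsilon>]) (erule (2) sep, erule wc)
  then obtain U where U: "\<forall>j\<in>top_set r - J1. \<forall>l<m. degree_below (2 * q + s') (U j l)"
    "\<forall>j\<in>top_set r - J1. \<forall>i\<in>top_set r - J1. (\<Sum>l<m. poly (U j l) (ev i) * co (col B l) i) = (if i = j then 1 else 0)"
    "\<forall>j\<in>top_set r - J1. \<forall>i\<in>{1..d} - top_set r. \<bar>\<Sum>l<m. poly (U j l) (ev i) * co (col B l) i\<bar> \<le> 1 / (40 * real d)"
    by (elim exE conjE) (rule that)
  have finJ1: "finite J1" using J1(1) finite_subset by blast
  have "error_ratio B t i0 \<le> rate_bound r (2 * q + s' + q) t"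
  proof (rule error_ratio_deflated[OF B i0 r finJ1])
    show "card J1 \<le> q" using J1(2) by simp
    show "degree_below (2 * q + s') (U j l)" if "j \<in> top_set r - J1" "l < m" for j l
      using U(1) that by blast
    show "(\<Sum>l<m. poly (U j l) (ev i) * co (col B l) i) = (if i = j then 1 else 0)"
      if "j \<in> top_set r - J1" "i \<in> top_set r - J1" for j i
      using bspec[OF bspec[OF U(2) that(1)] that(2)] .
    show "\<bar>\<Sum>l<m. poly (U j l) (ev i) * co (col B l) i\<bar> \<le> 1 / (40 * real d)"
      if "j \<in> top_set r - J1" "i \<in> {1..d} - top_set r" for j i
      using bspec[OF bspec[OF U(3) that(1)] that(2)] .
  qed
  moreover have "2 * q + s' + q = 3 * q + s'" by simp
  ultimately show ?thesis by (simp only:)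
qed

end

section \<open>Relative error of a Gaussian block\<close>

lemma sets_gaussian_law: "sets (gaussian_law d m) = sets (\<Pi>\<^sub>M k\<in>{..<d} \<times> {..<m}. borel)"
  unfolding gaussian_law_def by (rule sets_PiM_cong) simp_all

lemma space_gaussian_law: "space (gaussian_law d m) = space (\<Pi>\<^sub>M k\<in>{..<d} \<times> {..<m}. borel)"
  by (rule sets_eq_imp_space_eq[OF sets_gaussian_law])

lemma prob_space_gaussian_law: "prob_space (gaussian_law d m)"
  unfolding gaussian_law_def by (intro prob_space_PiM prob_space_normal_density) simp

lemma norm2_measurable:
  assumes dim: "\<And>\<omega>. dim_vec (x \<omega>) = n"
    and meas: "\<And>p. p < n \<Longrightarrow> (\<lambda>\<omega>. x \<omega> $ p) \<in> borel_measurable M"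
  shows "(\<lambda>\<omega>. norm2 (x \<omega>)) \<in> borel_measurable M"
proof -
  have "(\<lambda>\<omega>. \<Sum>p\<in>{0..<n}. x \<omega> $ p * x \<omega> $ p) \<in> borel_measurable M"
    by (intro borel_measurable_sum borel_measurable_times meas) simp_all
  then show ?thesis unfolding norm2_def scalar_prod_def dim by measurable
qed

lemma block_of_carrier: "block_of d m \<omega> \<in> carrier_mat d m"
  by (simp add: block_of_def)

context eigenbasis
begin

text \<open>
  The integrand is jointly measurable in the outcome and \<open>z\<close> since it is built from \<open>residual\<close>.
\<close>

lemma bsq_index_measurable:
  assumes i0: "i0 < m" and p: "p < d"
  shows "(\<lambda>\<omega>. bsq A (block_of d m \<omega>) t i0 $ p) \<in> borel_measurable (\<Pi>\<^sub>M k\<in>{..<d} \<times> {..<m}. borel)"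
proof -
  let ?N = "\<Pi>\<^sub>M k\<in>{..<d} \<times> {..<m}. (borel :: real measure)"
  let ?P = "?N \<Otimes>\<^sub>M lborel"
  have z: "(\<lambda>u::(nat \<times> nat \<Rightarrow> real) \<times> real. (snd u)\<^sup>2) \<in> borel_measurable ?P" by measurable
  have \<beta>: "(\<lambda>u. co (col (block_of d m (fst u)) j) i) \<in> borel_measurable ?P" if j: "j < m" for j i
    unfolding gram_rows_block_of[OF j] by (rule measurable_compose[OF measurable_fst gauss_coord_measurable[OF j]])
  have res: "(\<lambda>u. cg_residual (block_of d m (fst u)) t i0 ((snd u)\<^sup>2) i) \<in> borel_measurable ?P" if i: "i \<in> {1..d}" for i
    by (rule cg_residual_measurable[OF \<beta> block_of_carrier z i0 i])
  have meas: "(\<lambda>u. \<Sum>i\<in>{1..d}. (co (col (block_of d m (fst u)) i0) i * (ev i / (ev i + (snd u)\<^sup>2))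
      - ev i * cg_residual (block_of d m (fst u)) t i0 ((snd u)\<^sup>2) i) * v i $ p) \<in> borel_measurable ?P"
  proof (rule borel_measurable_sum)
    fix i assume i: "i \<in> {1..d}"
    show "(\<lambda>u. (co (col (block_of d m (fst u)) i0) i * (ev i / (ev i + (snd u)\<^sup>2))
      - ev i * cg_residual (block_of d m (fst u)) t i0 ((snd u)\<^sup>2) i) * v i $ p) \<in> borel_measurable ?P"
      using \<beta>[OF i0, of i] res[OF i] z by measurable
  qed
  have "(\<lambda>\<omega>. \<integral>z. indicator {0..} z *\<^sub>R (\<Sum>i\<in>{1..d}. (co (col (block_of d m \<omega>) i0) i * (ev i / (ev i + z\<^sup>2))
      - ev i * cg_residual (block_of d m \<omega>) t i0 (z\<^sup>2) i) * v i $ p) \<partial>lborel) \<in> borel_measurable ?N"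
  proof (rule lborel.borel_measurable_lebesgue_integral)
    have ind: "(\<lambda>u::(nat \<times> nat \<Rightarrow> real) \<times> real. indicator {0..} (snd u) :: real) \<in> borel_measurable ?P"
      by (rule measurable_compose[OF measurable_snd borel_measurable_indicator]) simp
    have "(\<lambda>u. indicator {0..} (snd u) *\<^sub>R (\<Sum>i\<in>{1..d}. (co (col (block_of d m (fst u)) i0) i * (ev i / (ev i + (snd u)\<^sup>2))
      - ev i * cg_residual (block_of d m (fst u)) t i0 ((snd u)\<^sup>2) i) * v i $ p)) \<in> borel_measurable ?P"
      by (rule borel_measurable_scaleR[OF ind meas])
    then show "case_prod (\<lambda>\<omega> z. indicator {0..} z *\<^sub>R (\<Sum>i\<in>{1..d}. (co (col (block_of d m \<omega>) i0) i * (ev i / (ev i + z\<^sup>2))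
      - ev i * cg_residual (block_of d m \<omega>) t i0 (z\<^sup>2) i) * v i $ p)) \<in> borel_measurable ?P"
      by (simp only: split_def)
  qed
  then have "(\<lambda>\<omega>. 2 / pi * (LBINT z:{0..}. (A *\<^sub>v bcg A (block_of d m \<omega>) t i0 (z\<^sup>2)) $ p)) \<in> borel_measurable ?N"
    unfolding set_lebesgue_integral_def index_A_bcg[OF block_of_carrier i0 p] by (intro borel_measurable_times) simp_all
  then show ?thesis using p by (simp add: bsq_def)
qed

lemma error_event_measurable:
  "{\<omega> \<in> space (gaussian_law d m). \<forall>i<m. error_ratio (block_of d m \<omega>) t i \<le> c} \<in> sets (gaussian_law d m)"
proof -
  let ?N = "\<Pi>\<^sub>M k\<in>{..<d} \<times> {..<m}. (borel :: real measure)"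
  have comp: "(\<lambda>\<omega>. \<omega> (p, i)) \<in> borel_measurable ?N" if "p < d" "i < m" for p i
    using that by (intro measurable_component_singleton) simp
  have col: "(\<lambda>\<omega>. col (block_of d m \<omega>) i $ p) \<in> borel_measurable ?N" if "p < d" "i < m" for p i
    using comp[OF that] that by (simp add: block_of_def)
  have [measurable]: "(\<lambda>\<omega>. error_ratio (block_of d m \<omega>) t i) \<in> borel_measurable ?N" if i: "i < m" for i
  proof (intro borel_measurable_divide borel_measurable_times borel_measurable_const)
    show "(\<lambda>\<omega>. norm2 (col (block_of d m \<omega>) i)) \<in> borel_measurable ?N"
      by (rule norm2_measurable[where n = d]) (simp add: block_of_def, rule col[OF _ i])
    show "(\<lambda>\<omega>. norm2 (mat_sqrt A *\<^sub>v col (block_of d m \<omega>) i - bsq A (block_of d m \<omega>) t i)) \<in> borel_measurable ?N"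
    proof (rule norm2_measurable[where n = d])
      show "dim_vec (mat_sqrt A *\<^sub>v col (block_of d m \<omega>) i - bsq A (block_of d m \<omega>) t i) = d" for \<omega>
        by (simp add: bsq_def)
      fix p assume p: "p < d"
      have "(\<lambda>\<omega>. (\<Sum>p'\<in>{0..<d}. row (mat_sqrt A) p $ p' * col (block_of d m \<omega>) i $ p') - bsq A (block_of d m \<omega>) t i $ p) \<in> borel_measurable ?N"
        by (intro borel_measurable_diff borel_measurable_sum borel_measurable_times borel_measurable_const
            bsq_index_measurable[OF i p] col i) simp
      moreover have "(mat_sqrt A *\<^sub>v col (block_of d m \<omega>) i - bsq A (block_of d m \<omega>) t i) $ p
         = (\<Sum>p'\<in>{0..<d}. row (mat_sqrt A) p $ p' * col (block_of d m \<omega>) i $ p') - bsq A (block_of d m \<omega>) t i $ p" for \<omega>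
      proof -
        have "dim_row (mat_sqrt A) = d" "dim_vec (bsq A (block_of d m \<omega>) t i) = d" "dim_vec (col (block_of d m \<omega>) i) = d"
          using carrier_matD(1)[OF mat_sqrt_carrier] by (simp_all add: bsq_def block_of_def)
        then show ?thesis using p by (simp add: scalar_prod_def)
      qed
      ultimately show "(\<lambda>\<omega>. (mat_sqrt A *\<^sub>v col (block_of d m \<omega>) i - bsq A (block_of d m \<omega>) t i) $ p) \<in> borel_measurable ?N"
        by (simp only:)
    qed
  qed
  have "{\<omega> \<in> space ?N. \<forall>i\<in>{..<m}. error_ratio (block_of d m \<omega>) t i \<le> c} \<in> sets ?N"
  proof (rule sets.sets_Collect_finite_All)
    show "{\<omega> \<in> space ?N. error_ratio (block_of d m \<omega>) t i \<le> c} \<in> sets ?N" if "i \<in> {..<m}" for i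
    proof -
      have "i < m" using that by simp
      then show ?thesis by measurable
    qed
  qed simp_all
  then show ?thesis unfolding sets_gaussian_law space_gaussian_law by (simp only: lessThan_iff Ball_def)
qed

lemma prob_error_event:
  assumes Bad: "Bad \<in> sets (gaussian_law d m)" "emeasure (gaussian_law d m) Bad \<le> ennreal \<delta>" and \<delta>: "0 \<le> \<delta>"
    and ok: "\<And>\<omega> i. \<omega> \<in> space (gaussian_law d m) \<Longrightarrow> \<omega> \<notin> Bad \<Longrightarrow> i < m \<Longrightarrow> error_ratio (block_of d m \<omega>) t i \<le> c"
  shows "1 - \<delta> \<le> measure (gaussian_law d m) {\<omega> \<in> space (gaussian_law d m). \<forall>i<m. error_ratio (block_of d m \<omega>) t i \<le> c}"
proof -
  interpret P: prob_space "gaussian_law d m" by (rule prob_space_gaussian_law)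
  have "P.prob Bad \<le> \<delta>" using Bad(2) \<delta> by (simp add: P.emeasure_eq_measure)
  then have "1 - \<delta> \<le> P.prob (space (gaussian_law d m) - Bad)" by (simp add: P.prob_compl[OF Bad(1)])
  also have "\<dots> \<le> P.prob {\<omega> \<in> space (gaussian_law d m). \<forall>i<m. error_ratio (block_of d m \<omega>) t i \<le> c}"
    by (rule P.finite_measure_mono[OF _ error_event_measurable]) (use ok in blast)
  finally show ?thesis .
qed

text \<open>
  Subsets of \<open>{1..r}\<close> with at most \<open>q\<close> elements are listed as words of length \<open>q\<close>, which gives the simple count \<open>r\<^sup>q\<close>.
\<close>

definition degenerate_event :: "nat \<Rightarrow> nat \<Rightarrow> nat \<Rightarrow> real \<Rightarrow> real \<Rightarrow> (nat \<times> nat \<Rightarrow> real) set" where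
  "degenerate_event m r q \<eta> \<theta> =
     (\<Union>(xs, j, l)\<in>{(xs, j, l). set xs \<subseteq> {1..r} \<and> length xs = q \<and> j \<in> set xs \<and> l < m - 1}.
        bad_event m {..<m - 1} q \<eta> \<theta> ({1..r} - set xs) j l)"

lemma finite_degenerate_index:
  fixes r q k :: nat
  shows "finite {(xs, j, l). set xs \<subseteq> {1..r} \<and> length xs = q \<and> j \<in> set xs \<and> l < k}"
    and "card {(xs, j, l). set xs \<subseteq> {1..r} \<and> length xs = q \<and> j \<in> set xs \<and> l < k} \<le> r ^ (q + 1) * k"
proof -
  let ?X = "{(xs, j, l). set xs \<subseteq> {1..r} \<and> length xs = q \<and> j \<in> set xs \<and> l < k}"
  let ?Y = "{xs. set xs \<subseteq> {1..r} \<and> length xs = q} \<times> {1..r} \<times> {..<k}"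
  have sub: "?X \<subseteq> ?Y" by auto
  have finY: "finite ?Y" by (intro finite_cartesian_product finite_lists_length_eq) simp_all
  show "finite ?X" by (rule finite_subset[OF sub finY])
  have "card ?X \<le> card ?Y" by (rule card_mono[OF finY sub])
  also have "\<dots> = r ^ (q + 1) * k" by (simp add: card_cartesian_product card_lists_length_eq)
  finally show "card ?X \<le> r ^ (q + 1) * k" .
qed

lemma degenerate_event_prob:
  assumes r: "r \<le> d" and \<eta>: "0 \<le> \<eta>" and \<theta>: "0 < \<theta>"
  shows "degenerate_event m r q \<eta> \<theta> \<in> sets (gaussian_law d m)"
    and "emeasure (gaussian_law d m) (degenerate_event m r q \<eta> \<theta>) \<le> ennreal (real (r ^ (q + 1) * (m - 1)) * (16 * sqrt (\<eta> / \<theta>)))"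
proof -
  let ?X = "{(xs, j, l). set xs \<subseteq> {1..r} \<and> length xs = q \<and> j \<in> set xs \<and> l < m - 1}"
  let ?E = "\<lambda>(xs, j, l). bad_event m {..<m - 1} q \<eta> \<theta> ({1..r} - set xs) j l"
  have L: "{..<m - 1} \<subseteq> {..<m}" by auto
  have meas: "?E x \<in> sets (gaussian_law d m)" for x
    unfolding sets_gaussian_law split_def by (rule bad_event_measurable[OF L]) simp
  have bound: "emeasure (gaussian_law d m) (?E x) \<le> ennreal (16 * sqrt (\<eta> / \<theta>))" if "x \<in> ?X" for x
  proof -
    obtain xs j l where x: "x = (xs, j, l)" by (cases x)
    have "set xs \<subseteq> {1..r}" "j \<in> set xs" "l < m - 1" using that unfolding x by auto
    then show ?thesis
      unfolding x prod.case using r by (intro prob_bad_event[OF L _ _ _ _ _ \<eta> \<theta>]) auto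
  qed
  show "degenerate_event m r q \<eta> \<theta> \<in> sets (gaussian_law d m)"
    unfolding degenerate_event_def by (rule sets.finite_UN[OF finite_degenerate_index(1) meas])
  have "emeasure (gaussian_law d m) (degenerate_event m r q \<eta> \<theta>) \<le> (\<Sum>x\<in>?X. emeasure (gaussian_law d m) (?E x))"
    unfolding degenerate_event_def by (rule emeasure_subadditive_finite[OF finite_degenerate_index(1)]) (use meas in blast)
  also have "\<dots> \<le> of_nat (card ?X) * ennreal (16 * sqrt (\<eta> / \<theta>))"
    by (rule sum_bounded_above[OF bound])
  also have "\<dots> = ennreal (real (card ?X) * (16 * sqrt (\<eta> / \<theta>)))"
    using \<eta> \<theta> by (simp add: ennreal_mult ennreal_of_nat_eq_real_of_nat)
  also have "\<dots> \<le> ennreal (real (r ^ (q + 1) * (m - 1)) * (16 * sqrt (\<eta> / \<theta>)))"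
    by (intro ennreal_leI mult_right_mono) (simp_all only: of_nat_le_iff finite_degenerate_index(2), use \<eta> \<theta> in simp)
  finally show "emeasure (gaussian_law d m) (degenerate_event m r q \<eta> \<theta>) \<le> ennreal (real (r ^ (q + 1) * (m - 1)) * (16 * sqrt (\<eta> / \<theta>)))" .
qed

lemma not_degenerate:
  assumes \<omega>: "\<omega> \<in> space (gaussian_law d m)" "\<omega> \<notin> degenerate_event m r q \<eta> \<theta>"
    and T: "T \<subseteq> {1..r}" "card T \<le> q" and j: "j \<in> T" and l: "l < m - 1"
    and small: "block_rows.dsq {..<m - 1} q rel_ev (gram_rows (block_of d m \<omega>)) ({1..r} - T) (block_rows.row rel_ev (gram_rows (block_of d m \<omega>)) j) < \<eta>"
  shows "block_rows.dsq {..<m - 1} q rel_ev (gram_rows (block_of d m \<omega>)) ({1..r} - T) (block_rows.node rel_ev l j) < \<theta>"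
proof -
  have BR: "block_rows {..<m - 1}" by standard simp
  have finT: "finite T" using T(1) finite_subset by blast
  obtain xs where xs: "set xs = T" "length xs = q"
  proof -
    obtain ys where ys: "set ys = T" "distinct ys" using finite_distinct_list[OF finT] by blast
    have "length ys \<le> q" using T(2) distinct_card[OF ys(2)] ys(1) by simp
    then have "length (ys @ replicate (q - length ys) j) = q" by simp
    moreover have "set (ys @ replicate (q - length ys) j) = T"
      using ys(1) j by (simp add: set_replicate_conv_if insert_absorb)
    ultimately show ?thesis using that by blast
  qed
  have "\<omega> \<notin> bad_event m {..<m - 1} q \<eta> \<theta> ({1..r} - T) j l"
    using \<omega>(2) xs T(1) j l unfolding degenerate_event_def by blast
  moreover have gp_eq: "gram_rows (block_of d m \<omega>) i b = gauss_coord \<omega> i b" if "b \<in> {..<m - 1}" for i b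
    using that by (intro gram_rows_block_of) simp
  moreover have "block_rows.dsq {..<m - 1} q rel_ev (gram_rows (block_of d m \<omega>)) ({1..r} - T) (block_rows.row rel_ev (gram_rows (block_of d m \<omega>)) j)
     = block_rows.dsq {..<m - 1} q rel_ev (gauss_coord \<omega>) ({1..r} - T) (block_rows.row rel_ev (gauss_coord \<omega>) j)"
    by (rule dsq_cong) (auto simp: block_rows.row_def[OF BR] gp_eq)
  moreover have "block_rows.dsq {..<m - 1} q rel_ev (gram_rows (block_of d m \<omega>)) ({1..r} - T) (block_rows.node rel_ev l j)
     = block_rows.dsq {..<m - 1} q rel_ev (gauss_coord \<omega>) ({1..r} - T) (block_rows.node rel_ev l j)"
    by (rule dsq_cong) (auto simp: gp_eq)
  ultimately show ?thesis
    using small \<omega>(1) unfolding bad_event_def space_gaussian_law by (simp add: not_le)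
qed

end

context eigenbasis
begin

text \<open>
  The gaps are disjoint parts of the interval from 0 to \<open>\<lambda>\<^sub>1\<close>.
\<close>

lemma telescoped_gap:
  assumes gap: "\<And>i. i \<in> {1..<R} \<Longrightarrow> \<Delta> * ev 1 \<le> ev i - ev (i + 1)"
    and R: "1 \<le> R" "R \<le> d"
  shows "\<Delta> * (real R - 1) \<le> 1"
proof -
  note One_nat_def [simp del]
  have ev1: "ev 1 > 0" using ev_pos[of 1] R by simp
  have "\<Delta> * real n * ev 1 \<le> ev 1 - ev (n + 1)" if "n + 1 \<le> R" for n
    using that
  proof (induction n)
    case (Suc n)
    have "\<Delta> * ev 1 \<le> ev (n + 1) - ev (n + 1 + 1)" using Suc.prems by (intro gap) simp
    moreover have "\<Delta> * real n * ev 1 \<le> ev 1 - ev (n + 1)" using Suc.IH Suc.prems by simp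
    moreover have "\<Delta> * real (Suc n) * ev 1 = \<Delta> * real n * ev 1 + \<Delta> * ev 1" by (simp add: algebra_simps)
    moreover have "Suc n + 1 = n + 1 + 1" by simp
    ultimately show ?case by (simp only:)
  qed simp
  from this[of "R - 1"] have "\<Delta> * real (R - 1) * ev 1 \<le> ev 1 - ev R" using R by simp
  also have "\<dots> \<le> 1 * ev 1" using ev_pos[of R] R by simp
  finally have "\<Delta> * real (R - 1) \<le> 1" using ev1 by (simp only: mult_le_cancel_right)
  then show ?thesis using R by (simp add: of_nat_diff)
qed

lemma separated_top_eigenvalues:
  assumes gap: "\<And>i. i \<in> {1..<R} \<Longrightarrow> c \<le> ev i - ev (i + 1)"
    and r: "r \<le> R" "R \<le> d" and ij: "i \<in> {1..r}" "j \<in> {1..r}" "i \<noteq> j"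
  shows "c \<le> \<bar>ev i - ev j\<bar>"
proof -
  have *: "c \<le> \<bar>ev i - ev j\<bar>" if "i \<in> {1..r}" "j \<in> {1..r}" "i < j" for i j
  proof -
    have "c \<le> ev i - ev (i + 1)" using that r by (intro gap) simp
    moreover have "ev j \<le> ev (i + 1)" using that r by (intro ev_antimono) simp_all
    ultimately show ?thesis by simp
  qed
  show ?thesis
  proof (cases "i < j")
    case True
    then show ?thesis using * ij by blast
  next
    case False
    then have "c \<le> \<bar>ev j - ev i\<bar>" using * ij by (intro *) simp_all
    then show ?thesis by (simp only: abs_minus_commute)
  qed
qed

lemma sum_norm2_block_of:
  "(\<Sum>l<m. (norm2 (col (block_of d m \<omega>) l))\<^sup>2) = (\<Sum>k\<in>{..<d} \<times> {..<m}. (\<omega> k)\<^sup>2)"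
proof -
  have "(norm2 (col (block_of d m \<omega>) l))\<^sup>2 = (\<Sum>p<d. (\<omega> (p, l))\<^sup>2)" if "l < m" for l
    using that by (simp add: norm2_def scalar_prod_def block_of_def atLeast0LessThan power2_eq_square[symmetric] sum_nonneg)
  then have "(\<Sum>l<m. (norm2 (col (block_of d m \<omega>) l))\<^sup>2) = (\<Sum>l<m. \<Sum>p<d. (\<omega> (p, l))\<^sup>2)" by (intro sum.cong) simp_all
  also have "\<dots> = (\<Sum>p<d. \<Sum>l<m. (\<omega> (p, l))\<^sup>2)" by (rule sum.swap)
  also have "\<dots> = (\<Sum>k\<in>{..<d} \<times> {..<m}. (\<omega> k)\<^sup>2)" unfolding sum.cartesian_product by (simp add: split_def)
  finally show ?thesis .
qed

text \<open>
  The exceptional event has two parts of probability at most \<open>\<delta>/2\<close>: an ill-conditioned row, or columns that are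
  too long.  The lower bound \<open>\<Delta>\<close> for the gaps is arbitrary, so that an empty range of gaps is covered by \<open>\<Delta> = 1\<close>.
\<close>

lemma error_probability_separated:
  assumes m: "2 \<le> m" and r: "1 \<le> r" "r + 1 \<le> d" and q: "q = nat \<lceil>real r / real (m - 1)\<rceil>"
    and R: "(m - 1) * q \<le> d"
    and \<delta>: "0 < \<delta>" "\<delta> < 1" and \<Delta>: "0 < \<Delta>" "\<Delta> \<le> 1"
    and gap: "\<And>i. i \<in> {1..<(m - 1) * q} \<Longrightarrow> \<Delta> * ev 1 \<le> ev i - ev (i + 1)"
  shows "\<exists>s::nat. real s \<le> 50 * (real r / real m * ln (1 / \<Delta>) + ln (real d / \<delta>)) \<and>
    (\<forall>t. 1 - \<delta> \<le> measure (gaussian_law d m)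
        {\<omega> \<in> space (gaussian_law d m). \<forall>i<m. error_ratio (block_of d m \<omega>) t i \<le> rate_bound r s t})"
proof -
  define k where "k = m - 1"
  have k1: "k \<ge> 1" and kr: "real k > 0" using m by (simp_all add: k_def)
  have pos: "real r / real k > 0" using r kr by simp
  have qr: "real q = of_int \<lceil>real r / real k\<rceil>" using pos unfolding q k_def[symmetric] by simp
  have qge: "real r / real k \<le> real q" unfolding qr by (rule le_of_int_ceiling)
  have q1: "q \<ge> 1" using qge pos by (cases q) simp_all
  have qlt: "real (q - 1) < real r / real k" 
  proof -
    have "real q - 1 < real r / real k" unfolding qr using ceiling_correct[of "real r / real k"] by simp
    then show ?thesis using q1 by (simp add: of_nat_diff)
  qed
  have rR: "r \<le> k * q"
  proof -
    have "real r \<le> real q * real k" using qge kr by (simp only: pos_divide_le_eq)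
    then have "real r \<le> real (k * q)" by (simp add: mult.commute)
    then show ?thesis by (simp only: of_nat_le_iff)
  qed
  have d2: "2 \<le> d" using r by simp
  (* \<theta>s is the threshold of exists_well_conditioned_rows; \<eta>s makes each of the at most r^(q+1) k bad events,
     of probability at most 16 \<eta>s / \<theta>s, small enough for a union bound. *)
  define \<theta>s where "\<theta>s = (\<Delta> / 5) ^ (q - 1) / real (2 * k)"
  define \<eta>s where "\<eta>s = \<theta>s * \<delta> / real (32 * m * r ^ (q + 1))"
  define T where "T = real (2 * d * m) / \<delta>"
  define Z where "Z = real (40 * d) * (1 / \<Delta>) ^ (q - 1) * (sqrt (real q * T) / \<eta>s)"
  have \<theta>p: "\<theta>s > 0" unfolding \<theta>s_def using \<Delta> k1 by simp
  have \<eta>p: "\<eta>s > 0" unfolding \<eta>s_def using \<theta>p \<delta> m r by simp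
  have Tp: "T > 0" unfolding T_def using d2 m \<delta> by simp
  have R1: "1 \<le> k * q" using rR r(1) by linarith
  have Rd: "k * q \<le> d" using R by (simp add: k_def)
  have \<Delta>R: "\<Delta> * (real (k * q) - 1) \<le> 1"
    by (rule telescoped_gap[OF gap R1 Rd]) (simp add: k_def)
  note count = iteration_count_bound[OF d2 m r(1) r(2) k_def q1 qlt Rd rR \<delta> \<Delta> \<Delta>R \<theta>s_def \<eta>s_def T_def Z_def]
  (* 4 > e, so this damping exponent gives 4^s' \<ge> Z. *)
  define s' where "s' = nat \<lceil>ln Z\<rceil>"
  have s': "real s' \<le> ln Z + 1" "ln Z \<le> real s'"
  proof -
    have "real s' = of_int \<lceil>ln Z\<rceil>" using count(3) by (simp add: s'_def)
    then show "real s' \<le> ln Z + 1" "ln Z \<le> real s'" using ceiling_correct[of "ln Z"] by simp_all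
  qed
  have small: "(1 / 4) ^ s' * (1 / \<Delta>) ^ (q - 1) * sqrt (q * T / \<eta>s\<^sup>2) \<le> 1 / (40 * real d)"
  proof -
    have "Z = exp (ln Z)" using count(2) by simp
    also have "\<dots> \<le> exp (real s')" using s'(2) by (simp only: exp_le_cancel_iff)
    also have "\<dots> = exp 1 ^ s'" by (simp add: exp_of_nat_mult[symmetric])
    also have "\<dots> \<le> 4 ^ s'" using exp_le by (intro power_mono) simp_all
    finally have "Z \<le> 4 ^ s'" .
    then have Z4: "(1 / 4) ^ s' * Z \<le> 1" by (simp add: power_divide)
    have sq: "sqrt (real q * T / \<eta>s\<^sup>2) = sqrt (real q * T) / \<eta>s" using \<eta>p by (simp add: real_sqrt_divide)
    have "(1 / 4) ^ s' * (1 / \<Delta>) ^ (q - 1) * sqrt (q * T / \<eta>s\<^sup>2) = ((1 / 4) ^ s' * Z) / (40 * real d)"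
      unfolding sq Z_def using d2 by simp
    also have "\<dots> \<le> 1 / (40 * real d)" by (rule divide_right_mono[OF Z4]) simp
    finally show ?thesis .
  qed
  have sep: "\<Delta> * ev 1 \<le> \<bar>ev i - ev j\<bar>" if "i \<in> {1..r}" "j \<in> {1..r}" "i \<noteq> j" for i j
    by (rule separated_top_eigenvalues[OF gap _ R that]) (use rR in \<open>simp_all add: k_def\<close>)
  define Large where "Large = {\<omega> \<in> space (gaussian_law d m). T \<le> (\<Sum>x\<in>{..<d} \<times> {..<m}. (\<omega> x)\<^sup>2)}"
  define Bad where "Bad = degenerate_event m r q (\<eta>s\<^sup>2) (\<theta>s\<^sup>2) \<union> Large"
  have \<eta>2: "0 < \<eta>s\<^sup>2" "0 \<le> \<eta>s\<^sup>2" and \<theta>2: "0 < \<theta>s\<^sup>2" using \<eta>p \<theta>p by simp_all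
  have rd: "r \<le> d" using r by simp
  note deg = degenerate_event_prob[OF rd \<eta>2(2) \<theta>2, of m q]
  have LargeM: "Large \<in> sets (gaussian_law d m)"
  proof -
    have "(\<lambda>\<omega>. \<Sum>x\<in>{..<d} \<times> {..<m}. (\<omega> x :: real)\<^sup>2) \<in> borel_measurable (\<Pi>\<^sub>M k\<in>{..<d} \<times> {..<m}. borel)"
      by (intro borel_measurable_sum borel_measurable_power measurable_component_singleton)
    then show ?thesis unfolding Large_def sets_gaussian_law space_gaussian_law by measurable
  qed
  have LargeP: "emeasure (gaussian_law d m) Large \<le> ennreal (\<delta> / 2)"
  proof -
    have "emeasure (gaussian_law d m) Large \<le> ennreal (card ({..<d} \<times> {..<m}) / T)"
      unfolding Large_def gaussian_law_def by (rule std_normal_prod_sum_squares_tail[OF _ Tp]) simp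
    also have "card ({..<d} \<times> {..<m}) / T = \<delta> / 2"
      unfolding T_def using d2 m \<delta> by (simp add: card_cartesian_product)
    finally show ?thesis .
  qed
  have degP: "emeasure (gaussian_law d m) (degenerate_event m r q (\<eta>s\<^sup>2) (\<theta>s\<^sup>2)) \<le> ennreal (\<delta> / 2)"
  proof -
    have rt: "sqrt (\<eta>s\<^sup>2 / \<theta>s\<^sup>2) = \<delta> / real (32 * m * r ^ (q + 1))"
    proof -
      have "sqrt (\<eta>s\<^sup>2 / \<theta>s\<^sup>2) = \<eta>s / \<theta>s" using \<eta>p \<theta>p by (simp add: real_sqrt_divide)
      also have "\<dots> = \<delta> / real (32 * m * r ^ (q + 1))" using \<theta>p by (simp add: \<eta>s_def)
      finally show ?thesis .
    qed
    have "real (r ^ (q + 1) * (m - 1)) * (16 * sqrt (\<eta>s\<^sup>2 / \<theta>s\<^sup>2)) = real (m - 1) / real m * (\<delta> / 2)"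
    proof -
      define w where "w = real (r ^ (q + 1))"
      have w: "w > 0" using r by (simp add: w_def)
      show ?thesis unfolding rt of_nat_mult w_def[symmetric] using w by simp
    qed
    also have "\<dots> \<le> 1 * (\<delta> / 2)" using m \<delta> by (intro mult_right_mono) simp_all
    finally have "real (r ^ (q + 1) * (m - 1)) * (16 * sqrt (\<eta>s\<^sup>2 / \<theta>s\<^sup>2)) \<le> \<delta> / 2" by simp
    from order_trans[OF deg(2) ennreal_leI[OF this]] show ?thesis .
  qed
  have BadM: "Bad \<in> sets (gaussian_law d m)" unfolding Bad_def by (rule sets.Un[OF deg(1) LargeM])
  have BadP: "emeasure (gaussian_law d m) Bad \<le> ennreal \<delta>"
  proof -
    have "emeasure (gaussian_law d m) Bad \<le> ennreal (\<delta> / 2) + ennreal (\<delta> / 2)"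
      unfolding Bad_def by (rule order_trans[OF emeasure_subadditive[OF deg(1) LargeM] add_mono[OF degP LargeP]])
    also have "\<dots> = ennreal \<delta>" using \<delta> by (subst ennreal_plus[symmetric]) simp_all
    finally show ?thesis .
  qed
  have main: "1 - \<delta> \<le> measure (gaussian_law d m)
        {\<omega> \<in> space (gaussian_law d m). \<forall>i<m. error_ratio (block_of d m \<omega>) t i \<le> rate_bound r (3 * q + s') t}" for t
  proof (rule prob_error_event[OF BadM BadP])
    show "0 \<le> \<delta>" using \<delta> by simp
    fix \<omega> i
    assume \<omega>: "\<omega> \<in> space (gaussian_law d m)" "\<omega> \<notin> Bad" and i: "i < m"
    have nd: "\<omega> \<notin> degenerate_event m r q (\<eta>s\<^sup>2) (\<theta>s\<^sup>2)" and nl: "\<omega> \<notin> Large" using \<omega>(2) by (simp_all add: Bad_def)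
    have T: "(\<Sum>l<m. (norm2 (col (block_of d m \<omega>) l))\<^sup>2) \<le> T"
      using nl \<omega>(1) unfolding Large_def sum_norm2_block_of by simp
    show "error_ratio (block_of d m \<omega>) t i \<le> rate_bound r (3 * q + s') t"
    proof (rule error_ratio_good_block[OF block_of_carrier i r(2) q1 _ \<Delta> sep \<eta>2(1) _ T small])
      show "r \<le> (m - 1) * q" using rR by (simp add: k_def)
      fix T j l
      assume "T \<subseteq> {1..r}" "card T \<le> q" "j \<in> T" "l < m - 1"
       "block_rows.dsq {..<m - 1} q rel_ev (gram_rows (block_of d m \<omega>)) ({1..r} - T) (block_rows.row rel_ev (gram_rows (block_of d m \<omega>)) j) < \<eta>s\<^sup>2"
      from not_degenerate[OF \<omega>(1) nd this]
      show "block_rows.dsq {..<m - 1} q rel_ev (gram_rows (block_of d m \<omega>)) ({1..r} - T) (block_rows.node rel_ev l j)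
         < ((\<Delta> / 5) ^ (q - 1) / (2 * real (m - 1)))\<^sup>2"
        unfolding \<theta>s_def k_def of_nat_mult of_nat_numeral .
    qed
  qed
  have "real (3 * q + s') \<le> 50 * (real r / real m * ln (1 / \<Delta>) + ln (real d / \<delta>))"
    using count(1) s'(1) by simp
  with main show ?thesis by blast
qed

lemma error_probability:
  assumes m: "2 \<le> m" and r: "r + 1 \<le> d" and R: "gap_top r m \<le> d" and \<delta>: "0 < \<delta>" "\<delta> < 1"
  shows "\<exists>s::nat. ereal (real s) \<le> ereal 50 * (gap_term ev r m + ereal (ln (real d / \<delta>))) \<and>
    (\<forall>t. 1 - \<delta> \<le> measure (gaussian_law d m)
        {\<omega> \<in> space (gaussian_law d m). \<forall>i<m. error_ratio (block_of d m \<omega>) t i \<le> rate_bound r s t})"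
proof -
  note One_nat_def [simp del]
  have d1: "d \<ge> 1" and ev1: "ev 1 > 0" using ev_pos[of 1] r by simp_all
  have sure: "1 - \<delta> \<le> measure (gaussian_law d m)
        {\<omega> \<in> space (gaussian_law d m). \<forall>i<m. error_ratio (block_of d m \<omega>) t i \<le> rate_bound r s t}"
    if "\<And>\<omega> i. i < m \<Longrightarrow> error_ratio (block_of d m \<omega>) t i \<le> rate_bound r s t" for s t
    by (rule prob_error_event[of "{}"]) (use \<delta> that in simp_all)
  have ld: "0 \<le> ln (real d / \<delta>)" using d1 \<delta> by (simp add: pos_le_divide_eq)
  show ?thesis
  proof (cases "r = 0")
    case True
    have gt: "gap_term ev r m = 0" unfolding True by (simp add: gap_term_def gap_top_def)
    have "1 - \<delta> \<le> measure (gaussian_law d m)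
        {\<omega> \<in> space (gaussian_law d m). \<forall>i<m. error_ratio (block_of d m \<omega>) t i \<le> rate_bound r 0 t}" for t
      by (rule sure) (unfold True, rule error_ratio_no_deflation[OF block_of_carrier _ d1])
    moreover have "ereal (real 0) \<le> ereal 50 * (gap_term ev r m + ereal (ln (real d / \<delta>)))"
      unfolding gt using ld by simp
    ultimately show ?thesis by blast
  next
    case False
    then have r1: "1 \<le> r" by simp
    define q where "q = nat \<lceil>real r / real (m - 1)\<rceil>"
    have top: "gap_top r m = (m - 1) * q" by (simp add: gap_top_def q_def)
    have Rd: "(m - 1) * q \<le> d" using R by (simp only: top)
    note sepd = error_probability_separated[OF m r1 r q_def Rd \<delta>]
    show ?thesis
    proof (cases "{1..<(m - 1) * q} = {}")
      case True
      have gt: "gap_term ev r m = 0" unfolding gap_term_def top using True by simp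
      show ?thesis using sepd[of 1] True unfolding gt by simp
    next
      case ne: False
      let ?g = "\<lambda>i. (ev i - ev (i + 1)) / ev 1"
      define \<Delta> where "\<Delta> = eigen_gap ev r m"
      have \<Delta>eq: "\<Delta> = Min (?g ` {1..<(m - 1) * q})" by (simp add: \<Delta>_def eigen_gap_def top)
      have le: "\<Delta> \<le> ?g i" if "i \<in> {1..<(m - 1) * q}" for i
        unfolding \<Delta>eq by (rule Min_le[OF finite_imageI[OF finite_atLeastLessThan] imageI[OF that]])
      have g0: "0 \<le> ?g i" "?g i \<le> 1" if "i \<in> {1..<(m - 1) * q}" for i
      proof -
        have "ev (i + 1) \<le> ev i" "ev i \<le> ev 1" "0 < ev (i + 1)"
          using that Rd by (auto intro!: ev_antimono ev_pos)
        then show "0 \<le> ?g i" "?g i \<le> 1" using ev1 by simp_all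
      qed
      have "\<Delta> \<in> ?g ` {1..<(m - 1) * q}" unfolding \<Delta>eq using ne by (intro Min_in) simp_all
      then have \<Delta>01: "0 \<le> \<Delta>" "\<Delta> \<le> 1" using g0 by blast+
      show ?thesis
      proof (cases "\<Delta> = 0")
        case True
        have gt: "gap_term ev r m = \<infinity>" unfolding gap_term_def top \<Delta>_def[symmetric] using True ne by simp
        have "1 - \<delta> \<le> measure (gaussian_law d m)
            {\<omega> \<in> space (gaussian_law d m). \<forall>i<m. error_ratio (block_of d m \<omega>) t i \<le> rate_bound r d t}" for t
          by (rule sure) (rule error_ratio_exact[OF block_of_carrier _ r])
        moreover have "ereal (real d) \<le> ereal 50 * (gap_term ev r m + ereal (ln (real d / \<delta>)))"
          unfolding gt by simp
        ultimately show ?thesis by blast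
      next
        case False
        have gt: "gap_term ev r m = ereal (real r / real m * ln (1 / \<Delta>))"
          unfolding gap_term_def top \<Delta>_def[symmetric] using False ne by simp
        have "\<exists>s::nat. real s \<le> 50 * (real r / real m * ln (1 / \<Delta>) + ln (real d / \<delta>)) \<and>
          (\<forall>t. 1 - \<delta> \<le> measure (gaussian_law d m)
            {\<omega> \<in> space (gaussian_law d m). \<forall>i<m. error_ratio (block_of d m \<omega>) t i \<le> rate_bound r s t})"
        proof (rule sepd)
          show "0 < \<Delta>" "\<Delta> \<le> 1" using \<Delta>01 False by simp_all
          show "\<Delta> * ev 1 \<le> ev i - ev (i + 1)" if "i \<in> {1..<(m - 1) * q}" for i
            using le[OF that] ev1 by (simp only: pos_le_divide_eq)
        qed
        then show ?thesis unfolding gt plus_ereal.simps times_ereal.simps ereal_less_eq .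
      qed
    qed
  qed
qed

end

theorem theorem5p4:
  shows "\<exists>C::real. C > 0 \<and>
    (\<forall>(d::nat) (A::real mat) (ev::nat \<Rightarrow> real) (m::nat) (r::nat) (\<delta>::real).
       symmetric_pos_def d A \<longrightarrow> ordered_eigenvalues d A ev \<longrightarrow>
       m \<ge> 2 \<longrightarrow> r + 1 \<le> d \<longrightarrow> gap_top r m \<le> d \<longrightarrow> 0 < \<delta> \<longrightarrow> \<delta> < 1 \<longrightarrow>
       (\<exists>s::int.
          ereal (real_of_int s) \<le> ereal C * (gap_term ev r m + ereal (ln (real d / \<delta>))) \<and>
          (\<forall>t::nat.
             measure (gaussian_law d m)
               {\<omega> \<in> space (gaussian_law d m). \<forall>i<m.
                  norm2 (mat_sqrt A *\<^sub>v col (block_of d m \<omega>) i - bsq A (block_of d m \<omega>) t i)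
                    / (mat_norm (mat_sqrt A) * norm2 (col (block_of d m \<omega>) i))
                  \<le> ln (16 * (ev 1 / ev d))
                    * exp (- (real t - real_of_int s) / (3 * sqrt (shifted_cond d ev (r + 1) 0)))}
             \<ge> 1 - \<delta>)))"
proof (rule exI[of _ 50], intro conjI allI impI)
  fix d m r :: nat and A :: "real mat" and ev :: "nat \<Rightarrow> real" and \<delta> :: real
  assume A: "symmetric_pos_def d A" "ordered_eigenvalues d A ev" and m: "m \<ge> 2" and r: "r + 1 \<le> d"
    and R: "gap_top r m \<le> d" and \<delta>: "0 < \<delta>" "\<delta> < 1"
  obtain v where "eigenbasis d A ev v" using eigenbasis_exists[OF A] by blast
  then interpret eigenbasis d A ev v .
  obtain s :: nat where s: "ereal (real s) \<le> ereal 50 * (gap_term ev r m + ereal (ln (real d / \<delta>)))"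
    "\<forall>t. 1 - \<delta> \<le> measure (gaussian_law d m)
        {\<omega> \<in> space (gaussian_law d m). \<forall>i<m. error_ratio (block_of d m \<omega>) t i \<le> rate_bound r s t}"
    using error_probability[OF m r R \<delta>] by (elim exE conjE) (rule that)
  have cond: "shifted_cond d ev (r + 1) 0 = ev (r + 1) / ev d" by (simp only: shifted_cond_def add_0_right)
  show "\<exists>s::int.
          ereal (real_of_int s) \<le> ereal 50 * (gap_term ev r m + ereal (ln (real d / \<delta>))) \<and>
          (\<forall>t::nat.
             measure (gaussian_law d m)
               {\<omega> \<in> space (gaussian_law d m). \<forall>i<m.
                  norm2 (mat_sqrt A *\<^sub>v col (block_of d m \<omega>) i - bsq A (block_of d m \<omega>) t i)
                    / (mat_norm (mat_sqrt A) * norm2 (col (block_of d m \<omega>) i))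
                  \<le> ln (16 * (ev 1 / ev d))
                    * exp (- (real t - real_of_int s) / (3 * sqrt (shifted_cond d ev (r + 1) 0)))}
             \<ge> 1 - \<delta>)"
    by (rule exI[of _ "int s"]) (unfold cond of_int_of_nat_eq, rule conjI[OF s])
qed simp

end
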